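(* Consider the branching random walk on $\mathbb{Z}^d$ described in the context, with $\beta^*>0$. Let $\beta^*>\beta_c$ and $\lambda_{\mathcal{E}}>0$. Then for all $n\in\mathbb{N}$ and $x,y\in\mathbb{Z}^d$, as $t\to\infty$, $$m_n(t,x,y)\sim C_n(x,y)e^{n\lambda_{\mathcal{E}}t},\qquad m_n(t,x)\sim C_n(x)e^{n\lambda_{\mathcal{E}}t},$$ where $$C_1(x,y)=\frac{G_{\lambda_0}(x,0)\,G_{\lambda_0}(0,y)}{\|G_{\lambda_0}(0,\cdot)\|^2},\qquad C_1(x)=\frac{G_{\lambda_0}(x,0)}{\lambda_0\|G_{\lambda_0}(0,\cdot)\|^2},$$ with $\|\cdot\|$ the $l^2(\mathbb{Z}^d)$ norm, and the functions $C_n(x,y),C_n(x)>0$ for $n\ge2$ are defined by $$C_n(x,y)=g_n(C_1(0,y),\dots,C_{n-1}(0,y))\,D_n(x),\qquad C_n(x)=g_n(C_1(0),\dots,C_{n-1}(0))\,D_n(x),$$ where $D_n(x)$ are certain functions (depending only on $n$ and $x$) satisfying, for some $n_*\in\mathbb{N}$, the estimate $|D_n(x)|\le\frac{2}{n\lambda_{\mathcal{E}}}$ for all $n\ge n_*$ and $x \in \mathbb{Z}^d$.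
   Context: **Random walk.** Let $d\in\mathbb{N}$. The underlying continuous-time random walk on $\mathbb{Z}^d$ has transition intensity matrix $A=(a(x,y))_{x,y\in\mathbb{Z}^d}$ with $a(x,y)\ge0$ for $x\ne y$, $a(x,x)<0$, and is regular ($\sum_y a(x,y)=0$), symmetric ($a(x,y)=a(y,x)$), spatially homogeneous ($a(x,y)=a(y-x)$, regarded as a function of one argument), time homogeneous and irreducible (every lattice point can be reached from every other). No condition on the variance of jumps is imposed. Its transition probabilities are $p(t,x,y)$; $p(h,x,y)=a(x,y)h+o(h)$ for $x\neq y$ and $p(h,x,x)=1+a(x,x)h+o(h)$ as $h\to0$. The Green's function is $G_\lambda(x,y)=\int_0^\infty e^{-\lambda t}p(t,x,y)\,dt$, $\lambda\ge0$, and $\beta_c:=1/G_0(0,0)$ (with $\beta_c=0$ if $G_0(0,0)=\infty$). **Branching and absorption.** Let $f(u)=\sum_{n\ge0}b_nu^n$, $0\le u\le1$, with $b_n\ge0$ for $n\ne1$, $b_1<0$, $\sum_nb_n=0$. A particle at $x$ during a short time $dt$ jumps to $y\ne x$ with probability $a(x,y)dt+o(dt)$, dies with probability $b_0dt+o(dt)$ (at every lattice point $x$), and, only if $x=0$, is replaced by $n>1$ particles at $0$ (itself included) with probability $b_ndt+o(dt)$; otherwise it stays unchanged. Particles evolve independently of each other and of the past. Put $\beta^*:=\sum_{n>1}(n-1)b_n$; throughout $\beta^*>0$. Put $\beta^{(r)}:=f^{(r)}(1)$, assumed finite for all $r\in\mathbb{N}$. **Moments.** $\mu(t,y)$ is the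 number of particles at $y\in\mathbb{Z}^d$ at time $t$, and $\mu(t)=\sum_y\mu(t,y)$. $\mathsf{E}_x$ is expectation when the process starts at time $0$ with one particle at $x$. $m_n(t,x,y):=\mathsf{E}_x\mu^n(t,y)$, $m_n(t,x):=\mathsf{E}_x\mu^n(t)$, $n\in\mathbb{N}$. **Evolution operator.** $(\mathcal{A}\varphi)(x)=\sum_ya(x-y)\varphi(y)$, $\Delta_0=\delta_0\delta_0^T$ (so $(\Delta_0\varphi)(x)=\varphi(0)$ if $x=0$ and $0$ otherwise), $\mathcal{E}=\mathcal{A}+\beta^*\Delta_0-b_0I$. When $\beta^*>\beta_c$, $\lambda_0>0$ denotes the unique isolated positive eigenvalue of $\mathcal{A}+\beta^*\Delta_0$ on $l^2(\mathbb{Z}^d)$, i.e. the solution of $\beta^*G_\lambda(0,0)=1$, and $\lambda_{\mathcal{E}}:=\lambda_0-b_0$ is the corresponding eigenvalue of $\mathcal{E}$. **The functions $g_n$.** For $n\ge2$, $$g_n(m_1,\ldots,m_{n-1}):=\sum_{r=2}^{n}\frac{\beta^{(r)}}{r!}\sum_{\substack{i_1,\ldots,i_r>0\\ i_1+\cdots+i_r=n}}\frac{n!}{i_1!\cdots i_r!}\,m_{i_1}\cdots m_{i_r}.$$ The symbol $\sim$ denotes asymptotic equivalence (the ratio tends to $1$). *)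

theory Defs
  imports "HOL-Probability.Probability" "HOL-Library.Multiset" "HOL-Library.Landau_Symbols"
begin

section \<open>The underlying random walk\<close>

text \<open>The lattice is \<open>int ^ 'd\<close> with dimension \<open>CARD('d)\<close>. The distribution \<open>p t x\<close> is
  constrained for \<open>t \<ge> 0\<close> only.\<close>

locale random_walk =
  fixes a :: "int ^ 'd::finite \<Rightarrow> int ^ 'd \<Rightarrow> real"
    and p :: "real \<Rightarrow> int ^ 'd \<Rightarrow> (int ^ 'd) pmf"
  assumes off_diagonal: "\<And>x y. x \<noteq> y \<Longrightarrow> a x y \<ge> 0"
    and diagonal: "\<And>x. a x x < 0"
    and regular: "\<And>x. (a x has_sum 0) UNIV"
    and symmetric: "\<And>x y. a x y = a y x"
    and homogeneous: "\<And>x y. a x y = a 0 (y - x)"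
    and irreducible: "\<And>x y. (x, y) \<in> {(u, v). a u v > 0}\<^sup>*"
    and p_start: "\<And>x. p 0 x = return_pmf x"
    and p_Markov: "\<And>s t x. s \<ge> 0 \<Longrightarrow> t \<ge> 0 \<Longrightarrow> p (s + t) x = bind_pmf (p s x) (p t)"
    and p_jump: "\<And>x y. x \<noteq> y \<Longrightarrow> (\<lambda>h. pmf (p h x) y - a x y * h) \<in> o[at_right 0](\<lambda>h. h)"
    and p_stay: "\<And>x. (\<lambda>h. pmf (p h x) x - (1 + a x x * h)) \<in> o[at_right 0](\<lambda>h. h)"

definition green ::
    "(real \<Rightarrow> int ^ 'd::finite \<Rightarrow> (int ^ 'd) pmf) \<Rightarrow> real \<Rightarrow> int ^ 'd \<Rightarrow> int ^ 'd \<Rightarrow> ennreal" where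
  "green p l x y = (\<integral>\<^sup>+t\<in>{0..}. ennreal (exp (- l * t) * pmf (p t x) y) \<partial>lborel)"

definition green_real ::
    "(real \<Rightarrow> int ^ 'd::finite \<Rightarrow> (int ^ 'd) pmf) \<Rightarrow> real \<Rightarrow> int ^ 'd \<Rightarrow> int ^ 'd \<Rightarrow> real" where
  "green_real p l x y = enn2real (green p l x y)"

definition beta_crit :: "(real \<Rightarrow> int ^ 'd::finite \<Rightarrow> (int ^ 'd) pmf) \<Rightarrow> real" where
  "beta_crit p = (if green p 0 0 0 = \<infinity> then 0 else 1 / green_real p 0 0 0)"


section \<open>The branching law\<close>

definition offspring_gf :: "(nat \<Rightarrow> real) \<Rightarrow> real \<Rightarrow> real" where
  "offspring_gf b u = (\<Sum>n. b n * u ^ n)"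

text \<open>Derivatives are taken within \<open>{0..1}\<close>, hence one-sided at \<open>1\<close>: the radius of convergence
  of the generating function may be exactly \<open>1\<close>.\<close>

fun offspring_gf_deriv :: "(nat \<Rightarrow> real) \<Rightarrow> nat \<Rightarrow> real \<Rightarrow> real" where
  "offspring_gf_deriv b 0 = offspring_gf b"
| "offspring_gf_deriv b (Suc r) =
     (\<lambda>u. vector_derivative (offspring_gf_deriv b r) (at u within {0..1}))"

definition beta_fac :: "(nat \<Rightarrow> real) \<Rightarrow> nat \<Rightarrow> real" where
  "beta_fac b r = offspring_gf_deriv b r 1"

definition beta_star :: "(nat \<Rightarrow> real) \<Rightarrow> real" where
  "beta_star b = (\<Sum>\<^sub>\<infinity>n\<in>{n. n > 1}. (real n - 1) * b n)"

locale branching_law =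
  fixes b :: "nat \<Rightarrow> real"
  assumes b_nonneg: "\<And>n. n \<noteq> 1 \<Longrightarrow> b n \<ge> 0"
    and b_one: "b 1 < 0"
    and b_sums: "b sums 0"
    and beta_finite: "\<And>r. offspring_gf_deriv b r differentiable (at 1 within {0..1})"


section \<open>The branching random walk\<close>

text \<open>A state is the finite multiset of the positions of the particles, and \<open>K t \<eta>\<close> is the law
  of the state at time \<open>t\<close> when the initial state is \<open>\<eta>\<close>. The following is the probability
  that the Markov process in state \<open>\<eta>\<close> at time \<open>s\<close> is observed in the listed states at the
  listed times.\<close>

fun path_prob :: "(real \<Rightarrow> 'c \<Rightarrow> 'c pmf) \<Rightarrow> real \<Rightarrow> 'c \<Rightarrow> (real \<times> 'c) list \<Rightarrow> real" where
  "path_prob K s \<eta> [] = 1"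
| "path_prob K s \<eta> ((t, \<xi>) # obs) = pmf (K (t - s) \<eta>) \<xi> * path_prob K t \<xi> obs"

text \<open>\<open>M x\<close> is the probability measure under which the process starts with one particle at \<open>x\<close>.
  The coefficient in \<open>K_stay\<close> is minus the total rate of the other events: jumps have total rate
  \<open>- a x x\<close>, and death together with branching has rate \<open>- b 1\<close> at \<open>0\<close>, while only death, with
  rate \<open>b 0\<close>, remains elsewhere.\<close>

locale branching_random_walk = random_walk a p + branching_law b
  for a :: "int ^ 'd::finite \<Rightarrow> int ^ 'd \<Rightarrow> real"
    and p :: "real \<Rightarrow> int ^ 'd \<Rightarrow> (int ^ 'd) pmf"
    and b :: "nat \<Rightarrow> real" +
  fixes K :: "real \<Rightarrow> (int ^ 'd) multiset \<Rightarrow> (int ^ 'd) multiset pmf"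
    and M :: "int ^ 'd \<Rightarrow> 'w measure"
    and X :: "real \<Rightarrow> 'w \<Rightarrow> (int ^ 'd) multiset"
  assumes K_start: "\<And>\<eta>. K 0 \<eta> = return_pmf \<eta>"
    and K_Markov: "\<And>s t \<eta>. s \<ge> 0 \<Longrightarrow> t \<ge> 0 \<Longrightarrow> K (s + t) \<eta> = bind_pmf (K s \<eta>) (K t)"
    and K_empty: "\<And>t. t \<ge> 0 \<Longrightarrow> K t {#} = return_pmf {#}"
    and K_independent: "\<And>t \<eta> \<xi>. t \<ge> 0 \<Longrightarrow>
      K t (\<eta> + \<xi>) = map_pmf (\<lambda>(\<eta>', \<xi>'). \<eta>' + \<xi>') (pair_pmf (K t \<eta>) (K t \<xi>))"
    and K_jump: "\<And>x y. x \<noteq> y \<Longrightarrow>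
      (\<lambda>h. pmf (K h {#x#}) {#y#} - a x y * h) \<in> o[at_right 0](\<lambda>h. h)"
    and K_death: "\<And>x. (\<lambda>h. pmf (K h {#x#}) {#} - b 0 * h) \<in> o[at_right 0](\<lambda>h. h)"
    and K_branch: "\<And>n. n > 1 \<Longrightarrow>
      (\<lambda>h. pmf (K h {#0#}) (replicate_mset n 0) - b n * h) \<in> o[at_right 0](\<lambda>h. h)"
    and K_stay: "\<And>x. (\<lambda>h. pmf (K h {#x#}) {#x#} -
        (1 + (a x x + (if x = 0 then b 1 else - b 0)) * h)) \<in> o[at_right 0](\<lambda>h. h)"
    and M_prob: "\<And>x. prob_space (M x)"
    and X_measurable: "\<And>x t. t \<ge> 0 \<Longrightarrow> X t \<in> measurable (M x) (count_space UNIV)"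
    and X_law: "\<And>x obs. sorted (0 # map fst obs) \<Longrightarrow>
      measure (M x) {w \<in> space (M x). \<forall>(t, \<eta>)\<in>set obs. X t w = \<eta>} = path_prob K 0 {#x#} obs"

definition local_moment ::
    "('s \<Rightarrow> 'w measure) \<Rightarrow> (real \<Rightarrow> 'w \<Rightarrow> 's multiset) \<Rightarrow> nat \<Rightarrow> real \<Rightarrow> 's \<Rightarrow> 's \<Rightarrow> real" where
  "local_moment M X n t x y = integral\<^sup>L (M x) (\<lambda>w. real (count (X t w) y) ^ n)"

definition total_moment ::
    "('s \<Rightarrow> 'w measure) \<Rightarrow> (real \<Rightarrow> 'w \<Rightarrow> 's multiset) \<Rightarrow> nat \<Rightarrow> real \<Rightarrow> 's \<Rightarrow> real" where
  "total_moment M X n t x = integral\<^sup>L (M x) (\<lambda>w. real (size (X t w)) ^ n)"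


section \<open>The leading eigenvalue\<close>

definition l2 :: "('s \<Rightarrow> real) set" where
  "l2 = {\<phi>. (\<lambda>x. (\<phi> x)\<^sup>2) summable_on UNIV}"

definition l2_norm :: "('s \<Rightarrow> real) \<Rightarrow> real" where
  "l2_norm \<phi> = sqrt (\<Sum>\<^sub>\<infinity>x. (\<phi> x)\<^sup>2)"

definition l2_eigenvalue :: "(('s \<Rightarrow> real) \<Rightarrow> ('s \<Rightarrow> real)) \<Rightarrow> real \<Rightarrow> bool" where
  "l2_eigenvalue T l \<longleftrightarrow> (\<exists>\<phi>\<in>l2. \<phi> \<noteq> (\<lambda>_. 0) \<and> T \<phi> = (\<lambda>x. l * \<phi> x))"

text \<open>For a bounded operator, a bijective \<open>l - T\<close> automatically has a bounded inverse. Real scalars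
  suffice because the operators considered below are self-adjoint.\<close>

definition l2_spectrum :: "(('s \<Rightarrow> real) \<Rightarrow> ('s \<Rightarrow> real)) \<Rightarrow> real set" where
  "l2_spectrum T = {l. \<not> bij_betw (\<lambda>\<phi> x. l * \<phi> x - T \<phi> x) l2 l2}"

definition walk_generator ::
    "(int ^ 'd::finite \<Rightarrow> int ^ 'd \<Rightarrow> real) \<Rightarrow> (int ^ 'd \<Rightarrow> real) \<Rightarrow> int ^ 'd \<Rightarrow> real" where
  "walk_generator a \<phi> x = (\<Sum>\<^sub>\<infinity>y. a 0 (x - y) * \<phi> y)"

definition Delta0 :: "('s::zero \<Rightarrow> real) \<Rightarrow> 's \<Rightarrow> real" where
  "Delta0 \<phi> x = (if x = 0 then \<phi> 0 else 0)"

definition perturbed_generator ::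
    "(int ^ 'd::finite \<Rightarrow> int ^ 'd \<Rightarrow> real) \<Rightarrow> (nat \<Rightarrow> real) \<Rightarrow>
     (int ^ 'd \<Rightarrow> real) \<Rightarrow> int ^ 'd \<Rightarrow> real" where
  "perturbed_generator a b \<phi> x = walk_generator a \<phi> x + beta_star b * Delta0 \<phi> x"

definition lambda0 :: "(int ^ 'd::finite \<Rightarrow> int ^ 'd \<Rightarrow> real) \<Rightarrow> (nat \<Rightarrow> real) \<Rightarrow> real" where
  "lambda0 a b = (THE l. l > 0 \<and> l2_eigenvalue (perturbed_generator a b) l \<and>
                         l isolated_in l2_spectrum (perturbed_generator a b))"

definition lambdaE :: "(int ^ 'd::finite \<Rightarrow> int ^ 'd \<Rightarrow> real) \<Rightarrow> (nat \<Rightarrow> real) \<Rightarrow> real" where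
  "lambdaE a b = lambda0 a b - b 0"


section \<open>The functions in the moment equations\<close>

definition compositions :: "nat \<Rightarrow> nat \<Rightarrow> nat list set" where
  "compositions r n = {is. length is = r \<and> (\<forall>i\<in>set is. i > 0) \<and> sum_list is = n}"

lemma finite_compositions: "finite (compositions r n)"
proof (rule finite_subset)
  show "compositions r n \<subseteq> {is. set is \<subseteq> {..n} \<and> length is = r}"
    by (auto simp: compositions_def intro: member_le_sum_list)
  show "finite {is. set is \<subseteq> {..n} \<and> length is = r}"
    by (rule finite_lists_length_eq) simp
qed

text \<open>For \<open>r \<ge> 2\<close> all parts of a composition of \<open>n\<close> are below \<open>n\<close>, so only \<open>m 1\<close>, ..., 
  \<open>m (n - 1)\<close> enter.\<close>

definition g_moment :: "(nat \<Rightarrow> real) \<Rightarrow> nat \<Rightarrow> (nat \<Rightarrow> real) \<Rightarrow> real" where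
  "g_moment b n m = (\<Sum>r=2..n. beta_fac b r / fact r *
     (\<Sum>is\<in>compositions r n. fact n / prod_list (map fact is) * prod_list (map m is)))"

end

theory Submission
  imports Defs
begin

text \<open>The moments grow exponentially because their evolution operator has one isolated leading
  eigenvalue, and because the equation for the \<open>n\<close>-th moment is driven by products of lower moments whose
  orders add up to \<open>n\<close>.

  The first moment solves \<open>\<partial>\<^sub>t m = (A + \<beta> \<Delta>\<^sub>0 - b\<^sub>0) m\<close>. Up to a multiple of the identity the operator
  is a symmetric kernel \<open>B\<close> with non-negative entries and bounded row sums, so its semigroup is a power
  series in \<open>B\<close> (locale \<open>bounded_kernel\<close>), and Duhamel's formula (\<open>duhamel\<close>) holds for all
  bounded solutions. The positive eigenvalue \<open>\<lambda>\<^sub>0\<close> is found from the resolvent of the walk: a rank-one perturbation has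
  the eigenvalue \<open>l > 0\<close> iff \<open>\<beta> G\<^sub>l(0,0) = 1\<close>, with eigenfunction \<open>\<psi> = G\<^sub>l(\<cdot>,0)\<close>, and is invertible on
  \<open>l\<^sup>2\<close> for all other \<open>l > 0\<close> (\<open>lambda0_characterization\<close>). That \<open>exp (- \<lambda>\<^sub>0 t)\<close> times the semigroup tends to the
  projection on \<open>\<psi>\<close> (\<open>heat_ergodic\<close>) follows from symmetry and convexity:
  the diagonal of the normalised kernel is a bounded convex function of time, hence decreasing, and this makes the kernel
  a Cauchy family in \<open>l\<^sup>2\<close>. The limit gives the constants \<open>C\<^sub>1(x,y)\<close>; for the total population, conservation of
  mass by the walk reduces the claim to the same limit (\<open>heat_one_limit\<close>).

  The process is specified only by the behaviour of its transition probabilities at time \<open>0\<close>, along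
  single jumps, deaths and branchings. Since the rates of these events sum to zero with the rate of staying, nothing
  else happens to first order (\<open>generator_limit\<close>), and the backward equation holds for bounded
  functions (\<open>backward_equation\<close>). Powers of the number \<open>N\<close> of particles are not bounded, so they are damped to
  \<open>N ^ n exp (- z N)\<close>. The damped moments still obey a closed system, because particles evolve
  independently and the exponential is multiplicative; the system differs from the moment equations only through the
  derivatives of the offspring generating function being taken at a point below \<open>1\<close>. This lowers
  the solution, so the damped moments are bounded uniformly in \<open>z\<close>, and \<open>z \<rightarrow> 0\<close> yields finiteness of all moments
  and the integrated equation (\<open>moment_equation\<close>)
  \<open>m\<^sub>n(t,x) = m\<^sub>1(t,x) + \<integral>\<^sub>0\<^sup>t k(t - s,x) g\<^sub>n(m\<^sub>1(s,0), ..., m\<^sub>n\<^sub>-\<^sub>1(s,0)) ds\<close>, where \<open>k(t,x)\<close> is the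
  mean number of particles at \<open>0\<close>.

  For \<open>n \<ge> 2\<close> the source grows like \<open>g\<^sub>n(C\<^sub>1, ..., C\<^sub>n\<^sub>-\<^sub>1) exp (n \<lambda> t)\<close> with the eigenvalue \<open>\<lambda> = \<lambda>\<^sub>0 - b\<^sub>0\<close>,
  which is faster than the kernel. Hence (\<open>convolution_asymptotics\<close>) the convolution has the same growth with the
  additional factor \<open>D\<^sub>n(x) = \<integral>\<^sub>0\<^sup>\<infinity> exp (- n \<lambda> r) k(r,x) dr\<close>. Since \<open>k(r,x) \<le> exp (\<beta> r)\<close>, this
  factor is at most \<open>1 / (n \<lambda> - \<beta>)\<close>, which gives the bound \<open>2 / (n \<lambda>)\<close> for large \<open>n\<close>.\<close>

section \<open>Exchanging limits, derivatives and infinite sums\<close>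

lemma abs_summable_real:
  fixes f :: "'i \<Rightarrow> real"
  assumes "g summable_on A" "\<And>x. x \<in> A \<Longrightarrow> \<bar>f x\<bar> \<le> g x"
  shows "(\<lambda>x. \<bar>f x\<bar>) summable_on A" "f summable_on A"
proof -
  show *: "(\<lambda>x. \<bar>f x\<bar>) summable_on A"
    by (rule summable_on_comparison_test[OF assms(1)]) (use assms(2) in auto)
  show "f summable_on A"
    by (rule abs_summable_summable) (use * in simp)
qed

lemma abs_infsum_le:
  fixes f :: "'i \<Rightarrow> real"
  assumes "g summable_on A" "\<And>x. x \<in> A \<Longrightarrow> \<bar>f x\<bar> \<le> g x"
  shows "\<bar>infsum f A\<bar> \<le> infsum g A"
proof -
  note s = abs_summable_real[OF assms]
  have le: "f x \<le> g x" "- f x \<le> g x" if "x \<in> A" for x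
    using assms(2)[OF that] by linarith+
  have "infsum f A \<le> infsum g A"
    using le(1) by (intro infsum_mono s assms(1))
  moreover have "infsum (\<lambda>x. - f x) A \<le> infsum g A"
    using le(2) by (intro infsum_mono abs_summable_real(2)[OF assms(1)] assms(1)) (use assms(2) in auto)
  ultimately show ?thesis by (simp add: infsum_uminus)
qed

lemma infsum_single:
  fixes f :: "'i \<Rightarrow> real"
  assumes "\<And>y. y \<noteq> x \<Longrightarrow> f y = 0"
  shows "infsum f UNIV = f x"
proof -
  have "infsum f UNIV = infsum f {x}"
    by (rule infsum_cong_neutral) (use assms in auto)
  then show ?thesis by simp
qed

lemma nonneg_summable_le:
  fixes f :: "'i \<Rightarrow> real"
  assumes "\<And>x. x \<in> A \<Longrightarrow> f x \<ge> 0" "\<And>F. finite F \<Longrightarrow> F \<subseteq> A \<Longrightarrow> sum f F \<le> C"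
  shows "f summable_on A" "infsum f A \<le> C"
proof -
  show "f summable_on A"
    by (rule nonneg_bdd_above_summable_on) (use assms in \<open>auto intro!: bdd_aboveI2[where M=C]\<close>)
  then show "infsum f A \<le> C"
    by (rule infsum_le_finite_sums) (use assms in auto)
qed

lemma indicator_le_1: "\<bar>indicat_real A z\<bar> \<le> 1"
  by (simp add: indicator_def)

lemma indicator_l1:
  fixes x :: 's
  shows "(\<lambda>z. \<bar>indicat_real {x} z\<bar>) summable_on UNIV"
proof (rule nonneg_summable_le(1)[where C = 1])
  fix F :: "'s set" assume "finite F"
  then show "(\<Sum>z\<in>F. \<bar>indicat_real {x} z\<bar>) \<le> 1"
    by (cases "x \<in> F") (auto simp: indicator_def sum.delta)
qed simp

lemma has_sum_finite_sum:
  fixes f :: "'r \<Rightarrow> 'j \<Rightarrow> real"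
  assumes "finite A" "\<And>r. r \<in> A \<Longrightarrow> (f r has_sum s r) U"
  shows "((\<lambda>j. \<Sum>r\<in>A. f r j) has_sum (\<Sum>r\<in>A. s r)) U"
  using assms by (induction rule: finite_induct) (auto intro!: has_sum_add)

text \<open>A finite set carries all but \<open>\<epsilon>\<close> of the dominating sum, and on that set the limit commutes with
  the sum.\<close>

lemma tendsto_infsum_dominated:
  fixes f :: "'i \<Rightarrow> 's \<Rightarrow> real"
  assumes g: "g summable_on A"
    and le: "\<forall>\<^sub>F i in F. \<forall>x\<in>A. \<bar>f i x\<bar> \<le> g x"
    and lim: "\<And>x. x \<in> A \<Longrightarrow> ((\<lambda>i. f i x) \<longlongrightarrow> l x) F"
  shows "((\<lambda>i. \<Sum>\<^sub>\<infinity>x\<in>A. f i x) \<longlongrightarrow> (\<Sum>\<^sub>\<infinity>x\<in>A. l x)) F"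
proof (cases "F = bot")
  case False
  have l_le: "\<bar>l x\<bar> \<le> g x" if "x \<in> A" for x
  proof (rule tendsto_upperbound[OF tendsto_rabs[OF lim[OF that]] _ False])
    show "\<forall>\<^sub>F i in F. \<bar>f i x\<bar> \<le> g x" using le by eventually_elim (use that in auto)
  qed
  have g0: "g x \<ge> 0" if "x \<in> A" for x using l_le[OF that] by linarith
  show ?thesis
  proof (rule tendstoI)
    fix e :: real assume e: "e > 0"
    obtain S where S: "finite S" "S \<subseteq> A" "dist (sum g S) (infsum g A) \<le> e / 4"
      using infsum_finite_approximation[OF g, of "e/4"] e by auto
    have gtail: "infsum g (A - S) \<le> e / 4"
      using S infsum_Diff[OF g summable_on_finite[OF S(1)] S(2)] infsum_finite[OF S(1), of g] unfolding dist_real_def by linarith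
    have gsS: "g summable_on (A - S)" using g by (rule summable_on_subset_banach) auto
    have split: "infsum h A = sum h S + infsum h (A - S)" "\<bar>infsum h (A - S)\<bar> \<le> e / 4"
      if "\<And>x. x \<in> A \<Longrightarrow> \<bar>h x\<bar> \<le> g x" for h
    proof -
      have "h summable_on A" by (rule abs_summable_real(2)[OF g that])
      then show "infsum h A = sum h S + infsum h (A - S)"
        using S infsum_Diff[of h A S] by simp
      show "\<bar>infsum h (A - S)\<bar> \<le> e / 4"
        using abs_infsum_le[OF gsS, of h] that order_trans[OF _ gtail] by simp
    qed
    have "((\<lambda>i. sum (f i) S) \<longlongrightarrow> sum l S) F"
      using S lim by (intro tendsto_sum) auto
    then have "\<forall>\<^sub>F i in F. dist (sum (f i) S) (sum l S) < e / 4"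
      by (rule tendstoD) (use e in simp)
    then show "\<forall>\<^sub>F i in F. dist (\<Sum>\<^sub>\<infinity>x\<in>A. f i x) (\<Sum>\<^sub>\<infinity>x\<in>A. l x) < e"
      using le
    proof eventually_elim
      case (elim i)
      have "\<bar>infsum (f i) A - infsum l A\<bar> < e"
        using elim(1) split[OF bspec[OF elim(2)]] split[OF l_le] e unfolding dist_real_def by linarith
      then show ?case by (simp add: dist_real_def)
    qed
  qed
qed simp

lemma infsum_swap_abs:
  fixes f :: "'i \<Rightarrow> 'j \<Rightarrow> real"
  assumes inner: "\<And>x. (\<lambda>y. \<bar>f x y\<bar>) summable_on UNIV"
    and outer: "(\<lambda>x. \<Sum>\<^sub>\<infinity>y. \<bar>f x y\<bar>) summable_on UNIV"
  shows "(\<Sum>\<^sub>\<infinity>x. \<Sum>\<^sub>\<infinity>y. f x y) = (\<Sum>\<^sub>\<infinity>y. \<Sum>\<^sub>\<infinity>x. f x y)"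
    and "(\<lambda>y. \<Sum>\<^sub>\<infinity>x. \<bar>f x y\<bar>) summable_on UNIV"
    and "\<And>y. (\<lambda>x. \<bar>f x y\<bar>) summable_on UNIV"
    and "(\<Sum>\<^sub>\<infinity>x. \<Sum>\<^sub>\<infinity>y. \<bar>f x y\<bar>) = (\<Sum>\<^sub>\<infinity>y. \<Sum>\<^sub>\<infinity>x. \<bar>f x y\<bar>)"
proof -
  have s: "(\<lambda>(x,y). \<bar>f x y\<bar>) summable_on (UNIV \<times> UNIV)"
    by (rule summable_on_SigmaI[where g = "\<lambda>x. \<Sum>\<^sub>\<infinity>y. \<bar>f x y\<bar>"])
      (use inner outer in \<open>auto intro: has_sum_infsum\<close>)
  have s2: "(\<lambda>(x,y). f x y) summable_on (UNIV \<times> UNIV)"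
    by (rule abs_summable_summable) (use s in \<open>simp add: case_prod_unfold\<close>)
  show "(\<Sum>\<^sub>\<infinity>x. \<Sum>\<^sub>\<infinity>y. f x y) = (\<Sum>\<^sub>\<infinity>y. \<Sum>\<^sub>\<infinity>x. f x y)"
    by (rule infsum_swap_banach[OF s2])
  show "(\<Sum>\<^sub>\<infinity>x. \<Sum>\<^sub>\<infinity>y. \<bar>f x y\<bar>) = (\<Sum>\<^sub>\<infinity>y. \<Sum>\<^sub>\<infinity>x. \<bar>f x y\<bar>)"
    by (rule infsum_swap_banach[OF s])
  have sw: "(\<lambda>(y,x). \<bar>f x y\<bar>) summable_on (UNIV \<times> UNIV)"
    using s by (subst (asm) summable_on_swap) (simp add: case_prod_beta)
  then show 1: "(\<lambda>x. \<bar>f x y\<bar>) summable_on UNIV" for y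
    using summable_on_SigmaD1[OF sw, of y] by simp
  show "(\<lambda>y. \<Sum>\<^sub>\<infinity>x. \<bar>f x y\<bar>) summable_on UNIV"
    using summable_on_SigmaD[OF sw] 1 by simp
qed

lemma summable_infsum_eq_suminf:
  fixes f :: "nat \<Rightarrow> real"
  assumes "summable (\<lambda>n. \<bar>f n\<bar>)"
  shows "f summable_on UNIV" "infsum f UNIV = suminf f"
proof -
  show s: "f summable_on UNIV" using assms by (intro norm_summable_imp_summable_on) simp
  show "infsum f UNIV = suminf f"
    using has_sum_imp_sums[OF has_sum_infsum[OF s]] by (simp add: sums_iff)
qed

text \<open>The mean value theorem bounds the difference quotients by the bound \<open>C\<close> on the derivatives,
  so dominated convergence applies to them.\<close>

lemma has_real_derivative_infsum:
  fixes w w' :: "real \<Rightarrow> 's \<Rightarrow> real"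
  assumes k: "\<And>y. k y \<ge> 0" "k summable_on UNIV"
    and S: "convex S" "t \<in> S"
    and der: "\<And>s y. s \<in> S \<Longrightarrow> ((\<lambda>s. w s y) has_real_derivative w' s y) (at s within S)"
    and bd: "\<And>s y. s \<in> S \<Longrightarrow> \<bar>w' s y\<bar> \<le> C"
    and wb: "\<And>s y. s \<in> S \<Longrightarrow> \<bar>w s y\<bar> \<le> C'"
  shows "((\<lambda>s. \<Sum>\<^sub>\<infinity>y. k y * w s y) has_real_derivative (\<Sum>\<^sub>\<infinity>y. k y * w' t y)) (at t within S)"
proof -
  have sm: "(\<lambda>y. k y * w s y) summable_on UNIV" if "s \<in> S" for s
    by (rule abs_summable_real(2)[OF summable_on_cmult_left[OF k(2), of C']])
      (use k wb that in \<open>auto simp: abs_mult intro!: mult_left_mono\<close>)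
  have quot: "\<bar>w s y - w t y\<bar> \<le> C * \<bar>s - t\<bar>" if "s \<in> S" for s y
    using field_differentiable_bound[OF S(1), of "\<lambda>s. w s y" "\<lambda>s. w' s y" C s t] der bd S that
    by simp
  have "((\<lambda>s. \<Sum>\<^sub>\<infinity>y. k y * ((w s y - w t y) / (s - t))) \<longlongrightarrow> (\<Sum>\<^sub>\<infinity>y. k y * w' t y)) (at t within S)"
  proof (rule tendsto_infsum_dominated[OF summable_on_cmult_left[OF k(2), of C]])
    show "\<forall>\<^sub>F s in at t within S. \<forall>y\<in>UNIV. \<bar>k y * ((w s y - w t y) / (s - t))\<bar> \<le> k y * C"
      unfolding eventually_at_topological
    proof (rule exI[of _ UNIV], safe)
      fix s y assume "s \<in> S" "s \<noteq> t"
      then have "\<bar>(w s y - w t y) / (s - t)\<bar> \<le> C"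
        using quot[of s y] by (simp add: abs_divide divide_le_eq)
      then show "\<bar>k y * ((w s y - w t y) / (s - t))\<bar> \<le> k y * C"
        using mult_left_mono[OF _ k(1)] by (simp only: abs_mult abs_of_nonneg[OF k(1)])
    qed auto
    show "((\<lambda>s. k y * ((w s y - w t y) / (s - t))) \<longlongrightarrow> k y * w' t y) (at t within S)" for y
      using der[OF S(2), of y] by (intro tendsto_intros) (simp add: has_field_derivative_iff)
  qed
  then show ?thesis
    unfolding has_field_derivative_iff
  proof (rule Lim_transform_eventually)
    show "\<forall>\<^sub>F s in at t within S. (\<Sum>\<^sub>\<infinity>y. k y * ((w s y - w t y) / (s - t)))
      = ((\<Sum>\<^sub>\<infinity>y. k y * w s y) - (\<Sum>\<^sub>\<infinity>y. k y * w t y)) / (s - t)"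
      unfolding eventually_at_topological
    proof (rule exI[of _ UNIV], safe)
      fix s assume s: "s \<in> S" "s \<noteq> t"
      have "(\<Sum>\<^sub>\<infinity>y. k y * ((w s y - w t y) / (s - t))) = (\<Sum>\<^sub>\<infinity>y. (k y * w s y + - (k y * w t y)) * (1/(s-t)))"
        by (simp add: algebra_simps diff_divide_distrib)
      also have "\<dots> = (\<Sum>\<^sub>\<infinity>y. k y * w s y + - (k y * w t y)) * (1/(s-t))"
        by (rule infsum_cmult_left')
      also have "(\<Sum>\<^sub>\<infinity>y. k y * w s y + - (k y * w t y)) = (\<Sum>\<^sub>\<infinity>y. k y * w s y) + (\<Sum>\<^sub>\<infinity>y. - (k y * w t y))"
        by (rule infsum_add) (use sm s S in \<open>auto simp: summable_on_uminus\<close>)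
      finally show "(\<Sum>\<^sub>\<infinity>y. k y * ((w s y - w t y) / (s - t)))
        = ((\<Sum>\<^sub>\<infinity>y. k y * w s y) - (\<Sum>\<^sub>\<infinity>y. k y * w t y)) / (s - t)"
        by (simp add: infsum_uminus)
    qed auto
  qed
qed

section \<open>Symmetric non-negative kernels and the semigroups they generate\<close>

locale bounded_kernel =
  fixes B :: "'s \<Rightarrow> 's \<Rightarrow> real" and L :: real
  assumes B_nonneg: "B x y \<ge> 0"
    and B_sym: "B x y = B y x"
    and B_summable: "B x summable_on UNIV"
    and B_le: "(\<Sum>\<^sub>\<infinity>y. B x y) \<le> L"
begin

definition act :: "('s \<Rightarrow> real) \<Rightarrow> 's \<Rightarrow> real" where
  "act f x = (\<Sum>\<^sub>\<infinity>y. B x y * f y)"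

text \<open>Both the semigroup and the resolvent generated by the kernel are power series in the
  operator; they differ only in the weights.\<close>

definition series :: "(nat \<Rightarrow> real) \<Rightarrow> ('s \<Rightarrow> real) \<Rightarrow> 's \<Rightarrow> real" where
  "series w f x = (\<Sum>n. w n * (act ^^ n) f x)"

definition heat :: "real \<Rightarrow> ('s \<Rightarrow> real) \<Rightarrow> 's \<Rightarrow> real" where
  "heat t = series (\<lambda>n. t ^ n / fact n)"

lemma L_nonneg: "L \<ge> 0"
  using B_le[of undefined] infsum_nonneg[of UNIV "B undefined"] B_nonneg by force

lemma act_abs_summable:
  assumes "\<And>y. \<bar>f y\<bar> \<le> C"
  shows "(\<lambda>y. \<bar>B x y * f y\<bar>) summable_on UNIV"
  by (rule abs_summable_real(1)[OF summable_on_cmult_left[OF B_summable, where c = C]])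
    (use assms B_nonneg in \<open>auto simp: abs_mult intro!: mult_left_mono\<close>)

lemma act_summable:
  assumes "\<And>y. \<bar>f y\<bar> \<le> C"
  shows "(\<lambda>y. B x y * f y) summable_on UNIV"
  by (rule abs_summable_summable) (use act_abs_summable[OF assms] in simp)

lemma act_bound:
  assumes "\<And>y. \<bar>f y\<bar> \<le> C"
  shows "\<bar>act f x\<bar> \<le> L * C"
proof -
  have C: "C \<ge> 0" using assms[of x] by linarith
  have "\<bar>act f x\<bar> \<le> (\<Sum>\<^sub>\<infinity>y. B x y * C)"
    unfolding act_def
    by (rule abs_infsum_le[OF summable_on_cmult_left[OF B_summable, where c = C]])
      (use assms B_nonneg in \<open>auto simp: abs_mult intro!: mult_left_mono\<close>)
  also have "\<dots> = (\<Sum>\<^sub>\<infinity>y. B x y) * C" by (rule infsum_cmult_left')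
  also have "\<dots> \<le> L * C" using B_le C by (rule mult_right_mono)
  finally show ?thesis .
qed

lemma pow_bound:
  assumes "\<And>y. \<bar>f y\<bar> \<le> C"
  shows "\<bar>(act ^^ n) f x\<bar> \<le> L ^ n * C"
proof (induction n arbitrary: x)
  case (Suc n)
  show ?case using act_bound[OF Suc.IH] by (simp add: mult.assoc)
qed (use assms in simp)

lemma act_add:
  assumes "\<And>y. \<bar>f y\<bar> \<le> C" "\<And>y. \<bar>g y\<bar> \<le> D"
  shows "act (\<lambda>y. f y + g y) x = act f x + act g x"
  unfolding act_def distrib_left by (rule infsum_add) (rule act_summable, rule assms)+

lemma act_cmult: "act (\<lambda>y. c * f y) x = c * act f x"
  unfolding act_def by (subst infsum_cmult_right'[symmetric]) (simp add: ac_simps)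

lemma act_nonneg: "(\<And>y. f y \<ge> 0) \<Longrightarrow> act f x \<ge> 0"
  unfolding act_def by (intro infsum_nonneg mult_nonneg_nonneg B_nonneg)

lemma pow_nonneg: "(\<And>y. f y \<ge> 0) \<Longrightarrow> (act ^^ n) f x \<ge> 0"
  by (induction n arbitrary: x) (auto intro: act_nonneg)

lemma pow_add:
  assumes "\<And>y. \<bar>f y\<bar> \<le> C" "\<And>y. \<bar>g y\<bar> \<le> D"
  shows "(act ^^ n) (\<lambda>y. f y + g y) = (\<lambda>x. (act ^^ n) f x + (act ^^ n) g x)"
proof (induction n)
  case (Suc n)
  show ?case
    by (simp add: Suc.IH) (rule ext, rule act_add[OF pow_bound[OF assms(1)] pow_bound[OF assms(2)]])
qed simp

lemma pow_cmult: "(act ^^ n) (\<lambda>y. c * f y) = (\<lambda>x. c * (act ^^ n) f x)"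
  by (induction n) (auto simp: act_cmult)

lemma pow_eigen:
  assumes "act f = (\<lambda>x. m * f x)"
  shows "(act ^^ n) f = (\<lambda>x. m ^ n * f x)"
  by (induction n) (auto simp: act_cmult assms)

context
  fixes w :: "nat \<Rightarrow> real"
  assumes w: "summable (\<lambda>n. \<bar>w n\<bar> * L ^ n)"
begin

lemma series_abs_summable:
  assumes "\<And>y. \<bar>f y\<bar> \<le> C"
  shows "summable (\<lambda>n. \<bar>w n * (act ^^ n) f x\<bar>)"
proof (rule summable_comparison_test'[where N = 0])
  show "summable (\<lambda>n. \<bar>w n\<bar> * L ^ n * C)" using w by (rule summable_mult2)
  show "norm \<bar>w n * (act ^^ n) f x\<bar> \<le> \<bar>w n\<bar> * L ^ n * C" for n
    using mult_left_mono[OF pow_bound[OF assms], of "\<bar>w n\<bar>"] by (simp add: abs_mult mult.assoc)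
qed

lemma series_summable:
  assumes "\<And>y. \<bar>f y\<bar> \<le> C"
  shows "summable (\<lambda>n. w n * (act ^^ n) f x)"
  using series_abs_summable[OF assms] by (rule summable_rabs_cancel)

lemma series_bound:
  assumes "\<And>y. \<bar>f y\<bar> \<le> C"
  shows "\<bar>series w f x\<bar> \<le> (\<Sum>n. \<bar>w n\<bar> * L ^ n) * C"
proof -
  have "\<bar>series w f x\<bar> \<le> (\<Sum>n. \<bar>w n * (act ^^ n) f x\<bar>)"
    unfolding series_def by (rule summable_rabs[OF series_abs_summable[OF assms]])
  also have "\<dots> \<le> (\<Sum>n. \<bar>w n\<bar> * L ^ n * C)"
  proof (rule suminf_le[OF _ series_abs_summable[OF assms] summable_mult2[OF w]])
    show "\<bar>w n * (act ^^ n) f x\<bar> \<le> \<bar>w n\<bar> * L ^ n * C" for n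
      using mult_left_mono[OF pow_bound[OF assms], of "\<bar>w n\<bar>"] by (simp add: abs_mult mult.assoc)
  qed
  finally show ?thesis using suminf_mult2[OF w, of C] by simp
qed

lemma series_add:
  assumes "\<And>y. \<bar>f y\<bar> \<le> C" "\<And>y. \<bar>g y\<bar> \<le> D"
  shows "series w (\<lambda>y. f y + g y) x = series w f x + series w g x"
  unfolding series_def pow_add[OF assms] distrib_left
  by (rule suminf_add[symmetric]) (rule series_summable, rule assms)+

lemma series_cmult: "\<lbrakk>\<And>y. \<bar>f y\<bar> \<le> C\<rbrakk> \<Longrightarrow> series w (\<lambda>y. c * f y) x = c * series w f x"
  unfolding series_def pow_cmult
  by (subst suminf_mult[OF series_summable, symmetric]) (auto simp: ac_simps)

lemma series_nonneg:
  assumes "\<And>y. \<bar>f y\<bar> \<le> C" "\<And>n. w n \<ge> 0" "\<And>y. f y \<ge> 0"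
  shows "series w f x \<ge> 0"
  unfolding series_def
  by (intro suminf_nonneg series_summable[OF assms(1)] mult_nonneg_nonneg assms pow_nonneg)

lemma series_mono:
  assumes "\<And>y. \<bar>f y\<bar> \<le> C" "\<And>y. \<bar>g y\<bar> \<le> D" "\<And>n. w n \<ge> 0" "\<And>y. f y \<le> g y"
  shows "series w f x \<le> series w g x"
proof -
  have "series w (\<lambda>y. g y + (-1) * f y) x \<ge> 0"
  proof (rule series_nonneg[where C = "C + D"])
    show "\<bar>g y + (-1) * f y\<bar> \<le> C + D" for y using assms(1)[of y] assms(2)[of y] by linarith
  qed (use assms in auto)
  also have "series w (\<lambda>y. g y + (-1) * f y) x = series w g x + series w (\<lambda>y. (-1) * f y) x"
    by (rule series_add[OF assms(2)]) (use assms(1) in auto)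
  also have "series w (\<lambda>y. (-1) * f y) x = (-1) * series w f x"
    by (rule series_cmult[OF assms(1)])
  finally show ?thesis by simp
qed

lemma series_eigen:
  assumes "\<And>y. \<bar>f y\<bar> \<le> C" "act f = (\<lambda>x. m * f x)" "summable (\<lambda>n. w n * m ^ n)"
  shows "series w f x = (\<Sum>n. w n * m ^ n) * f x"
  unfolding series_def pow_eigen[OF assms(2)]
  using suminf_mult2[OF assms(3), of "f x"] by (simp add: mult.assoc)

lemma act_series:
  assumes "\<And>y. \<bar>f y\<bar> \<le> C"
  shows "act (series w f) x = (\<Sum>n. w n * (act ^^ Suc n) f x)"
    and "act (series w f) x = series w (act f) x"
proof -
  define W where "W = (\<Sum>n. \<bar>w n\<bar> * L ^ n)"
  let ?F = "\<lambda>y n. B x y * (w n * (act ^^ n) f y)"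
  note sn = summable_infsum_eq_suminf
  have s: "summable (\<lambda>n. \<bar>?F y n\<bar>)" for y
    using summable_mult[OF series_abs_summable[OF assms], of "B x y"] B_nonneg
    by (simp add: abs_mult mult.assoc)
  have 1: "(\<lambda>n. \<bar>?F y n\<bar>) summable_on UNIV" for y
    by (rule sn(1)) (simp only: abs_idempotent s)
  have le: "(\<Sum>\<^sub>\<infinity>n. \<bar>?F y n\<bar>) \<le> B x y * (W * C)" for y
  proof -
    have "(\<Sum>\<^sub>\<infinity>n. \<bar>?F y n\<bar>) = (\<Sum>n. \<bar>?F y n\<bar>)" by (rule sn(2)) (simp only: abs_idempotent s)
    also have "\<dots> \<le> (\<Sum>n. B x y * C * (\<bar>w n\<bar> * L ^ n))"
    proof (rule suminf_le[OF _ s summable_mult[OF w]])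
      have pb: "\<bar>(act ^^ n) f y\<bar> \<le> L ^ n * C" for n by (rule pow_bound[OF assms])
      show "\<bar>?F y n\<bar> \<le> B x y * C * (\<bar>w n\<bar> * L ^ n)" for n
        using mult_left_mono[OF mult_left_mono[OF pb[of n], of "\<bar>w n\<bar>"] B_nonneg[of x y]] B_nonneg[of x y]
        by (simp add: abs_mult ac_simps)
    qed
    also have "\<dots> = B x y * C * W" unfolding W_def by (rule suminf_mult[OF w])
    finally show ?thesis by (simp add: ac_simps)
  qed
  have 2: "(\<lambda>y. \<Sum>\<^sub>\<infinity>n. \<bar>?F y n\<bar>) summable_on UNIV"
    by (rule abs_summable_real(2)[OF summable_on_cmult_left[OF B_summable, where c = "W * C"]])
      (use le in \<open>auto simp: infsum_nonneg\<close>)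
  have "B x y * series w f y = (\<Sum>\<^sub>\<infinity>n. ?F y n)" for y
  proof -
    have "(\<Sum>\<^sub>\<infinity>n. ?F y n) = (\<Sum>n. ?F y n)" by (rule sn(2)[OF s])
    then show ?thesis
      unfolding series_def using suminf_mult[OF series_summable[of f C, OF assms], of "B x y" y] by simp
  qed
  then have "act (series w f) x = (\<Sum>\<^sub>\<infinity>y. \<Sum>\<^sub>\<infinity>n. ?F y n)"
    by (simp add: act_def)
  also have "\<dots> = (\<Sum>\<^sub>\<infinity>n. \<Sum>\<^sub>\<infinity>y. ?F y n)" by (rule infsum_swap_abs(1)[OF 1 2])
  also have "\<dots> = (\<Sum>\<^sub>\<infinity>n. w n * (act ^^ Suc n) f x)"
  proof (rule infsum_cong)
    fix n
    have "(\<Sum>\<^sub>\<infinity>y. ?F y n) = (\<Sum>\<^sub>\<infinity>y. w n * (B x y * (act ^^ n) f y))" by (simp add: ac_simps)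
    also have "\<dots> = w n * act ((act ^^ n) f) x" unfolding act_def by (rule infsum_cmult_right')
    finally show "(\<Sum>\<^sub>\<infinity>y. ?F y n) = w n * (act ^^ Suc n) f x" by simp
  qed
  also have "\<dots> = (\<Sum>n. w n * (act ^^ Suc n) f x)"
    using series_abs_summable[of "act f" "L * C" x] act_bound[of f C, OF assms]
    by (intro sn(2)) (simp add: funpow_swap1)
  finally have *: "act (series w f) x = (\<Sum>n. w n * (act ^^ Suc n) f x)" .
  show "act (series w f) x = (\<Sum>n. w n * (act ^^ Suc n) f x)" by (rule *)
  from * show "act (series w f) x = series w (act f) x"
    by (simp add: series_def funpow_swap1)
qed

end

subsection \<open>Symmetry\<close>

lemma act_l1:
  assumes f: "(\<lambda>x. \<bar>f x\<bar>) summable_on UNIV" and g: "\<And>x. \<bar>g x\<bar> \<le> C"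
  shows "(\<lambda>x. \<bar>act f x\<bar>) summable_on UNIV"
    and "(\<Sum>\<^sub>\<infinity>x. \<bar>act f x\<bar>) \<le> L * (\<Sum>\<^sub>\<infinity>x. \<bar>f x\<bar>)"
    and "(\<Sum>\<^sub>\<infinity>x. act f x * g x) = (\<Sum>\<^sub>\<infinity>x. f x * act g x)"
proof -
  have main: "(\<Sum>\<^sub>\<infinity>x. act f x * h x) = (\<Sum>\<^sub>\<infinity>x. f x * act h x) \<and>
      (\<lambda>x. \<Sum>\<^sub>\<infinity>y. \<bar>B x y * f y * h x\<bar>) summable_on UNIV \<and>
      (\<forall>x. (\<lambda>y. \<bar>B x y * f y * h x\<bar>) summable_on UNIV) \<and>
      (\<Sum>\<^sub>\<infinity>x. \<Sum>\<^sub>\<infinity>y. \<bar>B x y * f y * h x\<bar>) \<le> L * C * (\<Sum>\<^sub>\<infinity>x. \<bar>f x\<bar>)"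
    if h: "\<And>x. \<bar>h x\<bar> \<le> C" for h C
  proof -
    let ?F = "\<lambda>y x. B x y * f y * h x"
    have Fle: "\<bar>?F y x\<bar> \<le> B y x * (C * \<bar>f y\<bar>)" for x y
      using mult_left_mono[OF h[of x], of "B x y * \<bar>f y\<bar>"] B_nonneg[of x y]
      by (simp add: abs_mult B_sym[of y x] ac_simps)
    note sB = summable_on_cmult_left[OF B_summable]
    have 1: "(\<lambda>x. \<bar>?F y x\<bar>) summable_on UNIV" for y
      by (rule abs_summable_real(1)[OF sB]) (rule Fle)
    have C: "C \<ge> 0" using h[of undefined] by linarith
    have le: "(\<Sum>\<^sub>\<infinity>x. \<bar>?F y x\<bar>) \<le> \<bar>f y\<bar> * (L * C)" for y
    proof -
      have "(\<Sum>\<^sub>\<infinity>x. \<bar>?F y x\<bar>) \<le> (\<Sum>\<^sub>\<infinity>x. B y x * (C * \<bar>f y\<bar>))"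
        by (rule infsum_mono[OF 1 sB]) (rule Fle)
      also have "\<dots> = (\<Sum>\<^sub>\<infinity>x. B y x) * (C * \<bar>f y\<bar>)" by (rule infsum_cmult_left')
      also have "\<dots> \<le> L * (C * \<bar>f y\<bar>)" using B_le C by (intro mult_right_mono) auto
      finally show ?thesis by (simp add: ac_simps)
    qed
    have s: "(\<lambda>y. \<bar>f y\<bar> * (L * C)) summable_on UNIV"
      by (rule summable_on_cmult_left[OF f])
    have 2: "(\<lambda>y. \<Sum>\<^sub>\<infinity>x. \<bar>?F y x\<bar>) summable_on UNIV"
      by (rule abs_summable_real(2)[OF s]) (use le in \<open>auto simp: infsum_nonneg\<close>)
    note sw = infsum_swap_abs[OF 1 2]
    have "(\<Sum>\<^sub>\<infinity>y. \<Sum>\<^sub>\<infinity>x. \<bar>?F y x\<bar>) \<le> (\<Sum>\<^sub>\<infinity>y. \<bar>f y\<bar> * (L * C))"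
      by (rule infsum_mono[OF 2 s]) (rule le)
    also have "\<dots> = L * C * (\<Sum>\<^sub>\<infinity>y. \<bar>f y\<bar>)" by (subst infsum_cmult_left') simp
    finally have bnd: "(\<Sum>\<^sub>\<infinity>x. \<Sum>\<^sub>\<infinity>y. \<bar>?F y x\<bar>) \<le> L * C * (\<Sum>\<^sub>\<infinity>y. \<bar>f y\<bar>)"
      using sw(4) by simp
    have "(\<Sum>\<^sub>\<infinity>x. f x * act h x) = (\<Sum>\<^sub>\<infinity>y. \<Sum>\<^sub>\<infinity>x. ?F y x)"
      unfolding act_def
      by (intro infsum_cong, subst infsum_cmult_right'[symmetric]) (simp add: ac_simps B_sym)
    also have "\<dots> = (\<Sum>\<^sub>\<infinity>x. \<Sum>\<^sub>\<infinity>y. ?F y x)" by (rule sw(1))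
    also have "\<dots> = (\<Sum>\<^sub>\<infinity>x. act f x * h x)"
      unfolding act_def by (intro infsum_cong, subst infsum_cmult_left'[symmetric]) simp
    finally show ?thesis using bnd sw by simp
  qed
  show "(\<Sum>\<^sub>\<infinity>x. act f x * g x) = (\<Sum>\<^sub>\<infinity>x. f x * act g x)" using main[OF g] by simp
  have m1: "(\<lambda>x. \<Sum>\<^sub>\<infinity>y. \<bar>B x y * f y\<bar>) summable_on UNIV"
      "\<And>x. (\<lambda>y. \<bar>B x y * f y\<bar>) summable_on UNIV"
      "(\<Sum>\<^sub>\<infinity>x. \<Sum>\<^sub>\<infinity>y. \<bar>B x y * f y\<bar>) \<le> L * (\<Sum>\<^sub>\<infinity>x. \<bar>f x\<bar>)"
    using main[of "\<lambda>_. 1" 1] by auto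
  have le: "\<bar>act f x\<bar> \<le> (\<Sum>\<^sub>\<infinity>y. \<bar>B x y * f y\<bar>)" for x
    unfolding act_def by (rule abs_infsum_le[OF m1(2)]) simp
  show s: "(\<lambda>x. \<bar>act f x\<bar>) summable_on UNIV"
    by (rule abs_summable_real(1)[OF m1(1)]) (rule le)
  show "(\<Sum>\<^sub>\<infinity>x. \<bar>act f x\<bar>) \<le> L * (\<Sum>\<^sub>\<infinity>x. \<bar>f x\<bar>)"
    using infsum_mono[OF s m1(1) le] m1(3) by simp
qed

lemma pow_l1:
  assumes f: "(\<lambda>x. \<bar>f x\<bar>) summable_on UNIV" and g: "\<And>x. \<bar>g x\<bar> \<le> C"
  shows "(\<lambda>x. \<bar>(act ^^ n) f x\<bar>) summable_on UNIV"
    and "(\<Sum>\<^sub>\<infinity>x. \<bar>(act ^^ n) f x\<bar>) \<le> L ^ n * (\<Sum>\<^sub>\<infinity>x. \<bar>f x\<bar>)"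
    and "(\<Sum>\<^sub>\<infinity>x. (act ^^ n) f x * g x) = (\<Sum>\<^sub>\<infinity>x. f x * (act ^^ n) g x)"
proof -
  have "(\<lambda>x. \<bar>(act ^^ n) f x\<bar>) summable_on UNIV \<and>
    (\<Sum>\<^sub>\<infinity>x. \<bar>(act ^^ n) f x\<bar>) \<le> L ^ n * (\<Sum>\<^sub>\<infinity>x. \<bar>f x\<bar>)" for n
  proof (induction n)
    case (Suc n)
    then have s: "(\<lambda>x. \<bar>(act ^^ n) f x\<bar>) summable_on UNIV" by simp
    have z: "\<And>x. \<bar>0::real\<bar> \<le> 0" by simp
    have "L * (\<Sum>\<^sub>\<infinity>x. \<bar>(act ^^ n) f x\<bar>) \<le> L * (L ^ n * (\<Sum>\<^sub>\<infinity>x. \<bar>f x\<bar>))"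
      using Suc L_nonneg by (intro mult_left_mono) auto
    then show ?case using act_l1(1,2)[OF s z] by (simp add: mult.assoc)
  qed (use f in simp)
  then show s: "(\<lambda>x. \<bar>(act ^^ n) f x\<bar>) summable_on UNIV"
    and "(\<Sum>\<^sub>\<infinity>x. \<bar>(act ^^ n) f x\<bar>) \<le> L ^ n * (\<Sum>\<^sub>\<infinity>x. \<bar>f x\<bar>)" for n by auto
  show "(\<Sum>\<^sub>\<infinity>x. (act ^^ n) f x * g x) = (\<Sum>\<^sub>\<infinity>x. f x * (act ^^ n) g x)"
    using g
  proof (induction n arbitrary: g C)
    case (Suc n)
    have "(\<Sum>\<^sub>\<infinity>x. (act ^^ Suc n) f x * g x) = (\<Sum>\<^sub>\<infinity>x. (act ^^ n) f x * act g x)"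
      using act_l1(3)[OF s Suc.prems] by simp
    also have "\<dots> = (\<Sum>\<^sub>\<infinity>x. f x * (act ^^ n) (act g) x)"
      by (rule Suc.IH[OF act_bound[OF Suc.prems]])
    finally show ?case by (simp add: funpow_swap1)
  qed simp
qed

lemma series_l1:
  assumes w: "summable (\<lambda>n. \<bar>w n\<bar> * L ^ n)"
    and f: "(\<lambda>x. \<bar>f x\<bar>) summable_on UNIV" and g: "\<And>x. \<bar>g x\<bar> \<le> C"
  shows "(\<lambda>x. \<bar>series w f x\<bar>) summable_on UNIV"
    and "(\<Sum>\<^sub>\<infinity>x. series w f x * g x) = (\<Sum>\<^sub>\<infinity>x. f x * series w g x)"
proof -
  note sn = summable_infsum_eq_suminf
  have "\<exists>C. \<forall>x. \<bar>f x\<bar> \<le> C"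
  proof (intro exI allI)
    fix x
    have "infsum (\<lambda>x. \<bar>f x\<bar>) {x} \<le> (\<Sum>\<^sub>\<infinity>x. \<bar>f x\<bar>)"
      by (rule infsum_mono2) (use f in auto)
    then show "\<bar>f x\<bar> \<le> (\<Sum>\<^sub>\<infinity>x. \<bar>f x\<bar>)" by simp
  qed
  then obtain Cf where fb: "\<And>x. \<bar>f x\<bar> \<le> Cf" by blast
  define N where "N = (\<Sum>\<^sub>\<infinity>x. \<bar>f x\<bar>)"
  have main: "(\<lambda>x. \<Sum>\<^sub>\<infinity>n. \<bar>w n * ((act ^^ n) f x * h x)\<bar>) summable_on UNIV \<and>
     (\<Sum>\<^sub>\<infinity>n. \<Sum>\<^sub>\<infinity>x. w n * ((act ^^ n) f x * h x)) = (\<Sum>\<^sub>\<infinity>x. \<Sum>\<^sub>\<infinity>n. w n * ((act ^^ n) f x * h x)) \<and>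
     (\<forall>x. (\<lambda>n. \<bar>w n * ((act ^^ n) f x * h x)\<bar>) summable_on UNIV)"
    if h: "\<And>x. \<bar>h x\<bar> \<le> C" for h C
  proof -
    let ?F = "\<lambda>n x. w n * ((act ^^ n) f x * h x)"
    have C: "C \<ge> 0" using h[of undefined] by linarith
    have Fle: "\<bar>?F n x\<bar> \<le> \<bar>(act ^^ n) f x\<bar> * (\<bar>w n\<bar> * C)" for n x
      using mult_left_mono[OF h[of x], of "\<bar>w n\<bar> * \<bar>(act ^^ n) f x\<bar>"] by (simp add: abs_mult ac_simps)
    note sp = summable_on_cmult_left[OF pow_l1(1)[OF f h]]
    have 1: "(\<lambda>x. \<bar>?F n x\<bar>) summable_on UNIV" for n
      by (rule abs_summable_real(1)[OF sp]) (rule Fle)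
    have le: "(\<Sum>\<^sub>\<infinity>x. \<bar>?F n x\<bar>) \<le> \<bar>w n\<bar> * L ^ n * (N * C)" for n
    proof -
      have "(\<Sum>\<^sub>\<infinity>x. \<bar>?F n x\<bar>) \<le> (\<Sum>\<^sub>\<infinity>x. \<bar>(act ^^ n) f x\<bar> * (\<bar>w n\<bar> * C))"
        by (rule infsum_mono[OF 1 sp]) (rule Fle)
      also have "\<dots> = (\<Sum>\<^sub>\<infinity>x. \<bar>(act ^^ n) f x\<bar>) * (\<bar>w n\<bar> * C)" by (rule infsum_cmult_left')
      also have "\<dots> \<le> L ^ n * N * (\<bar>w n\<bar> * C)"
        unfolding N_def using C by (intro mult_right_mono pow_l1(2)[OF f h]) auto
      finally show ?thesis by (simp add: ac_simps)
    qed
    have "(\<lambda>n. \<bar>w n\<bar> * L ^ n * (N * C)) summable_on UNIV"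
    proof (rule sn(1))
      have "N \<ge> 0" unfolding N_def by (simp add: infsum_nonneg)
      then show "summable (\<lambda>n. \<bar>\<bar>w n\<bar> * L ^ n * (N * C)\<bar>)"
        using summable_mult2[OF w, of "N * C"] C L_nonneg by (simp add: abs_mult)
    qed
    then have 2: "(\<lambda>n. \<Sum>\<^sub>\<infinity>x. \<bar>?F n x\<bar>) summable_on UNIV"
      by (rule abs_summable_real(2)) (use le in \<open>auto simp: infsum_nonneg\<close>)
    from infsum_swap_abs[OF 1 2] show ?thesis by blast
  qed
  have sx: "(\<Sum>\<^sub>\<infinity>n. w n * (act ^^ n) h x) = series w h x" if "\<And>x. \<bar>h x\<bar> \<le> C" for h C x
    unfolding series_def by (rule sn(2)[OF series_abs_summable[OF w that]])
  have m1: "(\<lambda>x. \<Sum>\<^sub>\<infinity>n. \<bar>w n * (act ^^ n) f x\<bar>) summable_on UNIV"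
     "\<And>x. (\<lambda>n. \<bar>w n * (act ^^ n) f x\<bar>) summable_on UNIV"
    using main[of "\<lambda>_. 1" 1] by auto
  show "(\<lambda>x. \<bar>series w f x\<bar>) summable_on UNIV"
  proof (rule abs_summable_real(1)[OF m1(1)])
    show "\<bar>series w f x\<bar> \<le> (\<Sum>\<^sub>\<infinity>n. \<bar>w n * (act ^^ n) f x\<bar>)" for x
      unfolding sx[OF fb, symmetric] by (rule abs_infsum_le[OF m1(2)]) simp
  qed
  have "(\<Sum>\<^sub>\<infinity>x. series w f x * g x) = (\<Sum>\<^sub>\<infinity>x. \<Sum>\<^sub>\<infinity>n. w n * ((act ^^ n) f x * g x))"
    unfolding sx[OF fb, symmetric]
    by (intro infsum_cong, subst infsum_cmult_left'[symmetric]) (simp add: ac_simps)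
  also have "\<dots> = (\<Sum>\<^sub>\<infinity>n. \<Sum>\<^sub>\<infinity>x. w n * ((act ^^ n) f x * g x))" using main[OF g] by simp
  also have "\<dots> = (\<Sum>\<^sub>\<infinity>n. \<Sum>\<^sub>\<infinity>x. w n * (f x * (act ^^ n) g x))"
    by (simp only: infsum_cmult_right' pow_l1(3)[OF f g])
  also have "\<dots> = (\<Sum>\<^sub>\<infinity>x. \<Sum>\<^sub>\<infinity>n. w n * (f x * (act ^^ n) g x))"
  proof -
    have *: "\<bar>w n * (f x * (act ^^ n) g x)\<bar> \<le> \<bar>f x\<bar> * (\<bar>w n\<bar> * (L ^ n * C))" for x n
      using mult_left_mono[OF pow_bound[of g C n x, OF g], of "\<bar>w n\<bar> * \<bar>f x\<bar>"] by (simp add: abs_mult ac_simps)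
    note sf = summable_on_cmult_left[OF f]
    have 1: "(\<lambda>x. \<bar>w n * (f x * (act ^^ n) g x)\<bar>) summable_on UNIV" for n
      by (rule abs_summable_real(1)[OF sf]) (rule *)
    have le: "(\<Sum>\<^sub>\<infinity>x. \<bar>w n * (f x * (act ^^ n) g x)\<bar>) \<le> \<bar>w n\<bar> * L ^ n * (N * C)" for n
    proof -
      have "(\<Sum>\<^sub>\<infinity>x. \<bar>w n * (f x * (act ^^ n) g x)\<bar>) \<le> (\<Sum>\<^sub>\<infinity>x. \<bar>f x\<bar> * (\<bar>w n\<bar> * (L ^ n * C)))"
        by (rule infsum_mono[OF 1 sf]) (rule *)
      also have "\<dots> = N * (\<bar>w n\<bar> * (L ^ n * C))" unfolding N_def by (rule infsum_cmult_left')
      finally show ?thesis by (simp add: ac_simps)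
    qed
    have "C \<ge> 0" using g[of undefined] by linarith
    moreover have "N \<ge> 0" unfolding N_def by (simp add: infsum_nonneg)
    ultimately have "(\<lambda>n. \<bar>w n\<bar> * L ^ n * (N * C)) summable_on UNIV"
      using summable_mult2[OF w, of "N * C"] L_nonneg by (intro sn(1)) (simp add: abs_mult)
    then have 2: "(\<lambda>n. \<Sum>\<^sub>\<infinity>x. \<bar>w n * (f x * (act ^^ n) g x)\<bar>) summable_on UNIV"
      by (rule abs_summable_real(2)) (use le in \<open>auto simp: infsum_nonneg\<close>)
    show ?thesis by (rule infsum_swap_abs(1)[OF 1 2])
  qed
  also have "\<dots> = (\<Sum>\<^sub>\<infinity>x. f x * series w g x)"
    unfolding sx[OF g, symmetric]
    by (intro infsum_cong, subst infsum_cmult_right'[symmetric]) (simp add: ac_simps)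
  finally show "(\<Sum>\<^sub>\<infinity>x. series w f x * g x) = (\<Sum>\<^sub>\<infinity>x. f x * series w g x)" .
qed

lemma series_symmetric:
  assumes w: "summable (\<lambda>n. \<bar>w n\<bar> * L ^ n)"
  shows "series w (indicator {x}) y = series w (indicator {y}) x"
proof -
  have s: "(\<lambda>z. \<bar>indicat_real {x} z\<bar>) summable_on UNIV" for x :: 's
  proof (rule nonneg_summable_le(1)[where C = 1])
    fix F :: "'s set" assume "finite F"
    then show "(\<Sum>z\<in>F. \<bar>indicat_real {x} z\<bar>) \<le> 1"
      by (cases "x \<in> F") (auto simp: indicator_def sum.delta)
  qed simp
  have b: "\<bar>indicat_real {x} z\<bar> \<le> 1" for x z :: 's by (simp add: indicator_def)
  have "(\<Sum>\<^sub>\<infinity>z. series w (indicat_real {x}) z * indicator {y} z)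
      = (\<Sum>\<^sub>\<infinity>z. indicator {x} z * series w (indicat_real {y}) z)"
    by (rule series_l1(2)[OF w s b])
  then show ?thesis
    using infsum_single[of y "\<lambda>z. series w (indicat_real {x}) z * indicator {y} z"]
      infsum_single[of x "\<lambda>z. indicator {x} z * series w (indicat_real {y}) z"]
    by (simp add: indicator_def)
qed

end

context bounded_kernel
begin

subsection \<open>The semigroup and Duhamel's formula\<close>

lemma heat_weights: "summable (\<lambda>n. \<bar>t ^ n / fact n\<bar> * L ^ n)"
  and heat_weights_sum: "(\<Sum>n. \<bar>t ^ n / fact n\<bar> * L ^ n) = exp (\<bar>t\<bar> * L)"
proof -
  have "(\<bar>t\<bar> * L) ^ n /\<^sub>R fact n = \<bar>t ^ n / fact n\<bar> * L ^ n" for n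
    by (simp add: power_abs power_mult_distrib abs_mult divide_inverse ac_simps)
  then have "(\<lambda>n. \<bar>t ^ n / fact n\<bar> * L ^ n) sums exp (\<bar>t\<bar> * L)"
    using exp_converges[of "\<bar>t\<bar> * L"] by simp
  then show "summable (\<lambda>n. \<bar>t ^ n / fact n\<bar> * L ^ n)"
    and "(\<Sum>n. \<bar>t ^ n / fact n\<bar> * L ^ n) = exp (\<bar>t\<bar> * L)" by (auto simp: sums_iff)
qed

lemmas heat_add_fun = series_add[OF heat_weights, folded heat_def]
  and heat_cmult = series_cmult[OF heat_weights, folded heat_def]
  and heat_l1 = series_l1[OF heat_weights, folded heat_def]
  and act_heat = act_series(2)[OF heat_weights, folded heat_def]

lemma heat_bound:
  assumes "\<And>y. \<bar>f y\<bar> \<le> C"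
  shows "\<bar>heat t f x\<bar> \<le> exp (\<bar>t\<bar> * L) * C"
  using series_bound[OF heat_weights, of f C t x, OF assms] unfolding heat_def heat_weights_sum .

lemma heat_nonneg:
  assumes "t \<ge> 0" "\<And>y. \<bar>f y\<bar> \<le> C" "\<And>y. f y \<ge> 0"
  shows "heat t f x \<ge> 0"
  unfolding heat_def by (rule series_nonneg[OF heat_weights assms(2)]) (use assms in auto)

lemma heat_mono:
  assumes "t \<ge> 0" "\<And>y. \<bar>f y\<bar> \<le> C" "\<And>y. \<bar>g y\<bar> \<le> D" "\<And>y. f y \<le> g y"
  shows "heat t f x \<le> heat t g x"
  unfolding heat_def by (rule series_mono[OF heat_weights assms(2,3)]) (use assms in auto)

lemma heat_0: "heat 0 f = f"
proof
  fix x
  have "(\<Sum>n. 0 ^ n / fact n * (act ^^ n) f x) = (\<Sum>n\<in>{0}. 0 ^ n / fact n * (act ^^ n) f x)"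
    by (rule suminf_finite) auto
  then show "heat 0 f x = f x" by (simp add: heat_def series_def)
qed

lemma heat_eigen:
  assumes "\<And>y. \<bar>f y\<bar> \<le> C" "act f = (\<lambda>x. m * f x)"
  shows "heat t f x = exp (m * t) * f x"
proof -
  have "(\<lambda>n. (m * t) ^ n /\<^sub>R fact n) sums exp (m * t)" by (rule exp_converges)
  then have "(\<lambda>n. t ^ n / fact n * m ^ n) sums exp (m * t)"
    by (simp add: power_mult_distrib divide_inverse ac_simps)
  then show ?thesis
    unfolding heat_def using series_eigen[OF heat_weights, of f C, OF assms] by (auto simp: sums_iff)
qed

lemma heat_has_derivative:
  assumes "\<And>y. \<bar>f y\<bar> \<le> C"
  shows "((\<lambda>t. heat t f x) has_real_derivative heat t (act f) x) (at t within S)"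
proof -
  let ?a = "\<lambda>n. (act ^^ n) f x / fact n"
  have "summable (\<lambda>n. ?a n * t ^ n)" for t
    using series_summable[OF heat_weights, of f C, OF assms] by (simp add: ac_simps)
  then have "DERIV (\<lambda>t. \<Sum>n. ?a n * t ^ n) t :> (\<Sum>n. diffs ?a n * t ^ n)"
    by (rule termdiffs_strong_converges_everywhere)
  moreover have "diffs ?a n = (act ^^ n) (act f) x / fact n" for n
  proof -
    have "(1 + real n) * (u / (fact n + real n * fact n)) = u / fact n" for u :: real
    proof -
      have "fact n + real n * fact n = (1 + real n) * fact n" by (simp add: algebra_simps)
      then show ?thesis by simp
    qed
    then show ?thesis by (simp add: diffs_def funpow_swap1)
  qed
  ultimately show ?thesis
    unfolding heat_def series_def by (simp add: ac_simps has_field_derivative_at_within)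
qed

lemma heat_continuous:
  assumes "\<And>y. \<bar>f y\<bar> \<le> C"
  shows "continuous_on S (\<lambda>t. heat t f x)"
  using heat_has_derivative[OF assms]
  by (meson DERIV_continuous continuous_on_eq_continuous_within)

text \<open>The function \<open>s \<mapsto> \<Sum>k\<le>m. (T - s) ^ k / k! * (B ^ k (w s)) x\<close> equals \<open>w T x\<close> at \<open>s = T\<close> and the Taylor
  polynomial of \<open>heat T (w 0) x\<close> at \<open>s = 0\<close>. Its derivative telescopes: only the source term and a
  remainder of order \<open>(T L) ^ m / m!\<close> survive. Letting \<open>m\<close> tend to infinity gives Duhamel's formula for
  every solution that is bounded, and with it uniqueness.\<close>

lemma duhamel:
  fixes w :: "real \<Rightarrow> 's \<Rightarrow> real" and \<rho> :: "real \<Rightarrow> real" and h :: "'s \<Rightarrow> real"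
  assumes T: "T \<ge> 0"
    and der: "\<And>s x. s \<in> {0..T} \<Longrightarrow>
      ((\<lambda>s. w s x) has_real_derivative act (w s) x + \<rho> s * h x) (at s within {0..T})"
    and wb: "\<And>s x. s \<in> {0..T} \<Longrightarrow> \<bar>w s x\<bar> \<le> C"
    and rb: "\<And>s. s \<in> {0..T} \<Longrightarrow> \<bar>\<rho> s\<bar> \<le> R"
    and hb: "\<And>x. \<bar>h x\<bar> \<le> H"
  shows "((\<lambda>s. heat (T - s) h x * \<rho> s) has_integral (w T x - heat T (w 0) x)) {0..T}"
proof -
  have R: "R \<ge> 0" using rb[of 0] T by auto
  have H: "H \<ge> 0" using hb[of undefined] by linarith
  have C: "C \<ge> 0" using wb[of 0 undefined] T by auto
  have step: "((\<lambda>s. (act ^^ k) (w s) x) has_real_derivative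
      (act ^^ Suc k) (w s) x + \<rho> s * (act ^^ k) h x) (at s within {0..T})"
    if "s \<in> {0..T}" for k s x
    using that
  proof (induction k arbitrary: s x)
    case (Suc k)
    let ?w' = "\<lambda>s y. (act ^^ Suc k) (w s) y + \<rho> s * (act ^^ k) h y"
    have bd: "\<bar>?w' s y\<bar> \<le> L ^ Suc k * C + R * (L ^ k * H)" if "s \<in> {0..T}" for s y
    proof -
      have "\<bar>\<rho> s * (act ^^ k) h y\<bar> \<le> R * (L ^ k * H)"
        unfolding abs_mult using rb[OF that] pow_bound[of h H k y, OF hb] R by (intro mult_mono) auto
      then show ?thesis using pow_bound[of "w s" C "Suc k" y, OF wb[OF that]] by linarith
    qed
    have "((\<lambda>s. act ((act ^^ k) (w s)) x) has_real_derivative act (?w' s) x) (at s within {0..T})"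
      unfolding act_def[of "(act ^^ k) (w s)" for s] act_def[of "?w' s"]
      by (rule has_real_derivative_infsum[where C = "L ^ Suc k * C + R * (L ^ k * H)" and C' = "L ^ k * C"])
        (use B_nonneg B_summable Suc.prems Suc.IH bd pow_bound wb in auto)
    also have "act (?w' s) x = act ((act ^^ Suc k) (w s)) x + act (\<lambda>y. \<rho> s * (act ^^ k) h y) x"
      by (rule act_add[where C = "L ^ Suc k * C" and D = "R * (L ^ k * H)"], rule pow_bound, rule wb, rule Suc.prems)
        (use rb[OF Suc.prems] pow_bound[of h H k, OF hb] R in \<open>auto simp: abs_mult intro!: mult_mono\<close>)
    finally show ?case by (simp add: act_cmult)
  qed (use der in simp)
  \<comment> \<open>the Taylor sum \<open>P\<close> and its derivative \<open>I\<close>\<close>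
  define P where "P m s = (\<Sum>k\<le>m. (T - s) ^ k / fact k * (act ^^ k) (w s) x)" for m s
  define I where "I m s = (T - s) ^ m / fact m * (act ^^ Suc m) (w s) x
      + (\<Sum>k\<le>m. (T - s) ^ k / fact k * (act ^^ k) h x) * \<rho> s" for m s
  have P_der: "(P m has_real_derivative I m s) (at s within {0..T})" if s: "s \<in> {0..T}" for m s
  proof (induction m)
    case 0
    show ?case using der[OF s, of x] by (simp add: P_def[abs_def] I_def ac_simps)
  next
    case (Suc m)
    have d: "((\<lambda>s. (T - s) ^ Suc m / fact (Suc m)) has_real_derivative - ((T - s) ^ m / fact m)) (at s within {0..T})"
      by (rule derivative_eq_intros refl | simp add: divide_simps del: fact_Suc)+ (simp add: fact_Suc)
    have "((\<lambda>s. P m s + (T - s) ^ Suc m / fact (Suc m) * (act ^^ Suc m) (w s) x) has_real_derivative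
       I m s + (- ((T - s) ^ m / fact m) * (act ^^ Suc m) (w s) x
       + ((act ^^ Suc (Suc m)) (w s) x + \<rho> s * (act ^^ Suc m) h x) * ((T - s) ^ Suc m / fact (Suc m))))
       (at s within {0..T})"
      by (intro DERIV_add Suc DERIV_mult d step[OF s])
    moreover have "P (Suc m) = (\<lambda>s. P m s + (T - s) ^ Suc m / fact (Suc m) * (act ^^ Suc m) (w s) x)"
      by (rule ext) (simp add: P_def)
    moreover have "I (Suc m) s = I m s + (- ((T - s) ^ m / fact m) * (act ^^ Suc m) (w s) x
       + ((act ^^ Suc (Suc m)) (w s) x + \<rho> s * (act ^^ Suc m) h x) * ((T - s) ^ Suc m / fact (Suc m)))"
      unfolding I_def sum.atMost_Suc by (simp only: algebra_simps)
    ultimately show ?case by metis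
  qed
  have int: "(I m has_integral (P m T - P m 0)) {0..T}" for m
    by (rule fundamental_theorem_of_calculus[OF T])
      (use P_der in \<open>simp add: has_real_derivative_iff_has_vector_derivative\<close>)
  have PT: "P m T = w T x" for m
  proof -
    have "P m T = (\<Sum>k\<in>{0}. (T - T) ^ k / fact k * (act ^^ k) (w T) x)"
      unfolding P_def by (rule sum.mono_neutral_right) auto
    then show ?thesis by simp
  qed
  have wbound: "\<bar>(T - s) ^ k / fact k\<bar> * L ^ k \<le> exp (T * L)" if "s \<in> {0..T}" for k s
  proof -
    have "\<bar>(T - s) ^ k / fact k\<bar> * L ^ k \<le> \<bar>T ^ k / fact k\<bar> * L ^ k"
      using that L_nonneg by (auto intro!: mult_right_mono divide_right_mono power_mono)
    also have "\<dots> \<le> (\<Sum>n. \<bar>T ^ n / fact n\<bar> * L ^ n)"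
      using sum_le_suminf[OF heat_weights[of T], of "{k}"] L_nonneg by auto
    finally show ?thesis unfolding heat_weights_sum using T by simp
  qed
  have sumterm: "\<bar>\<Sum>k\<le>m. (T - s) ^ k / fact k * (act ^^ k) h x\<bar> \<le> exp (T * L) * H" if "s \<in> {0..T}" for m s
  proof -
    have "\<bar>\<Sum>k\<le>m. (T - s) ^ k / fact k * (act ^^ k) h x\<bar> \<le> (\<Sum>k\<le>m. \<bar>T ^ k / fact k\<bar> * L ^ k * H)"
    proof (rule order_trans[OF sum_abs sum_mono])
      fix k
      have "\<bar>(T - s) ^ k / fact k * (act ^^ k) h x\<bar> \<le> \<bar>T ^ k / fact k\<bar> * (L ^ k * H)"
        unfolding abs_mult using that pow_bound[of h H k x, OF hb]
        by (intro mult_mono) (auto intro!: divide_right_mono power_mono)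
      then show "\<bar>(T - s) ^ k / fact k * (act ^^ k) h x\<bar> \<le> \<bar>T ^ k / fact k\<bar> * L ^ k * H" by (simp add: ac_simps)
    qed
    also have "\<dots> = (\<Sum>k\<le>m. \<bar>T ^ k / fact k\<bar> * L ^ k) * H" by (simp add: sum_distrib_right)
    also have "\<dots> \<le> (\<Sum>n. \<bar>T ^ n / fact n\<bar> * L ^ n) * H"
      using H L_nonneg by (intro mult_right_mono sum_le_suminf heat_weights) auto
    finally show ?thesis unfolding heat_weights_sum using T by simp
  qed
  have lim0: "(\<lambda>m. P m T - P m 0) \<longlonglongrightarrow> w T x - heat T (w 0) x"
  proof -
    have "(\<lambda>n. T ^ n / fact n * (act ^^ n) (w 0) x) sums heat T (w 0) x"
      unfolding heat_def series_def
      by (rule summable_sums, rule series_summable[OF heat_weights, where C = C]) (use wb T in auto)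
    then have "(\<lambda>m. P m 0) \<longlonglongrightarrow> heat T (w 0) x"
      by (simp add: P_def[abs_def] sums_def_le)
    then show ?thesis unfolding PT by (intro tendsto_intros)
  qed
  have dom: "\<bar>I m s\<bar> \<le> exp (T * L) * (L * C) + exp (T * L) * H * R" if s: "s \<in> {0..T}" for m s
  proof -
    have "\<bar>(T - s) ^ m / fact m * (act ^^ Suc m) (w s) x\<bar> \<le> \<bar>(T - s) ^ m / fact m\<bar> * (L ^ Suc m * C)"
      unfolding abs_mult using wb[OF s] by (intro mult_left_mono pow_bound) auto
    also have "\<dots> = (\<bar>(T - s) ^ m / fact m\<bar> * L ^ m) * (L * C)" by (simp add: ac_simps)
    also have "\<dots> \<le> exp (T * L) * (L * C)" using L_nonneg C by (intro mult_right_mono wbound[OF s]) auto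
    finally have 1: "\<bar>(T - s) ^ m / fact m * (act ^^ Suc m) (w s) x\<bar> \<le> exp (T * L) * (L * C)" .
    have 2: "\<bar>(\<Sum>k\<le>m. (T - s) ^ k / fact k * (act ^^ k) h x) * \<rho> s\<bar> \<le> exp (T * L) * H * R"
      unfolding abs_mult by (intro mult_mono sumterm[OF s] rb[OF s]) (use H in auto)
    show ?thesis unfolding I_def using 1 2 by linarith
  qed
  have lim1: "(\<lambda>m. I m s) \<longlonglongrightarrow> heat (T - s) h x * \<rho> s" if s: "s \<in> {0..T}" for s
  proof -
    have "(\<lambda>n. (T - s) ^ n / fact n * (act ^^ n) h x) sums heat (T - s) h x"
      unfolding heat_def series_def
      by (rule summable_sums, rule series_summable[OF heat_weights, where C = H]) (use hb in auto)
    then have 1: "(\<lambda>m. (\<Sum>k\<le>m. (T - s) ^ k / fact k * (act ^^ k) h x) * \<rho> s) \<longlonglongrightarrow> heat (T - s) h x * \<rho> s"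
      by (intro tendsto_intros) (simp add: sums_def_le)
    have "(\<lambda>n. (T - s) ^ n / fact n * (act ^^ Suc n) (w s) x) \<longlonglongrightarrow> 0"
      unfolding funpow_Suc_right o_def
      by (rule summable_LIMSEQ_zero, rule series_summable[OF heat_weights act_bound]) (rule wb[OF s])
    from tendsto_add[OF this 1] show ?thesis by (simp add: I_def[abs_def])
  qed
  have *: "(\<lambda>s. heat (T - s) h x * \<rho> s) integrable_on {0..T}"
    "(\<lambda>m. integral {0..T} (I m)) \<longlonglongrightarrow> integral {0..T} (\<lambda>s. heat (T - s) h x * \<rho> s)"
    using dominated_convergence[of I "{0..T}" "\<lambda>_. exp (T * L) * (L * C) + exp (T * L) * H * R"
        "\<lambda>s. heat (T - s) h x * \<rho> s"] int dom lim1 by (auto intro: integrable_const_ivl)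
  have "(\<lambda>m. integral {0..T} (I m)) \<longlonglongrightarrow> w T x - heat T (w 0) x"
    using lim0 integral_unique[OF int] by simp
  then have "integral {0..T} (\<lambda>s. heat (T - s) h x * \<rho> s) = w T x - heat T (w 0) x"
    using *(2) LIMSEQ_unique by blast
  then show ?thesis using *(1) by (simp add: has_integral_integrable_integral)
qed

lemma heat_unique:
  assumes T: "T \<ge> 0"
    and der: "\<And>s x. s \<in> {0..T} \<Longrightarrow> ((\<lambda>s. w s x) has_real_derivative act (w s) x) (at s within {0..T})"
    and wb: "\<And>s x. s \<in> {0..T} \<Longrightarrow> \<bar>w s x\<bar> \<le> C"
  shows "w T x = heat T (w 0) x"
proof -
  have "((\<lambda>s. heat (T - s) (\<lambda>_. 0) x * 0) has_integral (w T x - heat T (w 0) x)) {0..T}"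
    by (rule duhamel[where C = C and R = 0 and H = 0]) (use assms in auto)
  then have "((\<lambda>s. 0::real) has_integral (w T x - heat T (w 0) x)) {0..T}" by simp
  then show ?thesis using has_integral_is_0[of "{0..T}" "\<lambda>_. 0::real"] has_integral_unique by fastforce
qed

text \<open>Both sides solve the same bounded evolution equation in \<open>s\<close>.\<close>

lemma heat_heat:
  assumes "s \<ge> 0" "t \<ge> 0" and f: "\<And>y. \<bar>f y\<bar> \<le> C"
  shows "heat (s + t) f x = heat s (heat t f) x"
proof -
  have "(\<lambda>s. heat (s + t) f) s x = heat s ((\<lambda>s. heat (s + t) f) 0) x"
  proof (rule heat_unique[where C = "exp ((s + t) * L) * C"])
    fix r y assume r: "r \<in> {0..s}"
    have "((\<lambda>r. heat (r + t) f y) has_real_derivative heat (r + t) (act f) y * (1 + 0)) (at r within {0..s})"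
      by (rule DERIV_chain2[OF heat_has_derivative[OF f]]) (intro DERIV_add DERIV_ident DERIV_const)
    then show "((\<lambda>r. heat (r + t) f y) has_real_derivative act (heat (r + t) f) y) (at r within {0..s})"
      by (simp add: act_heat[OF f])
    have "C \<ge> 0" using f[of undefined] by linarith
    moreover have "\<bar>r + t\<bar> * L \<le> (s + t) * L" using r assms L_nonneg by (intro mult_right_mono) auto
    ultimately show "\<bar>heat (r + t) f y\<bar> \<le> exp ((s + t) * L) * C"
      by (intro order_trans[OF heat_bound[OF f]] mult_right_mono) auto
  qed (use assms in auto)
  then show ?thesis by simp
qed

end

section \<open>Convergence to the ground state\<close>

text \<open>A convex function that increases once keeps increasing at least linearly.\<close>

lemma midpoint_convex_bounded_decreasing:
  fixes D :: "real \<Rightarrow> real"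
  assumes conv: "\<And>a b. a \<ge> 0 \<Longrightarrow> b \<ge> 0 \<Longrightarrow> 2 * D ((a + b) / 2) \<le> D a + D b"
    and bd: "\<And>t. t \<ge> 0 \<Longrightarrow> D t \<le> K"
    and st: "0 \<le> s" "s \<le> t"
  shows "D t \<le> D s"
proof (rule ccontr)
  assume "\<not> D t \<le> D s"
  then have e: "D t - D s > 0" by simp
  define d where "d = t - s"
  have d: "d \<ge> 0" using st by (simp add: d_def)
  \<comment> \<open>By convexity the increments along an arithmetic progression do not decrease.\<close>
  have incr: "D (s + real (Suc k) * d) - D (s + real k * d) \<ge> D t - D s" for k
  proof (induction k)
    case (Suc k)
    have "2 * D (((s + real k * d) + (s + real (Suc (Suc k)) * d)) / 2)
        \<le> D (s + real k * d) + D (s + real (Suc (Suc k)) * d)"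
      using st d by (intro conv) auto
    moreover have "((s + real k * d) + (s + real (Suc (Suc k)) * d)) / 2 = s + real (Suc k) * d"
      by (simp add: field_simps)
    ultimately have "2 * D (s + real (Suc k) * d) \<le> D (s + real k * d) + D (s + real (Suc (Suc k)) * d)"
      by (simp only:)
    then show ?case using Suc by linarith
  qed (simp add: d_def)
  have lower: "D (s + real k * d) \<ge> D s + real k * (D t - D s)" for k
  proof (induction k)
    case (Suc k)
    then show ?case using incr[of k] by (simp add: algebra_simps)
  qed simp
  obtain k :: nat where "real k * (D t - D s) > K - D s"
    using reals_Archimedean3[OF e] by blast
  then show False using lower[of k] bd[of "s + real k * d"] st d by simp
qed

context bounded_kernel
begin

lemma heat_kernel_pairing:
  assumes "\<And>z. \<bar>g z\<bar> \<le> C"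
  shows "(\<lambda>z. heat t (indicator {x}) z * g z) summable_on UNIV"
    and "(\<Sum>\<^sub>\<infinity>z. heat t (indicator {x}) z * g z) = heat t g x"
proof -
  have "(\<lambda>z. \<bar>heat t (indicator {x}) z\<bar>) summable_on UNIV"
    by (rule heat_l1(1)[OF indicator_l1 indicator_le_1])
  note * = summable_on_cmult_left[OF this, of C]
  show "(\<lambda>z. heat t (indicator {x}) z * g z) summable_on UNIV"
    by (rule abs_summable_real(2)[OF *]) (use assms in \<open>auto simp: abs_mult intro!: mult_left_mono\<close>)
  have "(\<Sum>\<^sub>\<infinity>z. heat t (indicator {x}) z * g z) = (\<Sum>\<^sub>\<infinity>z. indicator {x} z * heat t g z)"
    by (rule heat_l1(2)[OF indicator_l1 assms])
  also have "\<dots> = heat t g x"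
    by (subst infsum_single[of x]) (auto simp: indicator_def)
  finally show "(\<Sum>\<^sub>\<infinity>z. heat t (indicator {x}) z * g z) = heat t g x" .
qed

text \<open>A positive summable eigenfunction \<open>\<psi>\<close> bounds the normalised kernel
  \<open>q t x y = exp (- \<mu> t) * heat t \<delta>\<^sub>y x\<close> by \<open>\<psi> x / \<psi> y\<close>. By symmetry and the semigroup property,
  \<open>q (s + t) y y\<close> is the inner product of \<open>q s _ y\<close> and \<open>q t _ y\<close>; hence \<open>D t = q t y y\<close> is
  midpoint convex, and being bounded it decreases. The squared distance
  \<open>D (2 s) + D (2 t) - 2 D (s + t)\<close> of the two functions therefore tends to \<open>0\<close>. The limit is invariant
  under the semigroup, hence a multiple of \<open>\<psi>\<close>, and the conserved inner product with \<open>\<psi>\<close> gives the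
  factor.\<close>

theorem heat_ergodic:
  fixes \<psi> :: "'s \<Rightarrow> real" and \<mu> :: real
  assumes pos: "\<And>x. \<psi> x > 0"
    and sum: "\<psi> summable_on UNIV"
    and eig: "act \<psi> = (\<lambda>x. \<mu> * \<psi> x)"
    and uniq: "\<And>g C. (\<And>x. \<bar>g x\<bar> \<le> C) \<Longrightarrow> act g = (\<lambda>x. \<mu> * g x) \<Longrightarrow> \<exists>\<kappa>. g = (\<lambda>x. \<kappa> * \<psi> x)"
  shows "((\<lambda>t. exp (- \<mu> * t) * heat t (indicator {y}) x) \<longlongrightarrow> \<psi> x * \<psi> y / (\<Sum>\<^sub>\<infinity>z. (\<psi> z)\<^sup>2)) at_top"
proof -
  define q where "q t x = exp (- \<mu> * t) * heat t (indicator {y}) x" for t x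
  define \<Psi> where "\<Psi> = infsum \<psi> UNIV"
  have psi0: "\<psi> x \<ge> 0" for x using pos[of x] by simp
  have psi_le: "\<psi> x \<le> \<Psi>" for x
    using infsum_mono2[of \<psi> "{x}" UNIV] sum psi0 by (simp add: \<Psi>_def)
  then have psi_b: "\<bar>\<psi> x\<bar> \<le> \<Psi>" for x using psi0 by simp
  have heat_psi: "heat t \<psi> x = exp (\<mu> * t) * \<psi> x" for t x
    by (rule heat_eigen[OF psi_b eig])
  have q0: "q t x \<ge> 0" if "t \<ge> 0" for t x
    unfolding q_def by (intro mult_nonneg_nonneg heat_nonneg[OF that indicator_le_1]) auto
  have q_le: "q t x \<le> \<psi> x / \<psi> y" if "t \<ge> 0" for t x
  proof -
    have "heat t (indicator {y}) x \<le> heat t (\<lambda>z. (1 / \<psi> y) * \<psi> z) x"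
      by (rule heat_mono[OF that indicator_le_1, where D = "\<bar>1 / \<psi> y\<bar> * \<Psi>"])
        (use psi_b pos psi0 in \<open>auto simp: abs_mult indicator_def less_imp_neq[symmetric] intro!: divide_right_mono\<close>)
    also have "\<dots> = (1 / \<psi> y) * (exp (\<mu> * t) * \<psi> x)"
      by (subst heat_cmult[OF psi_b]) (simp add: heat_psi)
    finally have "q t x \<le> exp (- \<mu> * t) * ((1 / \<psi> y) * (exp (\<mu> * t) * \<psi> x))"
      unfolding q_def by (rule mult_left_mono) simp
    then show ?thesis by (simp add: exp_minus field_simps)
  qed
  have q_b: "\<bar>q t x\<bar> \<le> \<Psi> / \<psi> y" if "t \<ge> 0" for t x
    using q0[OF that, of x] q_le[OF that, of x] psi_le[of x] pos[of y] divide_right_mono[of "\<psi> x" \<Psi> "\<psi> y"] by simp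
  have pair: "(\<lambda>z. heat s (indicator {x}) z * q t z) summable_on UNIV"
    "(\<Sum>\<^sub>\<infinity>z. exp (- \<mu> * s) * (heat s (indicator {x}) z * q t z)) = q (s + t) x" if "s \<ge> 0" "t \<ge> 0" for s t x
  proof -
    note hp = heat_kernel_pairing[of "q t", OF q_b[OF that(2)], of s x]
    show "(\<lambda>z. heat s (indicator {x}) z * q t z) summable_on UNIV" by (rule hp)
    have "q t = (\<lambda>z. exp (- \<mu> * t) * heat t (indicator {y}) z)" by (rule ext) (rule q_def)
    then have "heat s (q t) x = exp (- \<mu> * t) * heat s (heat t (indicator {y})) x"
      by (simp only: heat_cmult[OF heat_bound[OF indicator_le_1]])
    also have "heat s (heat t (indicator {y})) x = heat (s + t) (indicator {y}) x"
      by (rule heat_heat[OF that indicator_le_1, symmetric])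
    finally have hq: "heat s (q t) x = exp (- \<mu> * t) * heat (s + t) (indicator {y}) x" .
    show "(\<Sum>\<^sub>\<infinity>z. exp (- \<mu> * s) * (heat s (indicator {x}) z * q t z)) = q (s + t) x"
      unfolding infsum_cmult_right' hp(2) hq q_def[of "s + t"] by (simp add: mult_exp_exp algebra_simps)
  qed
  have pairq: "(\<lambda>z. q s z * q t z) summable_on UNIV" "(\<Sum>\<^sub>\<infinity>z. q s z * q t z) = q (s + t) y"
    if "s \<ge> 0" "t \<ge> 0" for s t
    using summable_on_cmult_right[OF pair(1)[OF that, of y], of "exp (- \<mu> * s)"] pair(2)[OF that, of y]
    by (simp_all add: q_def mult.assoc)
  define D where "D t = q t y" for t
  \<comment> \<open>the squared distance in \<open>l\<^sup>2\<close>, of which a single site gives a lower bound\<close>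
  have dist_sq: "(q s x - q t x)\<^sup>2 \<le> D (2 * s) + D (2 * t) - 2 * D (s + t)" if st: "s \<ge> 0" "t \<ge> 0" for s t x
  proof -
    let ?f = "\<lambda>z. q s z * q s z + q t z * q t z + (-2) * (q s z * q t z)"
    note sm = pairq(1)[OF st(1) st(1)] pairq(1)[OF st(2) st(2)] pairq(1)[OF st]
    have sf: "?f summable_on UNIV"
      by (intro summable_on_add summable_on_cmult_right sm)
    have sq: "?f = (\<lambda>z. (q s z - q t z)\<^sup>2)" by (rule ext) (simp add: power2_eq_square algebra_simps)
    have "infsum (\<lambda>z. (q s z - q t z)\<^sup>2) {x} \<le> infsum (\<lambda>z. (q s z - q t z)\<^sup>2) UNIV"
      by (rule infsum_mono2) (use sf[unfolded sq] in auto)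
    also have "infsum (\<lambda>z. (q s z - q t z)\<^sup>2) UNIV = infsum ?f UNIV" by (simp only: sq)
    also have "infsum ?f UNIV = (\<Sum>\<^sub>\<infinity>z. q s z * q s z) + (\<Sum>\<^sub>\<infinity>z. q t z * q t z) + (-2) * (\<Sum>\<^sub>\<infinity>z. q s z * q t z)"
      by (simp only: infsum_add summable_on_add summable_on_cmult_right sm infsum_cmult_right')
    finally show ?thesis unfolding pairq(2)[OF st(1) st(1)] pairq(2)[OF st(2) st(2)] pairq(2)[OF st] by (simp add: D_def)
  qed
  have D_conv: "2 * D ((a + b) / 2) \<le> D a + D b" if "a \<ge> 0" "b \<ge> 0" for a b
    using order_trans[OF zero_le_power2 dist_sq[of "a / 2" "b / 2" y]] that by (simp add: add_divide_distrib)
  have D_le1: "D t \<le> 1" if "t \<ge> 0" for t using q_le[OF that, of y] pos[of y] by (simp add: D_def)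
  have D_dec: "D t \<le> D s" if "0 \<le> s" "s \<le> t" for s t
    by (rule midpoint_convex_bounded_decreasing[OF D_conv D_le1 that])
  define d where "d = Inf (D ` {0..})"
  have bdd: "bdd_below (D ` {0..})" by (rule bdd_belowI2[where m = 0]) (use q0 in \<open>simp add: D_def\<close>)
  have d_le: "d \<le> D t" if "t \<ge> 0" for t unfolding d_def by (rule cInf_lower[OF _ bdd]) (use that in auto)
  have cauchy: "\<exists>T\<ge>0. \<forall>s\<ge>T. \<forall>t\<ge>T. \<forall>x. \<bar>q s x - q t x\<bar> < e" if e: "e > 0" for e
  proof -
    have "\<exists>u\<in>D ` {0..}. u < d + e\<^sup>2 / 2"
      unfolding d_def by (rule cInf_lessD) (use e in auto)
    then obtain T where T: "T \<ge> 0" "D T < d + e\<^sup>2 / 2" by auto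
    have "\<bar>q s x - q t x\<bar> < e" if "s \<ge> T" "t \<ge> T" for s t x
    proof -
      have "(q s x - q t x)\<^sup>2 \<le> D (2 * s) + D (2 * t) - 2 * D (s + t)"
        using that T by (intro dist_sq) auto
      also have "\<dots> \<le> D T + D T - 2 * d"
        using D_dec[of T "2 * s"] D_dec[of T "2 * t"] d_le[of "s + t"] that T by simp
      also have "\<dots> < e\<^sup>2" using T by simp
      finally have "\<bar>q s x - q t x\<bar>\<^sup>2 < e\<^sup>2" by simp
      then show ?thesis by (rule power2_less_imp_less) (use e in simp)
    qed
    then show ?thesis using T(1) by blast
  qed
  have "\<exists>l. ((\<lambda>t. q t x) \<longlongrightarrow> l) at_top" for x
  proof -
    have "Cauchy (\<lambda>n. q (real n) x)"
    proof (rule metric_CauchyI)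
      fix e :: real assume "e > 0"
      then obtain T where T: "\<And>s t. s \<ge> T \<Longrightarrow> t \<ge> T \<Longrightarrow> \<bar>q s x - q t x\<bar> < e" using cauchy by meson
      obtain N :: nat where "real N \<ge> T" using real_arch_simple by blast
      then have "real m \<ge> T" if "m \<ge> N" for m using that by simp
      then show "\<exists>M. \<forall>m\<ge>M. \<forall>n\<ge>M. dist (q (real m) x) (q (real n) x) < e"
        unfolding dist_real_def using T by blast
    qed
    then obtain l where l: "(\<lambda>n. q (real n) x) \<longlonglongrightarrow> l" by (auto simp: Cauchy_convergent_iff convergent_def)
    have "((\<lambda>t. q t x) \<longlongrightarrow> l) at_top"
    proof (rule tendstoI)
      fix e :: real assume e: "e > 0"
      then obtain T where T: "\<And>s t. s \<ge> T \<Longrightarrow> t \<ge> T \<Longrightarrow> \<bar>q s x - q t x\<bar> < e / 2" using cauchy[of "e / 2"] by auto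
      have "dist (q t x) l < e" if t: "t \<ge> T" for t
      proof -
        have "\<bar>q t x - l\<bar> \<le> e / 2"
        proof (rule tendsto_upperbound)
          show "(\<lambda>n. \<bar>q t x - q (real n) x\<bar>) \<longlonglongrightarrow> \<bar>q t x - l\<bar>" by (intro tendsto_intros l)
          show "\<forall>\<^sub>F n in sequentially. \<bar>q t x - q (real n) x\<bar> \<le> e / 2"
            using eventually_ge_at_top[of "nat \<lceil>T\<rceil>"]
          proof eventually_elim
            case (elim n)
            then have "real n \<ge> T" by linarith
            then show ?case using T[OF t] by (simp add: less_imp_le)
          qed
        qed simp
        then show ?thesis using e by (simp add: dist_real_def)
      qed
      then show "\<forall>\<^sub>F t in at_top. dist (q t x) l < e"
        by (rule eventually_mono[OF eventually_ge_at_top[of T]])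
    qed
    then show ?thesis by blast
  qed
  then obtain g where g: "\<And>x. ((\<lambda>t. q t x) \<longlongrightarrow> g x) at_top" by metis
  have ev0: "\<forall>\<^sub>F t in at_top. (t::real) \<ge> 0" by (rule eventually_ge_at_top)
  have g_b: "\<bar>g x\<bar> \<le> \<Psi> / \<psi> y" for x
  proof (rule tendsto_upperbound[OF tendsto_rabs[OF g] _ trivial_limit_at_top_linorder])
    show "\<forall>\<^sub>F t in at_top. \<bar>q t x\<bar> \<le> \<Psi> / \<psi> y" using ev0 by eventually_elim (rule q_b)
  qed
  have heat_g: "heat s g x = exp (\<mu> * s) * g x" if s: "s \<ge> 0" for s x
  proof -
    let ?h = "\<lambda>z. exp (- \<mu> * s) * heat s (indicator {x}) z"
    have h0: "?h z \<ge> 0" for z by (intro mult_nonneg_nonneg heat_nonneg[OF s indicator_le_1]) auto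
    have sm: "?h summable_on UNIV"
      using summable_on_cmult_right[OF heat_kernel_pairing(1)[of "\<lambda>_. 1" 1 s x], of "exp (- \<mu> * s)"] by simp
    have "((\<lambda>t. \<Sum>\<^sub>\<infinity>z. ?h z * q t z) \<longlongrightarrow> (\<Sum>\<^sub>\<infinity>z. ?h z * g z)) at_top"
    proof (rule tendsto_infsum_dominated[OF summable_on_cmult_left[OF sm, of "\<Psi> / \<psi> y"]])
      show "\<forall>\<^sub>F t in at_top. \<forall>z\<in>UNIV. \<bar>?h z * q t z\<bar> \<le> ?h z * (\<Psi> / \<psi> y)"
        using ev0
      proof eventually_elim
        case (elim t)
        show ?case
        proof
          fix z
          have "\<bar>?h z * q t z\<bar> = ?h z * \<bar>q t z\<bar>" using h0[of z] by (simp add: abs_mult zero_le_mult_iff)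
          also have "\<dots> \<le> ?h z * (\<Psi> / \<psi> y)" by (rule mult_left_mono[OF q_b[OF elim] h0])
          finally show "\<bar>?h z * q t z\<bar> \<le> ?h z * (\<Psi> / \<psi> y)" .
        qed
      qed
    qed (intro tendsto_intros g)
    moreover have "(\<Sum>\<^sub>\<infinity>z. ?h z * g z) = exp (- \<mu> * s) * heat s g x"
      unfolding heat_kernel_pairing(2)[OF g_b, symmetric]
      by (subst infsum_cmult_right'[symmetric]) (simp add: mult.assoc)
    ultimately have "((\<lambda>t. \<Sum>\<^sub>\<infinity>z. ?h z * q t z) \<longlongrightarrow> exp (- \<mu> * s) * heat s g x) at_top" by simp
    then have "((\<lambda>t. q (s + t) x) \<longlongrightarrow> exp (- \<mu> * s) * heat s g x) at_top"
    proof (rule Lim_transform_eventually)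
      show "\<forall>\<^sub>F t in at_top. (\<Sum>\<^sub>\<infinity>z. ?h z * q t z) = q (s + t) x"
        using ev0 by eventually_elim (use pair(2)[OF s, of _ x] in \<open>simp add: mult.assoc\<close>)
    qed
    moreover have "((\<lambda>t. q (s + t) x) \<longlongrightarrow> g x) at_top"
      by (rule filterlim_compose[OF g filterlim_tendsto_add_at_top[OF tendsto_const filterlim_ident]])
    ultimately have "exp (- \<mu> * s) * heat s g x = g x"
      using tendsto_unique trivial_limit_at_top_linorder by blast
    then show ?thesis by (auto simp: exp_minus field_simps)
  qed
  \<comment> \<open>differentiating the invariance of \<open>g\<close> at time \<open>0\<close>\<close>
  have "act g x = \<mu> * g x" for x
  proof -
    have "((\<lambda>s. heat s g x) has_real_derivative act g x) (at 0 within {0..})"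
      using heat_has_derivative[of g "\<Psi> / \<psi> y" x 0 "{0..}", OF g_b] by (simp add: heat_0)
    moreover have "((\<lambda>s. heat s g x) has_real_derivative \<mu> * g x) (at 0 within {0..})"
    proof (rule has_field_derivative_transform_within[where d = 1])
      show "((\<lambda>s. exp (\<mu> * s) * g x) has_real_derivative \<mu> * g x) (at 0 within {0..})"
        by (auto intro!: derivative_eq_intros)
    qed (auto simp: heat_g)
    ultimately show ?thesis
      by (rule has_field_derivative_unique) (simp add: at_within_Ici_at_right)
  qed
  then have "act g = (\<lambda>x. \<mu> * g x)" by (rule ext)
  from uniq[of g, OF g_b this] obtain \<kappa> where \<kappa>: "g = (\<lambda>x. \<kappa> * \<psi> x)" by blast
  have psi_sq: "(\<lambda>z. \<psi> z * \<psi> z) summable_on UNIV"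
    by (rule abs_summable_real(2)[OF summable_on_cmult_left[OF sum, of \<Psi>]])
      (use psi0 psi_le in \<open>auto intro!: mult_left_mono\<close>)
  have "((\<lambda>t. \<Sum>\<^sub>\<infinity>z. q t z * \<psi> z) \<longlongrightarrow> (\<Sum>\<^sub>\<infinity>z. g z * \<psi> z)) at_top"
  proof (rule tendsto_infsum_dominated[OF summable_on_cmult_left[OF psi_sq, of "1 / \<psi> y"]])
    show "\<forall>\<^sub>F t in at_top. \<forall>z\<in>UNIV. \<bar>q t z * \<psi> z\<bar> \<le> \<psi> z * \<psi> z * (1 / \<psi> y)"
      using ev0
    proof eventually_elim
      case (elim t)
      show ?case using mult_right_mono[OF q_le[OF elim] psi0] q0[OF elim] psi0 by simp
    qed
  qed (intro tendsto_intros g)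
  then have "((\<lambda>t::real. \<psi> y) \<longlongrightarrow> (\<Sum>\<^sub>\<infinity>z. g z * \<psi> z)) at_top"
  proof (rule Lim_transform_eventually)
    have "(\<Sum>\<^sub>\<infinity>z. q t z * \<psi> z) = exp (- \<mu> * t) * heat t \<psi> y" for t
      unfolding q_def heat_kernel_pairing(2)[OF psi_b, symmetric]
      by (subst infsum_cmult_right'[symmetric]) (simp add: mult.assoc)
    then show "\<forall>\<^sub>F t in at_top. (\<Sum>\<^sub>\<infinity>z. q t z * \<psi> z) = \<psi> y"
      by (simp add: heat_psi exp_minus)
  qed
  then have "\<psi> y = (\<Sum>\<^sub>\<infinity>z. g z * \<psi> z)"
    using tendsto_unique[OF trivial_limit_at_top_linorder] tendsto_const by blast
  also have "\<dots> = \<kappa> * (\<Sum>\<^sub>\<infinity>z. (\<psi> z)\<^sup>2)"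
    unfolding \<kappa> by (subst infsum_cmult_right'[symmetric]) (simp add: power2_eq_square mult.assoc)
  finally have *: "\<psi> y = \<kappa> * (\<Sum>\<^sub>\<infinity>z. (\<psi> z)\<^sup>2)" .
  with pos[of y] have "(\<Sum>\<^sub>\<infinity>z. (\<psi> z)\<^sup>2) \<noteq> 0" by auto
  with * have "g x = \<psi> x * \<psi> y / (\<Sum>\<^sub>\<infinity>z. (\<psi> z)\<^sup>2)" by (simp add: \<kappa> field_simps)
  then show ?thesis using g[of x] by (simp add: q_def)
qed

end

section \<open>Markov semigroups with conservative rates\<close>

lemma expectation_finite_part:
  fixes f :: "'c \<Rightarrow> real"
  assumes A: "finite A" and f: "\<And>c. \<bar>f c\<bar> \<le> C"
  shows "\<bar>measure_pmf.expectation P f - (\<Sum>c\<in>A. pmf P c * f c)\<bar> \<le> C * (1 - (\<Sum>c\<in>A. pmf P c))"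
proof -
  have C: "C \<ge> 0" using f[of undefined] by linarith
  have int: "integrable (measure_pmf P) g" if "\<And>c. \<bar>g c\<bar> \<le> C" for g :: "'c \<Rightarrow> real"
    by (rule measure_pmf.integrable_const_bound[where B = C]) (use that in auto)
  have i1: "integrable (measure_pmf P) (\<lambda>c. f c * indicator A c)"
    by (rule int) (use f C in \<open>auto simp: indicator_def\<close>)
  have i2: "integrable (measure_pmf P) (\<lambda>c. f c * indicator (- A) c)"
    by (rule int) (use f C in \<open>auto simp: indicator_def\<close>)
  have "measure_pmf.expectation P f
      = measure_pmf.expectation P (\<lambda>c. f c * indicator A c + f c * indicator (- A) c)"
    by (rule Bochner_Integration.integral_cong) (auto simp: indicator_def)
  also have "\<dots> = measure_pmf.expectation P (\<lambda>c. f c * indicator A c)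
      + measure_pmf.expectation P (\<lambda>c. f c * indicator (- A) c)"
    by (rule Bochner_Integration.integral_add[OF i1 i2])
  also have "measure_pmf.expectation P (\<lambda>c. f c * indicator A c) = (\<Sum>c\<in>A. (f c * indicator A c) * pmf P c)"
    by (rule integral_measure_pmf_real[OF A]) (auto simp: indicator_def split: if_splits)
  also have "\<dots> = (\<Sum>c\<in>A. pmf P c * f c)" by (rule sum.cong) auto
  finally have eq: "measure_pmf.expectation P f - (\<Sum>c\<in>A. pmf P c * f c)
    = measure_pmf.expectation P (\<lambda>c. f c * indicator (- A) c)" by simp
  have "\<bar>measure_pmf.expectation P (\<lambda>c. f c * indicator (- A) c)\<bar>
      \<le> measure_pmf.expectation P (\<lambda>c. \<bar>f c * indicator (- A) c\<bar>)"
    by (rule integral_abs_bound)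
  also have "\<dots> \<le> measure_pmf.expectation P (\<lambda>c. C * indicator (- A) c)"
    by (rule integral_mono[OF integrable_abs[OF i2] int]) (use f C in \<open>auto simp: indicator_def\<close>)
  also have "\<dots> = C * measure_pmf.prob P (- A)" by simp
  also have "measure_pmf.prob P (- A) = 1 - measure_pmf.prob P A"
    using measure_pmf.prob_compl[of A P] by (simp add: Compl_eq_Diff_UNIV)
  also have "measure_pmf.prob P A = (\<Sum>c\<in>A. pmf P c)" by (rule measure_measure_pmf_finite[OF A])
  finally show ?thesis by (simp add: eq)
qed

text \<open>The infinitesimal behaviour need only be known along a family of targets whose rates sum to
  zero: since the laws are probability measures, the mass on all other targets is then \<open>o(h)\<close>, and a
  finite part of the family already carries all but \<open>\<epsilon> h\<close> of it.\<close>

lemma generator_limit: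
  fixes P :: "real \<Rightarrow> 'c pmf" and e :: "'i \<Rightarrow> 'c" and g :: "real \<Rightarrow> 'c \<Rightarrow> real"
  assumes inj: "inj_on e I" and i0: "i0 \<in> I" and q: "(q has_sum 0) I"
    and rate: "\<And>i. i \<in> I \<Longrightarrow>
      ((\<lambda>h. (pmf (P h) (e i) - (if i = i0 then 1 else 0)) / h) \<longlongrightarrow> q i) (at_right 0)"
    and g: "\<And>i. i \<in> I \<Longrightarrow> ((\<lambda>h. g h (e i)) \<longlongrightarrow> g0 (e i)) (at_right 0)"
    and gb: "\<And>h c. \<bar>g h c\<bar> \<le> C"
  shows "((\<lambda>h. (measure_pmf.expectation (P h) (g h) - g h (e i0)) / h)
      \<longlongrightarrow> (\<Sum>\<^sub>\<infinity>i\<in>I. q i * g0 (e i))) (at_right 0)"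
proof (rule tendstoI)
  fix \<epsilon> :: real assume \<epsilon>: "\<epsilon> > 0"
  have C: "C \<ge> 0" using gb[of undefined undefined] by linarith
  \<comment> \<open>The mass off the finite part contributes at most \<open>2 C \<eta>\<close>, and its two limits \<open>\<eta>\<close> each.\<close>
  define \<eta> where "\<eta> = \<epsilon> / (2 * C + 3)"
  have \<eta>: "\<eta> > 0" "(2 * C + 2) * \<eta> < \<epsilon>" using \<epsilon> C by (auto simp: \<eta>_def field_simps)
  have g0b: "\<bar>g0 (e i)\<bar> \<le> C" if "i \<in> I" for i
    by (rule tendsto_upperbound[OF tendsto_rabs[OF g[OF that]]]) (use gb in auto)
  define S where "S = (\<Sum>\<^sub>\<infinity>i\<in>I. q i * g0 (e i))"
  have "(\<lambda>i. \<bar>q i\<bar>) summable_on I"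
    using q summable_on_iff_abs_summable_on_real[of q I] by (auto simp: summable_on_def)
  then have "(\<lambda>i. q i * g0 (e i)) summable_on I"
    by (rule abs_summable_real(2)[OF summable_on_cmult_left[where c = C]])
      (use g0b in \<open>auto simp: abs_mult intro!: mult_left_mono\<close>)
  then have hs: "((\<lambda>i. q i * g0 (e i)) has_sum S) I" unfolding S_def by (rule has_sum_infsum)
  have "\<forall>\<^sub>F F in finite_subsets_at_top I. dist (sum q F) 0 < \<eta> \<and> dist (\<Sum>i\<in>F. q i * g0 (e i)) S < \<eta>
      \<and> (finite F \<and> {i0} \<subseteq> F \<and> F \<subseteq> I)"
    using q hs \<eta>(1) i0 unfolding has_sum_def tendsto_iff
    by (intro eventually_conj) (auto simp: eventually_finite_subsets_at_top intro!: exI[of _ "{i0}"])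
  from eventually_happens'[OF finite_subsets_at_top_neq_bot this]
  obtain F where F: "finite F" "i0 \<in> F" "F \<subseteq> I" "\<bar>sum q F\<bar> < \<eta>" "\<bar>(\<Sum>i\<in>F. q i * g0 (e i)) - S\<bar> < \<eta>"
    by (auto simp: dist_real_def)
  define r where "r h i = (pmf (P h) (e i) - (if i = i0 then 1 else 0)) / h" for h i
  have "((\<lambda>h. sum (r h) F) \<longlongrightarrow> sum q F) (at_right 0)"
    unfolding r_def by (intro tendsto_sum rate) (use F in auto)
  then have e1: "\<forall>\<^sub>F h in at_right 0. \<bar>sum (r h) F - sum q F\<bar> < \<eta>"
    using \<eta>(1) by (auto simp: tendsto_iff dist_real_def)
  have "((\<lambda>h. \<Sum>i\<in>F. r h i * g h (e i)) \<longlongrightarrow> (\<Sum>i\<in>F. q i * g0 (e i))) (at_right 0)"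
    unfolding r_def by (intro tendsto_sum tendsto_mult rate g) (use F in auto)
  then have e2: "\<forall>\<^sub>F h in at_right 0. \<bar>(\<Sum>i\<in>F. r h i * g h (e i)) - (\<Sum>i\<in>F. q i * g0 (e i))\<bar> < \<eta>"
    using \<eta>(1) by (auto simp: tendsto_iff dist_real_def)
  have e3: "\<forall>\<^sub>F h in at_right 0. (h::real) > 0" by (rule eventually_at_right_less)
  show "\<forall>\<^sub>F h in at_right 0. dist ((measure_pmf.expectation (P h) (g h) - g h (e i0)) / h) S < \<epsilon>"
    unfolding S_def[symmetric] using e1 e2 e3
  proof eventually_elim
    case (elim h)
    have injF: "inj_on e F" using inj F(3) by (rule inj_on_subset)
    have "\<bar>measure_pmf.expectation (P h) (g h) - (\<Sum>c\<in>e ` F. pmf (P h) c * g h c)\<bar>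
        \<le> C * (1 - (\<Sum>c\<in>e ` F. pmf (P h) c))"
      by (rule expectation_finite_part) (use F gb in auto)
    then have *: "\<bar>measure_pmf.expectation (P h) (g h) - (\<Sum>i\<in>F. pmf (P h) (e i) * g h (e i))\<bar>
        \<le> C * (1 - (\<Sum>i\<in>F. pmf (P h) (e i)))" by (simp add: sum.reindex[OF injF])
    have s1: "sum (r h) F = ((\<Sum>i\<in>F. pmf (P h) (e i)) - 1) / h"
      using F(1,2) by (simp add: r_def sum_divide_distrib[symmetric] sum_subtractf sum.delta)
    have "(\<Sum>i\<in>F. (pmf (P h) (e i) - (if i = i0 then 1 else 0)) * g h (e i))
        = (\<Sum>i\<in>F. pmf (P h) (e i) * g h (e i) - (if i = i0 then g h (e i) else 0))"
      by (rule sum.cong) (auto simp: algebra_simps)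
    also have "\<dots> = (\<Sum>i\<in>F. pmf (P h) (e i) * g h (e i)) - g h (e i0)"
      using F(1,2) by (simp add: sum_subtractf sum.delta)
    finally have s2: "(\<Sum>i\<in>F. r h i * g h (e i)) = ((\<Sum>i\<in>F. pmf (P h) (e i) * g h (e i)) - g h (e i0)) / h"
      by (simp add: r_def sum_divide_distrib[symmetric])
    have "\<bar>(measure_pmf.expectation (P h) (g h) - g h (e i0)) / h - (\<Sum>i\<in>F. r h i * g h (e i))\<bar>
        = \<bar>measure_pmf.expectation (P h) (g h) - (\<Sum>i\<in>F. pmf (P h) (e i) * g h (e i))\<bar> / h"
      using elim(3) unfolding s2 by (simp add: diff_divide_distrib[symmetric] abs_divide)
    also have "\<dots> \<le> C * (1 - (\<Sum>i\<in>F. pmf (P h) (e i))) / h"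
      using * elim(3) by (intro divide_right_mono) auto
    also have "\<dots> = C * (- sum (r h) F)" unfolding s1 using elim(3) by (simp add: field_simps)
    also have "\<dots> \<le> C * (2 * \<eta>)" using F(4) elim(1) C by (intro mult_left_mono) auto
    finally have "\<bar>(measure_pmf.expectation (P h) (g h) - g h (e i0)) / h - S\<bar> < 2 * C * \<eta> + 2 * \<eta>"
      using F(5) elim(2) by linarith
    then show ?case using \<eta>(2) by (simp add: dist_real_def algebra_simps)
  qed
qed

locale markov_semigroup =
  fixes P :: "real \<Rightarrow> 'c \<Rightarrow> 'c pmf"
  assumes start: "P 0 c = return_pmf c"
    and Chapman_Kolmogorov: "s \<ge> 0 \<Longrightarrow> t \<ge> 0 \<Longrightarrow> P (s + t) c = bind_pmf (P s c) (P t)"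
begin

definition ev :: "('c \<Rightarrow> real) \<Rightarrow> real \<Rightarrow> 'c \<Rightarrow> real" where
  "ev f t c = measure_pmf.expectation (P t c) f"

lemma ev_0: "ev f 0 c = f c"
  by (simp add: ev_def start)

context
  fixes f :: "'c \<Rightarrow> real" and C :: real
  assumes f0: "\<And>c. 0 \<le> f c" and fC: "\<And>c. f c \<le> C"
begin

lemma ev_integrable: "integrable (measure_pmf p) f"
  by (rule measure_pmf.integrable_const_bound[where B = C]) (use f0 fC in auto)

lemma ev_range: "0 \<le> ev f t c" "ev f t c \<le> C"
proof -
  show "0 \<le> ev f t c" unfolding ev_def by (rule integral_nonneg_AE) (use f0 in auto)
  show "ev f t c \<le> C" unfolding ev_def
    by (rule measure_pmf.integral_le_const[OF ev_integrable]) (use fC in auto)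
qed

lemma ev_semigroup:
  assumes "s \<ge> 0" "t \<ge> 0"
  shows "ev f (s + t) c = measure_pmf.expectation (P s c) (ev f t)"
proof -
  have nn: "(\<integral>\<^sup>+x. ennreal (f x) \<partial>P t c) = ennreal (ev f t c)" for t c
    unfolding ev_def by (rule nn_integral_eq_integral[OF ev_integrable]) (use f0 in auto)
  have "ennreal (ev f (s + t) c) = (\<integral>\<^sup>+x. ennreal (ev f t x) \<partial>P s c)"
    unfolding nn[symmetric] Chapman_Kolmogorov[OF assms] by simp
  also have "\<dots> = ennreal (measure_pmf.expectation (P s c) (ev f t))"
    by (rule nn_integral_eq_integral[OF measure_pmf.integrable_const_bound[where B = C]])
      (use ev_range in auto)
  finally show ?thesis
    by (subst (asm) ennreal_inj) (auto intro!: ev_range integral_nonneg_AE)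
qed

text \<open>Over a time step \<open>h\<close> the expectation changes by at most \<open>C\<close> times the probability of having left
  the initial state, whatever the current time.\<close>

lemma ev_continuous:
  assumes stay: "((\<lambda>h. pmf (P h c) c) \<longlongrightarrow> 1) (at_right 0)"
  shows "continuous_on {0..} (\<lambda>t. ev f t c)"
proof -
  have C: "C \<ge> 0" using f0 fC order_trans by blast
  have incr: "\<bar>ev f (h + t) c - ev f t c\<bar> \<le> C * (1 - pmf (P h c) c)" if "h \<ge> 0" "t \<ge> 0" for h t
  proof -
    have b: "\<bar>ev f t c' - ev f t c\<bar> \<le> C" for c' using ev_range[of t c] ev_range[of t c'] by simp
    have i: "integrable (measure_pmf (P h c)) (ev f t)"
      by (rule measure_pmf.integrable_const_bound[where B = C]) (use ev_range in auto)
    have "\<bar>measure_pmf.expectation (P h c) (\<lambda>c'. ev f t c' - ev f t c)\<bar> \<le> C * (1 - pmf (P h c) c)"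
      using expectation_finite_part[of "{c}" "\<lambda>c'. ev f t c' - ev f t c" C "P h c", OF _ b] by simp
    then show ?thesis using i by (simp add: ev_semigroup[OF that])
  qed
  show ?thesis unfolding continuous_on_iff
  proof safe
    fix t e :: real assume t: "t \<ge> 0" and e: "e > 0"
    have "((\<lambda>h. C * (1 - pmf (P h c) c)) \<longlongrightarrow> C * (1 - 1)) (at_right 0)"
      by (intro tendsto_intros stay)
    then have "\<forall>\<^sub>F h in at_right 0. C * (1 - pmf (P h c) c) < e"
      using e by (intro order_tendstoD(2)) auto
    then obtain d where d: "d > 0" "\<And>h. 0 < h \<Longrightarrow> h < d \<Longrightarrow> C * (1 - pmf (P h c) c) < e"
      unfolding eventually_at_right_field by auto
    have "dist (ev f s c) (ev f t c) < e" if s: "s \<ge> 0" "dist s t < d" for s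
    proof (cases s t rule: linorder_cases)
      case less
      then show ?thesis using incr[of "t - s" s] d(2)[of "t - s"] s t
        by (auto simp: dist_real_def abs_minus_commute)
    next
      case greater
      then show ?thesis using incr[of "s - t" t] d(2)[of "s - t"] s t
        by (auto simp: dist_real_def abs_minus_commute)
    qed (use e in auto)
    then show "\<exists>d>0. \<forall>s\<in>{0..}. dist s t < d \<longrightarrow> dist (ev f s c) (ev f t c) < e" using d(1) by auto
  qed
qed

text \<open>On the right, the semigroup property turns the difference quotient into one of the generator
  applied to \<open>ev f t\<close>. On the left it is the generator applied to \<open>ev f (t - h)\<close>, which is why the limit
  theorem admits functions that depend on \<open>h\<close>, and why continuity in time is needed at all targets.\<close>

theorem backward_equation:
  fixes e :: "'i \<Rightarrow> 'c"
  assumes inj: "inj_on e I" and i0: "i0 \<in> I" and q: "(q has_sum 0) I"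
    and rate: "\<And>i. i \<in> I \<Longrightarrow>
      ((\<lambda>h. (pmf (P h (e i0)) (e i) - (if i = i0 then 1 else 0)) / h) \<longlongrightarrow> q i) (at_right 0)"
    and stay: "\<And>i. i \<in> I \<Longrightarrow> ((\<lambda>h. pmf (P h (e i)) (e i)) \<longlongrightarrow> 1) (at_right 0)"
    and t: "t \<ge> 0"
  shows "((\<lambda>t. ev f t (e i0)) has_real_derivative (\<Sum>\<^sub>\<infinity>i\<in>I. q i * ev f t (e i))) (at t within {0..})"
proof -
  let ?D = "\<Sum>\<^sub>\<infinity>i\<in>I. q i * ev f t (e i)"
  have b: "\<bar>ev f t c\<bar> \<le> C" for t c using ev_range[of t c] by simp
  have "((\<lambda>h. (measure_pmf.expectation (P h (e i0)) (ev f t) - ev f t (e i0)) / h) \<longlongrightarrow> ?D) (at_right 0)"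
    by (rule generator_limit[where g = "\<lambda>_. ev f t", OF inj i0 q rate _ b]) auto
  then have "((\<lambda>h. (ev f (h + t) (e i0) - ev f t (e i0)) / (h + t - t)) \<longlongrightarrow> ?D) (at_right 0)"
  proof (rule Lim_transform_eventually)
    show "\<forall>\<^sub>F h in at_right 0. (measure_pmf.expectation (P h (e i0)) (ev f t) - ev f t (e i0)) / h
        = (ev f (h + t) (e i0) - ev f t (e i0)) / (h + t - t)"
      using eventually_at_right_less[of "0::real"] by eventually_elim (use t in \<open>simp add: ev_semigroup\<close>)
  qed
  then have right: "((\<lambda>s. (ev f s (e i0) - ev f t (e i0)) / (s - t)) \<longlongrightarrow> ?D) (at_right t)"
    by (subst filterlim_at_right_to_0) simp
  show ?thesis
  proof (cases "t = 0")
    case True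
    then show ?thesis using right by (simp add: has_field_derivative_iff at_within_Ici_at_right)
  next
    case False
    with t have t: "t > 0" by simp
    \<comment> \<open>\<open>max 0\<close> keeps the time in the range where the laws are specified\<close>
    have c: "((\<lambda>h. ev f (max 0 (t - h)) (e i)) \<longlongrightarrow> ev f t (e i)) (at_right 0)" if "i \<in> I" for i
    proof -
      have "((\<lambda>h. max 0 (t - h)) \<longlongrightarrow> max 0 (t - 0)) (at_right 0)" by (intro tendsto_intros)
      then have "((\<lambda>h. max 0 (t - h)) \<longlongrightarrow> t) (at_right 0)" using t by simp
      from continuous_on_tendsto_compose[OF ev_continuous[OF stay[OF that]] this] t show ?thesis by simp
    qed
    have "((\<lambda>h. (measure_pmf.expectation (P h (e i0)) (ev f (max 0 (t - h))) - ev f (max 0 (t - h)) (e i0)) / h)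
        \<longlongrightarrow> ?D) (at_right 0)"
      by (rule generator_limit[where g = "\<lambda>h. ev f (max 0 (t - h))" and ?g0.0 = "ev f t", OF inj i0 q rate c b])
    then have "((\<lambda>h. (ev f (- (h + - t)) (e i0) - ev f t (e i0)) / (- (h + - t) - t)) \<longlongrightarrow> ?D) (at_right 0)"
    proof (rule Lim_transform_eventually)
      have "\<forall>\<^sub>F h in at_right (0::real). h < t" using t
        by (auto simp: eventually_at_right_field)
      with eventually_at_right_less[of "0::real"]
      show "\<forall>\<^sub>F h in at_right 0. (measure_pmf.expectation (P h (e i0)) (ev f (max 0 (t - h))) - ev f (max 0 (t - h)) (e i0)) / h
        = (ev f (- (h + - t)) (e i0) - ev f t (e i0)) / (- (h + - t) - t)"
      proof eventually_elim
        case (elim h)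
        then show ?case using ev_semigroup[of h "t - h" "e i0"] by (simp add: field_simps)
      qed
    qed
    then have left: "((\<lambda>s. (ev f s (e i0) - ev f t (e i0)) / (s - t)) \<longlongrightarrow> ?D) (at_left t)"
      by (subst filterlim_at_left_to_right, subst filterlim_at_right_to_0)
    have "((\<lambda>s. (ev f s (e i0) - ev f t (e i0)) / (s - t)) \<longlongrightarrow> ?D) (at t)"
      using left right by (rule filterlim_split_at_real)
    then show ?thesis
      unfolding has_field_derivative_iff by (rule tendsto_within_subset) simp
  qed
qed

end
end

section \<open>Square-summable functions\<close>

context bounded_kernel
begin

lemma act_eq_series: "act f x = series (\<lambda>n. if n = 1 then 1 else 0) f x"
  and act_weights: "summable (\<lambda>n. \<bar>if n = 1 then 1 else 0\<bar> * L ^ n)"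
proof -
  have "(\<Sum>n. (if n = 1 then 1 else 0) * (act ^^ n) f x) = (\<Sum>n\<in>{1}. (if n = 1 then 1 else 0) * (act ^^ n) f x)"
    by (rule suminf_finite) auto
  then show "act f x = series (\<lambda>n. if n = 1 then 1 else 0) f x" by (simp add: series_def)
  show "summable (\<lambda>n. \<bar>if n = 1 then 1 else 0\<bar> * L ^ n)"
    by (rule summable_finite[of "{1}"]) auto
qed

text \<open>Cauchy--Schwarz for the positive functional \<open>f \<mapsto> series w f x\<close>, obtained from
  \<open>series w ((f - \<theta>)\<^sup>2) x \<ge> 0\<close> with the optimal constant \<open>\<theta>\<close>, and then symmetry:
  the Schur test.\<close>

lemma series_l2:
  assumes w: "summable (\<lambda>n. \<bar>w n\<bar> * L ^ n)" and w0: "\<And>n. w n \<ge> 0"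
    and f: "(\<lambda>x. (f x)\<^sup>2) summable_on UNIV"
  shows "(\<lambda>x. (series w f x)\<^sup>2) summable_on UNIV"
proof -
  define S where "S = (\<Sum>\<^sub>\<infinity>x. (f x)\<^sup>2)"
  have fsq: "(f x)\<^sup>2 \<le> S" for x
    using infsum_mono2[of "\<lambda>x. (f x)\<^sup>2" "{x}" UNIV] f by (simp add: S_def)
  have S: "S \<ge> 0" unfolding S_def by (simp add: infsum_nonneg)
  have fb: "\<bar>f x\<bar> \<le> sqrt S" for x using fsq[of x] real_le_rsqrt by fastforce
  define W where "W = (\<Sum>n. \<bar>w n\<bar> * L ^ n) + 1"
  have W: "W > 0" unfolding W_def using L_nonneg suminf_nonneg[OF w] by (simp add: add_nonneg_pos)
  have CS: "(series w f x)\<^sup>2 \<le> series w (\<lambda>x. (f x)\<^sup>2) x * W" for x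
  proof -
    define \<theta> where "\<theta> = series w f x / W"
    have b1: "\<bar>(f y)\<^sup>2\<bar> \<le> S" for y using fsq by simp
    have b2: "\<bar>(-2 * \<theta>) * f y\<bar> \<le> \<bar>-2 * \<theta>\<bar> * sqrt S" for y
      unfolding abs_mult using fb by (intro mult_left_mono) auto
    have b3: "\<bar>\<theta>\<^sup>2 * 1\<bar> \<le> \<theta>\<^sup>2" for y :: 's by simp
    have b12: "\<bar>(f y)\<^sup>2 + (-2 * \<theta>) * f y\<bar> \<le> S + \<bar>-2 * \<theta>\<bar> * sqrt S" for y
      using b1[of y] b2[of y] by linarith
    have "0 \<le> series w (\<lambda>y. ((f y)\<^sup>2 + (-2 * \<theta>) * f y) + \<theta>\<^sup>2 * 1) x"
    proof (rule series_nonneg[OF w, where C = "S + \<bar>-2 * \<theta>\<bar> * sqrt S + \<theta>\<^sup>2"])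
      show "\<bar>((f y)\<^sup>2 + (-2 * \<theta>) * f y) + \<theta>\<^sup>2 * 1\<bar> \<le> S + \<bar>-2 * \<theta>\<bar> * sqrt S + \<theta>\<^sup>2" for y
        using b12[of y] b3 by linarith
      have "((f y)\<^sup>2 + (-2 * \<theta>) * f y) + \<theta>\<^sup>2 * 1 = (f y - \<theta>)\<^sup>2" for y
        by (simp add: power2_eq_square algebra_simps)
      then show "((f y)\<^sup>2 + (-2 * \<theta>) * f y) + \<theta>\<^sup>2 * 1 \<ge> 0" for y by simp
    qed (rule w0)
    also have "\<dots> = series w (\<lambda>y. (f y)\<^sup>2) x + (-2 * \<theta>) * series w f x + \<theta>\<^sup>2 * series w (\<lambda>_. 1) x"
      by (simp only: series_add[OF w, OF b12 b3] series_add[OF w, OF b1 b2] series_cmult[OF w, OF fb])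
        (simp only: series_cmult[OF w, of "\<lambda>_. 1" 1 "\<theta>\<^sup>2" x] abs_one order_refl)
    also have "series w (\<lambda>_. 1) x \<le> W"
      using series_bound[OF w, of "\<lambda>_. 1" 1 x] by (simp add: W_def)
    finally have "0 \<le> series w (\<lambda>y. (f y)\<^sup>2) x + (-2 * \<theta>) * series w f x + \<theta>\<^sup>2 * W"
      by (simp add: mult_left_mono)
    then show ?thesis using W by (simp add: \<theta>_def power2_eq_square field_simps)
  qed
  have "(\<lambda>x. \<bar>series w (\<lambda>x. (f x)\<^sup>2) x\<bar>) summable_on UNIV"
    by (rule series_l1(1)[OF w, where g = "\<lambda>_. 0" and C = 0]) (use f in auto)
  from summable_on_cmult_left[OF this, of W] show ?thesis
  proof (rule abs_summable_real(2))
    show "\<bar>(series w f x)\<^sup>2\<bar> \<le> \<bar>series w (\<lambda>x. (f x)\<^sup>2) x\<bar> * W" for x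
      using order_trans[OF CS mult_right_mono[OF abs_ge_self]] W by simp
  qed
qed

text \<open>Applying the operator \<open>n\<close> times bounds an eigenfunction by \<open>C (L / m) ^ n\<close>.\<close>

lemma eigenvector_zero:
  assumes "\<And>x. \<bar>f x\<bar> \<le> C" "act f = (\<lambda>x. m * f x)" "m > L"
  shows "f x = 0"
proof -
  have m: "m > 0" using assms(3) L_nonneg by simp
  have b: "\<bar>f x\<bar> \<le> C * (L / m) ^ n" for n
  proof -
    have "m ^ n * \<bar>f x\<bar> \<le> L ^ n * C"
      using pow_bound[of f C n x, OF assms(1)] m by (simp add: pow_eigen[OF assms(2)] abs_mult)
    then show ?thesis using m by (simp add: power_divide field_simps)
  qed
  have "(\<lambda>n. C * (L / m) ^ n) \<longlonglongrightarrow> C * 0"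
    by (intro tendsto_mult tendsto_const LIMSEQ_realpow_zero) (use m L_nonneg assms(3) in auto)
  then have "\<bar>f x\<bar> \<le> C * 0"
    by (rule tendsto_lowerbound) (use b in auto)
  then show ?thesis by simp
qed

end

lemma l2_bounded: "\<phi> \<in> l2 \<Longrightarrow> \<bar>\<phi> x\<bar> \<le> sqrt (\<Sum>\<^sub>\<infinity>x. (\<phi> x)\<^sup>2)"
  using infsum_mono2[of "\<lambda>x. (\<phi> x)\<^sup>2" "{x}" UNIV] by (intro real_le_rsqrt) (auto simp: l2_def)

lemma l2_add: "\<phi> \<in> l2 \<Longrightarrow> \<psi> \<in> l2 \<Longrightarrow> (\<lambda>x. \<phi> x + \<psi> x) \<in> l2"
proof -
  assume "\<phi> \<in> l2" "\<psi> \<in> l2"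
  then have "(\<lambda>x. 2 * (\<phi> x)\<^sup>2 + 2 * (\<psi> x)\<^sup>2) summable_on UNIV"
    unfolding l2_def by (intro summable_on_add summable_on_cmult_right) auto
  moreover have "\<bar>(\<phi> x + \<psi> x)\<^sup>2\<bar> \<le> 2 * (\<phi> x)\<^sup>2 + 2 * (\<psi> x)\<^sup>2" for x
    using zero_le_power2[of "\<phi> x - \<psi> x"] unfolding abs_of_nonneg[OF zero_le_power2]
    by (simp add: power2_eq_square algebra_simps)
  ultimately show ?thesis unfolding l2_def by (auto intro: abs_summable_real(2))
qed

lemma l2_cmult: "\<phi> \<in> l2 \<Longrightarrow> (\<lambda>x. c * \<phi> x) \<in> l2"
  unfolding l2_def by (simp add: power_mult_distrib summable_on_cmult_right)

lemma l2_indicator: "indicat_real {x} \<in> l2"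
  unfolding l2_def mem_Collect_eq
  by (rule abs_summable_real(2)[OF indicator_l1[of x]]) (simp add: indicator_def)

section \<open>The random walk and its Green's function\<close>

lemma smallo_rate:
  assumes "(\<lambda>h. f h - (d + q * h)) \<in> o[at_right 0](\<lambda>h. h)"
  shows "((\<lambda>h. (f h - d) / h) \<longlongrightarrow> q) (at_right (0::real))" and "(f \<longlongrightarrow> d) (at_right 0)"
proof -
  have ev: "\<forall>\<^sub>F h in at_right (0::real). h > 0" by (rule eventually_at_right_less)
  have "((\<lambda>h. (f h - (d + q * h)) / h) \<longlongrightarrow> 0) (at_right 0)" by (rule smalloD_tendsto[OF assms])
  then have "((\<lambda>h. (f h - (d + q * h)) / h + q) \<longlongrightarrow> 0 + q) (at_right 0)" by (intro tendsto_intros)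
  then show 1: "((\<lambda>h. (f h - d) / h) \<longlongrightarrow> q) (at_right (0::real))"
    by (rule Lim_transform_eventually[OF _ eventually_mono[OF ev], THEN tendsto_eq_rhs])
      (auto simp: field_simps)
  have "((\<lambda>h. (f h - d) / h * h + d) \<longlongrightarrow> q * 0 + d) (at_right 0)" by (intro tendsto_intros 1)
  then show "(f \<longlongrightarrow> d) (at_right 0)"
    by (rule Lim_transform_eventually[OF _ eventually_mono[OF ev], THEN tendsto_eq_rhs]) auto
qed

lemma nn_integral_power_exp:
  assumes "k > 0"
  shows "(\<integral>\<^sup>+t\<in>{0..}. ennreal (exp (- k * t) * (t ^ n / fact n)) \<partial>lborel) = ennreal (1 / k ^ Suc n)"
proof -
  have "(\<integral>\<^sup>+t\<in>{0..}. ennreal (exp (- k * t) * (t ^ n / fact n)) \<partial>lborel)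
      = (\<integral>\<^sup>+t. ennreal (1 / k ^ Suc n) * ennreal (erlang_density n k t) \<partial>lborel)"
    using assms
    by (intro nn_integral_cong)
      (auto simp: erlang_density_def indicator_def ennreal_mult[symmetric] divide_simps simp del: power_Suc)
  also have "\<dots> = ennreal (1 / k ^ Suc n) * (\<integral>\<^sup>+t. ennreal (erlang_density n k t) \<partial>lborel)"
    by (rule nn_integral_cmult) simp
  also have "(\<integral>\<^sup>+t. ennreal (erlang_density n k t) \<partial>lborel) = 1"
    using prob_space.emeasure_space_1[OF prob_space_erlang_density[OF assms, of n]]
    by (simp add: emeasure_density)
  finally show ?thesis by simp
qed

context random_walk
begin

text \<open>The generator is split as \<open>jump - c\<close> into a non-negative kernel with row sums \<open>c\<close> and a
  multiple of the identity, so that the theory of bounded kernels applies to its semigroup and its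
  resolvent.\<close>

definition c :: real where "c = - a 0 0"

definition jump :: "int ^ 'd \<Rightarrow> int ^ 'd \<Rightarrow> real" where
  "jump x y = (if x = y then 0 else a x y)"

lemma a_diag: "a x x = - c"
  using homogeneous[of x x] by (simp add: c_def)

lemma c_pos: "c > 0"
  using diagonal[of 0] by (simp add: c_def)

lemma jump_has_sum: "(jump x has_sum c) UNIV"
proof -
  have "((\<lambda>y. if y = x then c else 0) has_sum c) UNIV"
    by (rule has_sum_finite_neutralI[of "{x}"]) auto
  from has_sum_add[OF regular this] have "((\<lambda>y. a x y + (if y = x then c else 0)) has_sum c) UNIV" by simp
  moreover have "(\<lambda>y. a x y + (if y = x then c else 0)) = jump x" by (auto simp: jump_def a_diag)
  ultimately show ?thesis by simp
qed

sublocale J: bounded_kernel jump c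
proof
  show "jump x y \<ge> 0" "jump x y = jump y x" for x y
    using off_diagonal[of x y] symmetric[of x y] by (auto simp: jump_def)
  show "jump x summable_on UNIV" "infsum (jump x) UNIV \<le> c" for x
    using jump_has_sum[of x] by (auto simp: summable_on_def dest: infsumI)
qed

lemma generator_eq:
  assumes "\<And>z. \<bar>f z\<bar> \<le> C"
  shows "(\<Sum>\<^sub>\<infinity>z. a x z * f z) = J.act f x - c * f x"
proof -
  have "(\<Sum>\<^sub>\<infinity>z. a x z * f z) = (\<Sum>\<^sub>\<infinity>z. jump x z * f z + (- c) * (indicator {x} z * f z))"
    by (rule infsum_cong) (auto simp: jump_def a_diag indicator_def)
  also have "\<dots> = (\<Sum>\<^sub>\<infinity>z. jump x z * f z) + (\<Sum>\<^sub>\<infinity>z. (- c) * (indicator {x} z * f z))"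
  proof (rule infsum_add[OF J.act_summable[OF assms]])
    have "(\<lambda>z. indicat_real {x} z * f z) summable_on UNIV"
      by (rule abs_summable_real(2)[OF summable_on_cmult_left[OF indicator_l1, where c = C]])
        (use assms in \<open>auto simp: abs_mult intro!: mult_left_mono\<close>)
    then show "(\<lambda>z. (- c) * (indicat_real {x} z * f z)) summable_on UNIV" by (rule summable_on_cmult_right)
  qed
  also have "(\<Sum>\<^sub>\<infinity>z. (- c) * (indicator {x} z * f z)) = - c * f x"
    by (subst infsum_single[of x]) (auto simp: indicator_def)
  finally show ?thesis by (simp add: J.act_def)
qed

lemma walk_generator_eq:
  assumes "\<And>z. \<bar>f z\<bar> \<le> C"
  shows "walk_generator a f x = J.act f x - c * f x"
proof -
  have "a 0 (x - z) = a x z" for z using homogeneous[of z x] symmetric[of z x] by simp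
  then show ?thesis using generator_eq[of f C x, OF assms] by (simp add: walk_generator_def)
qed

sublocale P: markov_semigroup p
  by unfold_locales (auto simp: p_start p_Markov)

lemma p_rate:
  "((\<lambda>h. (pmf (p h x) y - (if y = x then 1 else 0)) / h) \<longlongrightarrow> a x y) (at_right 0)"
  "((\<lambda>h. pmf (p h x) x) \<longlongrightarrow> 1) (at_right 0)"
  using smallo_rate(1)[of "\<lambda>h. pmf (p h x) y" 0 "a x y"] p_jump[of x y]
    smallo_rate[of "\<lambda>h. pmf (p h x) x" 1 "a x x"] p_stay[of x]
  by auto

text \<open>The transition probabilities are only known to have the right derivative at time \<open>0\<close>; by the backward
  equation and uniqueness they are those of the semigroup of the generator.\<close>

lemma p_heat:
  assumes t: "t \<ge> 0"
  shows "pmf (p t x) y = exp (- c * t) * J.heat t (indicator {y}) x"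
proof -
  define u where "u t x = P.ev (indicat_real {y}) t x" for t x
  have u: "u t x = pmf (p t x) y" for t x by (simp add: u_def P.ev_def pmf.rep_eq)
  have ub: "\<bar>u t x\<bar> \<le> 1" for t x by (simp add: u pmf_le_1)
  have der: "((\<lambda>t. u t x) has_real_derivative J.act (u s) x - c * u s x) (at s within {0..})" if "s \<ge> 0" for s x
  proof -
    have "((\<lambda>t. P.ev (indicat_real {y}) t (id x)) has_real_derivative
       (\<Sum>\<^sub>\<infinity>z\<in>UNIV. a x z * P.ev (indicat_real {y}) s (id z))) (at s within {0..})"
      by (rule P.backward_equation[where C = 1]) (use regular p_rate that in \<open>auto simp: indicator_def\<close>)
    then show ?thesis using generator_eq[of "u s" 1 x, OF ub] by (simp add: u_def)
  qed
  have "(\<lambda>s x. exp (c * s) * u s x) t x = J.heat t ((\<lambda>s x. exp (c * s) * u s x) 0) x"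
  proof (rule J.heat_unique[OF t, where C = "exp (c * t)"])
    fix s x assume s: "s \<in> {0..t}"
    have "((\<lambda>s. exp (c * s) * u s x) has_real_derivative
        exp (c * s) * c * u s x + (J.act (u s) x - c * u s x) * exp (c * s)) (at s within {0..t})"
      by (intro DERIV_mult DERIV_subset[OF der]) (use s in \<open>auto intro!: derivative_eq_intros\<close>)
    then show "((\<lambda>s. exp (c * s) * u s x) has_real_derivative J.act (\<lambda>x. exp (c * s) * u s x) x) (at s within {0..t})"
      unfolding J.act_cmult by (rule DERIV_cong) (simp add: algebra_simps)
    have "exp (c * s) * \<bar>u s x\<bar> \<le> exp (c * t) * 1"
      using s c_pos ub by (intro mult_mono) auto
    then show "\<bar>exp (c * s) * u s x\<bar> \<le> exp (c * t)" by (simp add: abs_mult)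
  qed
  moreover have "(\<lambda>x. exp (c * 0) * u 0 x) = indicator {y}" by (auto simp: u_def P.ev_0)
  ultimately have "exp (c * t) * pmf (p t x) y = J.heat t (indicator {y}) x" by (simp add: u)
  then show ?thesis by (simp add: exp_minus field_simps)
qed

subsection \<open>The resolvent\<close>

definition res_weight :: "real \<Rightarrow> nat \<Rightarrow> real" where "res_weight l n = 1 / (l + c) ^ Suc n"

definition res :: "real \<Rightarrow> (int ^ 'd \<Rightarrow> real) \<Rightarrow> int ^ 'd \<Rightarrow> real" where
  "res l = J.series (res_weight l)"

lemma res_weights:
  assumes "l > 0"
  shows "summable (\<lambda>n. \<bar>res_weight l n\<bar> * c ^ n)" "(\<Sum>n. \<bar>res_weight l n\<bar> * c ^ n) = 1 / l"
proof -
  have "(\<lambda>n. (1 / (l + c)) * (c / (l + c)) ^ n) sums ((1 / (l + c)) * (1 / (1 - c / (l + c))))"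
    using assms c_pos by (intro sums_mult geometric_sums) (auto simp: field_simps)
  moreover have "(1 / (l + c)) * (1 / (1 - c / (l + c))) = 1 / l"
    using assms c_pos by (simp add: field_simps)
  moreover have "(1 / (l + c)) * (c / (l + c)) ^ n = \<bar>res_weight l n\<bar> * c ^ n" for n
    using assms c_pos by (simp add: res_weight_def power_divide abs_divide power_abs)
  ultimately have "(\<lambda>n. \<bar>res_weight l n\<bar> * c ^ n) sums (1 / l)" by simp
  then show "summable (\<lambda>n. \<bar>res_weight l n\<bar> * c ^ n)" "(\<Sum>n. \<bar>res_weight l n\<bar> * c ^ n) = 1 / l"
    by (auto simp: sums_iff)
qed

lemma res_weight_nonneg: "l > 0 \<Longrightarrow> res_weight l n \<ge> 0"
  using c_pos by (simp add: res_weight_def)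

lemma res_bound:
  assumes "l > 0" "\<And>x. \<bar>f x\<bar> \<le> C"
  shows "\<bar>res l f x\<bar> \<le> 1 / l * C"
  unfolding res_def res_weights(2)[OF assms(1), symmetric]
  by (rule J.series_bound[OF res_weights(1)[OF assms(1)] assms(2)])

lemma act_res:
  assumes l: "l > 0" and f: "\<And>x. \<bar>f x\<bar> \<le> C"
  shows "J.act (res l f) x = (l + c) * res l f x - f x"
proof -
  have lc: "l + c > 0" using l c_pos by simp
  note s = J.series_summable[OF res_weights(1)[OF l], of f C, OF f]
  have "(l + c) * res l f x = (\<Sum>n. (l + c) * (res_weight l n * (J.act ^^ n) f x))"
    unfolding res_def J.series_def by (rule suminf_mult[OF s, symmetric])
  also have "\<dots> = (\<Sum>n. (l + c) * (res_weight l (Suc n) * (J.act ^^ Suc n) f x)) + (l + c) * (res_weight l 0 * f x)"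
    using suminf_split_head[OF summable_mult[OF s, of "l + c"]] by simp
  also have "(\<Sum>n. (l + c) * (res_weight l (Suc n) * (J.act ^^ Suc n) f x)) = J.act (res l f) x"
    unfolding res_def J.act_series(1)[OF res_weights(1)[OF l] f]
    using lc by (intro suminf_cong) (simp add: res_weight_def)
  also have "(l + c) * (res_weight l 0 * f x) = f x" using lc by (simp add: res_weight_def)
  finally show ?thesis by simp
qed

text \<open>The difference of two bounded solutions is an eigenfunction of \<open>jump\<close> beyond its norm \<open>c\<close>.\<close>

lemma res_unique:
  assumes l: "l > 0" and f: "\<And>x. \<bar>f x\<bar> \<le> C" and g: "\<And>x. \<bar>g x\<bar> \<le> D"
    and eq: "\<And>x. J.act f x = (l + c) * f x - g x"
  shows "f x = res l g x"
proof -
  let ?d = "\<lambda>x. f x + (-1) * res l g x"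
  have b: "\<bar>(-1) * res l g x\<bar> \<le> 1 / l * D" for x using res_bound[of l g D x, OF l g] by simp
  have "?d x = 0"
  proof (rule J.eigenvector_zero[where m = "l + c" and C = "C + 1 / l * D"])
    show "\<bar>?d x\<bar> \<le> C + 1 / l * D" for x using f[of x] b[of x] by linarith
    show "J.act ?d = (\<lambda>x. (l + c) * ?d x)"
    proof
      fix x
      have "J.act ?d x = J.act f x + (-1) * J.act (res l g) x"
        by (simp only: J.act_add[OF f b] J.act_cmult)
      then show "J.act ?d x = (l + c) * ?d x"
        by (simp add: eq act_res[OF l g] algebra_simps)
    qed
  qed (use l in simp)
  then show ?thesis by simp
qed

lemma res_cmult: "l > 0 \<Longrightarrow> (\<And>x. \<bar>f x\<bar> \<le> C) \<Longrightarrow> res l (\<lambda>y. k * f y) x = k * res l f x"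
  unfolding res_def by (rule J.series_cmult[OF res_weights(1)])

text \<open>Integrating the power series of the semigroup term by term turns \<open>t ^ n / n!\<close> into
  \<open>1 / (l + c) ^ (n + 1)\<close>. For \<open>l = 0\<close> both sides may be infinite.\<close>

lemma green_series:
  assumes l: "l \<ge> 0"
  shows "green p l x y = (\<Sum>n. ennreal ((J.act ^^ n) (indicator {y}) x / (l + c) ^ Suc n))"
proof -
  define A where "A n = (J.act ^^ n) (indicator {y}) x" for n
  have A: "A n \<ge> 0" for n unfolding A_def by (rule J.pow_nonneg) simp
  have lc: "l + c > 0" using l c_pos by simp
  have *: "ennreal (exp (- l * t) * pmf (p t x) y) * indicator {0..} t
      = (\<Sum>n. ennreal (A n) * (ennreal (exp (- (l + c) * t) * (t ^ n / fact n)) * indicator {0..} t))" for t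
  proof (cases "t \<ge> 0")
    case True
    have s: "summable (\<lambda>n. t ^ n / fact n * A n)"
      unfolding A_def by (rule J.series_summable[OF J.heat_weights, of _ 1]) (rule indicator_le_1)
    have "ennreal (exp (- l * t) * pmf (p t x) y) = ennreal (\<Sum>n. exp (- (l + c) * t) * (t ^ n / fact n * A n))"
    proof (rule arg_cong[where f = ennreal])
      have "exp (- l * t) * pmf (p t x) y = exp (- (l + c) * t) * (\<Sum>n. t ^ n / fact n * A n)"
        unfolding p_heat[OF True] J.heat_def J.series_def A_def
        by (simp add: exp_add[symmetric] algebra_simps)
      also have "\<dots> = (\<Sum>n. exp (- (l + c) * t) * (t ^ n / fact n * A n))" by (rule suminf_mult[OF s, symmetric])
      finally show "exp (- l * t) * pmf (p t x) y = (\<Sum>n. exp (- (l + c) * t) * (t ^ n / fact n * A n))" .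
    qed
    also have "\<dots> = (\<Sum>n. ennreal (exp (- (l + c) * t) * (t ^ n / fact n * A n)))"
      by (rule suminf_ennreal2[OF _ summable_mult[OF s], symmetric]) (use A True in auto)
    finally show ?thesis using True A by (simp add: ennreal_mult[symmetric] ac_simps)
  qed simp
  have "green p l x y = (\<integral>\<^sup>+t. (\<Sum>n. ennreal (A n) * (ennreal (exp (- (l + c) * t) * (t ^ n / fact n)) * indicator {0..} t)) \<partial>lborel)"
    unfolding green_def * ..
  also have "\<dots> = (\<Sum>n. \<integral>\<^sup>+t. ennreal (A n) * (ennreal (exp (- (l + c) * t) * (t ^ n / fact n)) * indicator {0..} t) \<partial>lborel)"
    by (rule nn_integral_suminf) measurable
  also have "\<dots> = (\<Sum>n. ennreal (A n) * ennreal (1 / (l + c) ^ Suc n))"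
    by (subst nn_integral_cmult) (measurable, simp only: nn_integral_power_exp[OF lc])
  also have "\<dots> = (\<Sum>n. ennreal (A n / (l + c) ^ Suc n))"
    using A lc by (simp add: ennreal_mult[symmetric])
  finally show ?thesis by (simp add: A_def)
qed

lemma green_real_eq_res:
  assumes l: "l > 0"
  shows "green_real p l x y = res l (indicator {y}) x"
proof -
  have s: "summable (\<lambda>n. res_weight l n * (J.act ^^ n) (indicator {y}) x)"
    by (rule J.series_summable[OF res_weights(1)[OF l], of _ 1]) (rule indicator_le_1)
  have "green p l x y = (\<Sum>n. ennreal (res_weight l n * (J.act ^^ n) (indicator {y}) x))"
    using l by (simp add: green_series res_weight_def)
  also have "\<dots> = ennreal (res l (indicator {y}) x)"
    unfolding res_def J.series_def
    by (rule suminf_ennreal2) (use s J.pow_nonneg res_weight_nonneg[OF l] in auto)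
  finally have "green p l x y = ennreal (res l (indicator {y}) x)" .
  moreover have "res l (indicator {y}) x \<ge> 0"
    unfolding res_def by (rule J.series_nonneg[OF res_weights(1)[OF l] indicator_le_1])
      (use res_weight_nonneg[OF l] in auto)
  ultimately show ?thesis by (simp add: green_real_def)
qed

text \<open>The walk moves along the positive entries of \<open>jump\<close>, so irreducibility provides a path.\<close>

lemma pow_positive: "\<exists>n. (J.act ^^ n) (indicator {y}) x > 0"
proof -
  have "(x, y) \<in> {(u, v). a u v > 0}\<^sup>*" by (rule irreducible)
  then show ?thesis
  proof (induction rule: converse_rtrancl_induct)
    case base
    show ?case by (rule exI[of _ 0]) simp
  next
    case (step x z)
    then obtain n where n: "(J.act ^^ n) (indicator {y}) z > 0" by blast
    have az: "a x z > 0" using step by simp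
    then have "x \<noteq> z" using diagonal[of x] by auto
    then have "0 < jump x z * (J.act ^^ n) (indicator {y}) z" using az n by (simp add: jump_def)
    also have "\<dots> \<le> J.act ((J.act ^^ n) (indicator {y})) x"
    proof -
      have "(\<lambda>z. jump x z * (J.act ^^ n) (indicator {y}) z) summable_on UNIV"
        by (rule J.act_summable[OF J.pow_bound[OF indicator_le_1]])
      then have "infsum (\<lambda>z. jump x z * (J.act ^^ n) (indicator {y}) z) {z}
          \<le> infsum (\<lambda>z. jump x z * (J.act ^^ n) (indicator {y}) z) UNIV"
        by (intro infsum_mono2) (auto intro!: mult_nonneg_nonneg J.B_nonneg J.pow_nonneg)
      then show ?thesis by (simp add: J.act_def)
    qed
    finally show ?case by (intro exI[of _ "Suc n"]) simp
  qed
qed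

lemma res_positive:
  assumes l: "l > 0"
  shows "res l (indicator {y}) x > 0"
proof -
  obtain n where n: "(J.act ^^ n) (indicator {y}) x > 0" using pow_positive by blast
  have s: "summable (\<lambda>n. res_weight l n * (J.act ^^ n) (indicator {y}) x)"
    by (rule J.series_summable[OF res_weights(1)[OF l], of _ 1]) (rule indicator_le_1)
  have "0 < res_weight l n * (J.act ^^ n) (indicator {y}) x"
    using n l c_pos by (simp add: res_weight_def)
  then show ?thesis unfolding res_def J.series_def
    by (rule suminf_pos2[OF s, rotated]) (auto intro!: mult_nonneg_nonneg J.pow_nonneg res_weight_nonneg[OF l])
qed

lemma res_symmetric: "l > 0 \<Longrightarrow> res l (indicator {x}) y = res l (indicator {y}) x"
  unfolding res_def by (rule J.series_symmetric[OF res_weights(1)])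

lemma res_l1: "l > 0 \<Longrightarrow> res l (indicator {y}) summable_on UNIV"
  by (rule abs_summable_summable)
    (use J.series_l1(1)[OF res_weights(1) indicator_l1 indicator_le_1] in \<open>simp add: res_def\<close>)

lemma res_l2: "l > 0 \<Longrightarrow> \<phi> \<in> l2 \<Longrightarrow> res l \<phi> \<in> l2"
  unfolding res_def l2_def mem_Collect_eq
  by (rule J.series_l2[OF res_weights(1) res_weight_nonneg])

end

section \<open>The leading eigenvalue\<close>

context random_walk
begin

lemma perturbed_generator_eq:
  assumes "\<phi> \<in> l2"
  shows "perturbed_generator a b \<phi> x
    = J.act \<phi> x - c * \<phi> x + beta_star b * \<phi> 0 * indicator {0} x"
  using walk_generator_eq[of \<phi> _ x, OF l2_bounded[OF assms]]
  by (simp add: perturbed_generator_def Delta0_def indicator_def)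

lemma perturbed_generator_l2:
  assumes "\<phi> \<in> l2"
  shows "perturbed_generator a b \<phi> \<in> l2"
proof -
  have "J.act \<phi> = J.series (\<lambda>n. if n = 1 then 1 else 0) \<phi>" by (rule ext) (rule J.act_eq_series)
  then have "J.act \<phi> \<in> l2"
    using J.series_l2[OF J.act_weights, of \<phi>] assms by (auto simp: l2_def)
  from l2_add[OF l2_add[OF this l2_cmult[OF assms, of "- c"]] l2_cmult[OF l2_indicator[of 0], of "beta_star b * \<phi> 0"]]
  show ?thesis unfolding perturbed_generator_eq[OF assms, abs_def] by simp
qed

abbreviation g0 :: "real \<Rightarrow> real" where "g0 l \<equiv> res l (indicator {0}) 0"

text \<open>The perturbation sees \<open>\<phi>\<close> only through \<open>\<phi> 0\<close>, so an eigenfunction is a multiple of the resolvent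
  at \<open>\<delta>\<^sub>0\<close>; evaluation at \<open>0\<close> then gives the equation for the eigenvalue.\<close>

lemma eigen_eq:
  assumes l: "l > 0" and \<phi>: "\<phi> \<in> l2" and eq: "perturbed_generator a b \<phi> = (\<lambda>x. l * \<phi> x)"
  shows "\<phi> x = beta_star b * \<phi> 0 * res l (indicator {0}) x"
proof -
  have "\<phi> x = res l (\<lambda>x. beta_star b * \<phi> 0 * indicator {0} x) x"
  proof (rule res_unique[OF l l2_bounded[OF \<phi>]])
    show "\<bar>beta_star b * \<phi> 0 * indicator {0} x\<bar> \<le> \<bar>beta_star b * \<phi> 0\<bar>" for x :: "int ^ 'd"
      by (simp add: indicator_def)
    show "J.act \<phi> x = (l + c) * \<phi> x - beta_star b * \<phi> 0 * indicator {0} x" for x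
      using perturbed_generator_eq[OF \<phi>, of b x] fun_cong[OF eq, of x] by (simp add: algebra_simps)
  qed
  then show ?thesis using res_cmult[OF l, of "indicator {0}" 1] by (simp add: indicator_le_1)
qed

lemma eigenvalue_iff:
  assumes l: "l > 0"
  shows "l2_eigenvalue (perturbed_generator a b) l \<longleftrightarrow> beta_star b * g0 l = 1"
proof
  assume "l2_eigenvalue (perturbed_generator a b) l"
  then obtain \<phi> where \<phi>: "\<phi> \<in> l2" "\<phi> \<noteq> (\<lambda>_. 0)" "perturbed_generator a b \<phi> = (\<lambda>x. l * \<phi> x)"
    by (auto simp: l2_eigenvalue_def)
  note e = eigen_eq[OF l \<phi>(1,3)]
  have "\<phi> 0 \<noteq> 0"
  proof
    assume "\<phi> 0 = 0"
    then have "\<phi> x = 0" for x using e[of x] by simp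
    then show False using \<phi>(2) by auto
  qed
  then show "beta_star b * g0 l = 1" using e[of 0] by simp
next
  assume eq: "beta_star b * g0 l = 1"
  let ?\<psi> = "res l (indicator {0})"
  have \<psi>: "?\<psi> \<in> l2" by (rule res_l2[OF l l2_indicator])
  have "perturbed_generator a b ?\<psi> = (\<lambda>x. l * ?\<psi> x)"
    using perturbed_generator_eq[OF \<psi>, of b] act_res[OF l, of "indicator {0}" 1] eq
    by (auto simp: indicator_le_1 algebra_simps)
  moreover have "?\<psi> \<noteq> (\<lambda>_. 0)"
    using eq by (auto dest: fun_cong[of _ _ 0])
  ultimately show "l2_eigenvalue (perturbed_generator a b) l"
    using \<psi> unfolding l2_eigenvalue_def by blast
qed

text \<open>Off its positive eigenvalue, the rank-one perturbation is inverted through the resolvent of the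
  walk: \<open>\<phi> = res \<psi> + \<kappa> res \<delta>\<^sub>0\<close> with \<open>\<kappa> = \<beta> \<phi> 0\<close> solved from the value at \<open>0\<close>.\<close>

lemma resolvent_bijective:
  assumes l: "l > 0" and ne: "beta_star b * g0 l \<noteq> 1"
  shows "bij_betw (\<lambda>\<phi> x. l * \<phi> x - perturbed_generator a b \<phi> x) l2 l2"
proof (rule bij_betw_imageI)
  let ?T = "perturbed_generator a b"
  let ?R = "\<lambda>\<phi> x. l * \<phi> x - ?T \<phi> x"
  show "inj_on ?R l2"
  proof (rule inj_onI)
    fix \<phi> \<psi> :: "int ^ 'd \<Rightarrow> real"
    assume \<phi>: "\<phi> \<in> l2" and \<psi>: "\<psi> \<in> l2" and eq: "?R \<phi> = ?R \<psi>"
    let ?d = "\<lambda>x. \<phi> x + (-1) * \<psi> x"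
    have d: "?d \<in> l2" by (rule l2_add[OF \<phi> l2_cmult[OF \<psi>]])
    have b: "\<bar>(-1) * \<psi> x\<bar> \<le> sqrt (\<Sum>\<^sub>\<infinity>x. (\<psi> x)\<^sup>2)" for x using l2_bounded[OF \<psi>, of x] by simp
    have "?T ?d = (\<lambda>x. l * ?d x)"
    proof
      fix x
      have "?T ?d x = ?T \<phi> x + (-1) * ?T \<psi> x"
        unfolding perturbed_generator_eq[OF d] perturbed_generator_eq[OF \<phi>] perturbed_generator_eq[OF \<psi>]
        by (simp only: J.act_add[OF l2_bounded[OF \<phi>] b] J.act_cmult) (simp add: algebra_simps)
      then show "?T ?d x = l * ?d x" using fun_cong[OF eq, of x] by (simp add: algebra_simps)
    qed
    then have e: "?d x = beta_star b * ?d 0 * res l (indicator {0}) x" for x by (rule eigen_eq[OF l d])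
    have "?d 0 * (1 - beta_star b * g0 l) = 0" using e[of 0] by (simp add: algebra_simps)
    then have "?d 0 = 0" using ne by simp
    then have "?d x = 0" for x using e[of x] by simp
    then show "\<phi> = \<psi>" by auto
  qed
  show "?R ` l2 = l2"
  proof safe
    fix \<phi> :: "int ^ 'd \<Rightarrow> real" assume "\<phi> \<in> l2"
    then show "?R \<phi> \<in> l2"
      using l2_add[OF l2_cmult[of \<phi> l] l2_cmult[OF perturbed_generator_l2[of \<phi> b], of "-1"]] by simp
  next
    fix \<psi> :: "int ^ 'd \<Rightarrow> real" assume \<psi>: "\<psi> \<in> l2"
    define \<kappa> where "\<kappa> = beta_star b * res l \<psi> 0 / (1 - beta_star b * g0 l)"
    define \<phi> where "\<phi> x = res l \<psi> x + \<kappa> * res l (indicator {0}) x" for x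
    have \<phi>: "\<phi> \<in> l2"
      unfolding \<phi>_def[abs_def] by (intro l2_add l2_cmult res_l2[OF l] \<psi> l2_indicator)
    have \<kappa>: "\<kappa> = beta_star b * \<phi> 0"
      using ne by (simp add: \<phi>_def \<kappa>_def field_simps)
    have b: "\<bar>\<kappa> * res l (indicator {0}) x\<bar> \<le> \<bar>\<kappa>\<bar> * (1 / l * 1)" for x
      unfolding abs_mult by (intro mult_left_mono res_bound[OF l indicator_le_1]) auto
    have "J.act \<phi> x = J.act (res l \<psi>) x + \<kappa> * J.act (res l (indicator {0})) x" for x
      unfolding \<phi>_def[abs_def]
      by (simp only: J.act_add[OF res_bound[OF l l2_bounded[OF \<psi>]] b] J.act_cmult)
    then have act: "J.act \<phi> x = (l + c) * \<phi> x - \<psi> x - \<kappa> * indicator {0} x" for x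
      by (simp add: act_res[OF l l2_bounded[OF \<psi>]] act_res[OF l indicator_le_1] \<phi>_def algebra_simps)
    have "?R \<phi> = \<psi>"
    proof
      fix x
      show "?R \<phi> x = \<psi> x"
        unfolding perturbed_generator_eq[OF \<phi>] act \<kappa>[symmetric] by (simp add: algebra_simps)
    qed
    then show "\<psi> \<in> ?R ` l2" using \<phi> by blast
  qed
qed

lemma g0_partial_sum:
  assumes "l > 0"
  shows "(\<Sum>n<N. (J.act ^^ n) (indicator {0}) 0 / (l + c) ^ Suc n) \<le> g0 l"
proof -
  have "(\<Sum>n<N. res_weight l n * (J.act ^^ n) (indicator {0}) 0) \<le> g0 l"
    unfolding res_def J.series_def
    by (rule sum_le_suminf[OF J.series_summable[OF res_weights(1)[OF assms] indicator_le_1]])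
      (auto intro!: mult_nonneg_nonneg J.pow_nonneg res_weight_nonneg[OF assms])
  then show ?thesis by (simp add: res_weight_def)
qed

lemma g0_strict_antimono:
  assumes "0 < l" "l < m"
  shows "g0 m < g0 l"
proof -
  have m: "m > 0" using assms by simp
  note sl = J.series_summable[OF res_weights(1)[OF assms(1)], of "indicator {0}" 1 0, OF indicator_le_1]
  note sm = J.series_summable[OF res_weights(1)[OF m], of "indicator {0}" 1 0, OF indicator_le_1]
  let ?d = "\<lambda>n. res_weight l n * (J.act ^^ n) (indicator {0}) 0 - res_weight m n * (J.act ^^ n) (indicator {0}) 0"
  have d: "?d n \<ge> 0" for n
  proof -
    have "res_weight m n \<le> res_weight l n"
      unfolding res_weight_def using assms c_pos by (intro divide_left_mono power_mono mult_pos_pos zero_less_power) auto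
    then show ?thesis using J.pow_nonneg[of "indicator {0}" n 0] by (simp add: mult_right_mono)
  qed
  have "0 < ?d 0" using assms c_pos by (simp add: res_weight_def frac_less2)
  then have "0 < suminf ?d"
    by (rule suminf_pos2[OF summable_diff[OF sl sm] d])
  also have "suminf ?d = g0 l - g0 m"
    unfolding res_def J.series_def by (rule suminf_diff[OF sl sm, symmetric])
  finally show ?thesis by simp
qed

lemma g0_continuous:
  assumes "l1 > 0"
  shows "continuous_on {l1..m} g0"
proof -
  have lim: "uniform_limit {l1..m} (\<lambda>n l. \<Sum>i<n. res_weight l i * (J.act ^^ i) (indicator {0}) 0) g0 sequentially"
    unfolding res_def J.series_def
  proof (rule Weierstrass_m_test[OF _ res_weights(1)[OF assms]])
    fix n l assume l: "l \<in> {l1..m}"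
    have "\<bar>res_weight l n\<bar> \<le> \<bar>res_weight l1 n\<bar>"
      unfolding res_weight_def abs_divide
      using assms c_pos l by (intro divide_left_mono mult_pos_pos) (auto intro!: power_mono simp del: power_Suc)
    then have "\<bar>res_weight l n\<bar> * \<bar>(J.act ^^ n) (indicator {0}) 0\<bar> \<le> \<bar>res_weight l1 n\<bar> * (c ^ n * 1)"
      by (intro mult_mono J.pow_bound[OF indicator_le_1]) auto
    then show "norm (res_weight l n * (J.act ^^ n) (indicator {0}) 0) \<le> \<bar>res_weight l1 n\<bar> * c ^ n"
      by (simp add: abs_mult)
  qed
  show ?thesis
  proof (rule uniform_limit_theorem[OF _ lim])
    have "l + c \<noteq> 0" if "l \<in> {l1..m}" for l using that assms c_pos by auto
    then show "\<forall>\<^sub>F n in sequentially. continuous_on {l1..m} (\<lambda>l. \<Sum>i<n. res_weight l i * (J.act ^^ i) (indicator {0}) 0)"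
      unfolding res_weight_def by (intro always_eventually allI continuous_intros) auto
  qed simp
qed

text \<open>If \<open>\<beta> > \<beta>\<^sub>c\<close>, then the Green series at \<open>l = 0\<close> has a partial sum above \<open>1 / \<beta>\<close>, whether it
  converges or not, and a finite sum depends continuously on \<open>l\<close>.\<close>

lemma supercritical_small:
  assumes b: "\<beta> > 0" "\<beta> > beta_crit p"
  shows "\<exists>l>0. \<beta> * g0 l > 1"
proof -
  define A where "A n = (J.act ^^ n) (indicator {0}) 0" for n
  have A: "A n \<ge> 0" for n unfolding A_def by (rule J.pow_nonneg) simp
  have "\<exists>N. \<beta> * (\<Sum>n<N. A n / c ^ Suc n) > 1"
  proof (rule ccontr)
    assume "\<not> ?thesis"
    then have le: "(\<Sum>n<N. A n / c ^ Suc n) \<le> 1 / \<beta>" for N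
      using b(1) by (simp add: not_less field_simps)
    have s: "summable (\<lambda>n. A n / c ^ Suc n)"
      by (rule summableI_nonneg_bounded[where x = "1 / \<beta>"]) (use A c_pos le in auto)
    define S where "S = (\<Sum>n. A n / c ^ Suc n)"
    have "green p 0 0 0 = (\<Sum>n. ennreal (A n / c ^ Suc n))" by (simp add: green_series A_def)
    also have "\<dots> = ennreal S"
      unfolding S_def by (rule suminf_ennreal2[OF _ s]) (use A c_pos in auto)
    finally have gr: "green p 0 0 0 = ennreal S" .
    have "0 < A 0 / c ^ Suc 0" using c_pos by (simp add: A_def)
    then have S: "S > 0" unfolding S_def
      by (rule suminf_pos2[OF s, rotated]) (use A c_pos in auto)
    have "S \<le> 1 / \<beta>" unfolding S_def by (rule suminf_le_const[OF s]) (rule le)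
    then have "1 / S \<ge> \<beta>" using S b(1) by (simp add: field_simps)
    moreover have "beta_crit p = 1 / S" using S gr by (simp add: beta_crit_def green_real_def)
    ultimately show False using b(2) by simp
  qed
  then obtain N where N: "\<beta> * (\<Sum>n<N. A n / c ^ Suc n) > 1" by blast
  have "((\<lambda>l. \<beta> * (\<Sum>n<N. A n / (l + c) ^ Suc n)) \<longlongrightarrow> \<beta> * (\<Sum>n<N. A n / (0 + c) ^ Suc n)) (at_right 0)"
    using c_pos by (intro tendsto_intros) auto
  then have "\<forall>\<^sub>F l in at_right 0. \<beta> * (\<Sum>n<N. A n / (l + c) ^ Suc n) > 1"
    using N by (intro order_tendstoD(1)) auto
  with eventually_at_right_less[of "0::real"]
  have "\<forall>\<^sub>F l in at_right (0::real). 0 < l \<and> \<beta> * (\<Sum>n<N. A n / (l + c) ^ Suc n) > 1"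
    by eventually_elim simp
  then obtain l where l: "l > 0" "\<beta> * (\<Sum>n<N. A n / (l + c) ^ Suc n) > 1"
    using eventually_happens'[OF trivial_limit_at_right_real] by blast
  have "\<beta> * (\<Sum>n<N. A n / (l + c) ^ Suc n) \<le> \<beta> * g0 l"
    unfolding A_def using b(1) by (intro mult_left_mono g0_partial_sum l(1)) simp
  then show ?thesis using l by (intro exI[of _ l]) simp
qed

text \<open>The continuous, strictly decreasing function \<open>l \<mapsto> \<beta> G\<^sub>l(0,0)\<close> exceeds \<open>1\<close> near \<open>0\<close> and is below \<open>1\<close> at
  \<open>2 \<beta>\<close>, because \<open>G\<^sub>l(0,0) \<le> 1 / l\<close>. Its only crossing of \<open>1\<close> is the only positive point of the spectrum,
  hence isolated.\<close>

lemma lambda0_characterization: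
  assumes b: "beta_star b > 0" "beta_star b > beta_crit p"
  shows "lambda0 a b > 0" "beta_star b * g0 (lambda0 a b) = 1"
proof -
  let ?\<beta> = "beta_star b" and ?T = "perturbed_generator a b"
  obtain l1 where l1: "l1 > 0" "?\<beta> * g0 l1 > 1" using supercritical_small[OF b] by blast
  define lm where "lm = max l1 (2 * ?\<beta>)"
  have lm: "lm > 0" "l1 \<le> lm" "lm \<ge> 2 * ?\<beta>" using l1 by (auto simp: lm_def)
  have "g0 lm \<le> 1 / lm" using res_bound[OF lm(1), of "indicator {0}" 1 0] by (simp add: indicator_le_1)
  then have "?\<beta> * g0 lm \<le> ?\<beta> / lm" using mult_left_mono[of "g0 lm" "1 / lm" ?\<beta>] b(1) by simp
  also have "\<dots> \<le> 1" using lm b(1) by (simp add: field_simps)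
  finally have "\<exists>l\<ge>l1. l \<le> lm \<and> ?\<beta> * g0 l = 1"
    using l1 lm by (intro IVT2') (auto intro!: continuous_intros g0_continuous)
  then obtain l where l: "l > 0" "?\<beta> * g0 l = 1" using l1(1) by (metis less_le_trans)
  have unique: "m = l" if "m > 0" "?\<beta> * g0 m = 1" for m
  proof (rule ccontr)
    assume "m \<noteq> l"
    then have "g0 m \<noteq> g0 l" using g0_strict_antimono[of m l] g0_strict_antimono[of l m] that(1) l(1) by linarith
    moreover have "g0 m = g0 l" using that(2) l(2) b(1) by (metis mult_left_cancel less_irrefl)
    ultimately show False by simp
  qed
  have eig: "l2_eigenvalue ?T l" using eigenvalue_iff[OF l(1)] l(2) by simp
  have spl: "l \<in> l2_spectrum ?T"
  proof -
    obtain \<phi> where \<phi>: "\<phi> \<in> l2" "\<phi> \<noteq> (\<lambda>_. 0)" "?T \<phi> = (\<lambda>x. l * \<phi> x)" using eig by (auto simp: l2_eigenvalue_def)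
    have z: "(\<lambda>_. 0) \<in> l2" by (simp add: l2_def)
    have "?T (\<lambda>_. 0) = (\<lambda>_. 0)"
      by (rule ext) (simp add: perturbed_generator_def walk_generator_def Delta0_def)
    then have eq: "(\<lambda>x. l * \<phi> x - ?T \<phi> x) = (\<lambda>x. l * (\<lambda>_. 0) x - ?T (\<lambda>_. 0) x)" using \<phi>(3) by simp
    have "\<not> inj_on (\<lambda>\<phi> x. l * \<phi> x - ?T \<phi> x) l2"
    proof
      assume "inj_on (\<lambda>\<phi> x. l * \<phi> x - ?T \<phi> x) l2"
      then have "\<forall>\<phi>\<in>l2. \<forall>\<psi>\<in>l2. (\<lambda>x. l * \<phi> x - ?T \<phi> x) = (\<lambda>x. l * \<psi> x - ?T \<psi> x) \<longrightarrow> \<phi> = \<psi>"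
        unfolding inj_on_def .
      from mp[OF bspec[OF bspec[OF this \<phi>(1)] z] eq] have "\<phi> = (\<lambda>_. 0)" .
      with \<phi>(2) show False by contradiction
    qed
    then show ?thesis by (simp add: l2_spectrum_def bij_betw_def)
  qed
  have sp: "m = l" if "m \<in> l2_spectrum ?T" "m > 0" for m
    using that resolvent_bijective[of m b] unique[of m] by (auto simp: l2_spectrum_def)
  have "{0<..} \<inter> l2_spectrum ?T = {l}"
  proof
    show "{0<..} \<inter> l2_spectrum ?T \<subseteq> {l}" using sp by blast
    show "{l} \<subseteq> {0<..} \<inter> l2_spectrum ?T" using spl l(1) by simp
  qed
  then have iso: "l isolated_in l2_spectrum ?T"
    using spl by (intro isolated_inI[of _ _ "{0<..}"]) simp_all
  have "lambda0 a b = l" unfolding lambda0_def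
  proof (rule the_equality)
    show "l > 0 \<and> l2_eigenvalue ?T l \<and> l isolated_in l2_spectrum ?T" using l eig iso by simp
    show "m = l" if "m > 0 \<and> l2_eigenvalue ?T m \<and> m isolated_in l2_spectrum ?T" for m
      using that eigenvalue_iff[of m b] unique by blast
  qed
  then show "lambda0 a b > 0" "beta_star b * g0 (lambda0 a b) = 1" using l by simp_all
qed

end

section \<open>The offspring generating function\<close>

text \<open>Abel's argument at the end point of the disc of convergence: the partial sums of
  \<open>\<Sum>n d\<^sub>n\<close> are limits of partial sums of difference quotients, which are bounded by the whole quotient
  because all late coefficients are non-negative.\<close>

lemma power_series_derivative_at_1:
  fixes d :: "nat \<Rightarrow> real"
  assumes nonneg: "\<And>n. n \<ge> 2 \<Longrightarrow> d n \<ge> 0" and d: "summable d"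
    and der: "((\<lambda>u. \<Sum>n. d n * u ^ n) has_real_derivative D) (at 1 within {0..1})"
  shows "summable (diffs d)" and "D = (\<Sum>n. diffs d n)"
proof -
  have "summable (\<lambda>n. d (n + 2))" using d by (subst summable_iff_shift)
  then have "summable (\<lambda>n. \<bar>d (n + 2)\<bar>)" using nonneg by simp
  then have dabs: "summable (\<lambda>n. \<bar>d n\<bar>)" using summable_iff_shift[of "\<lambda>n. \<bar>d n\<bar>" 2] by simp
  have su: "summable (\<lambda>n. d n * u ^ n)" if "u \<in> {0..1}" for u
  proof (rule summable_rabs_cancel, rule summable_comparison_test'[OF dabs, of 0])
    show "norm \<bar>d n * u ^ n\<bar> \<le> \<bar>d n\<bar>" for n
      using that mult_left_mono[of "u ^ n" 1 "\<bar>d n\<bar>"] by (simp add: abs_mult power_le_one)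
  qed
  define S where "S n u = (\<Sum>i<n. u ^ i)" for n and u :: real
  have S_le: "S n u \<le> real n" "S n u \<ge> 0" if "u \<in> {0..1}" for n u
  proof -
    show "S n u \<le> real n" unfolding S_def
      using sum_mono[of "{..<n}" "\<lambda>i. u ^ i" "\<lambda>_. 1"] that by (simp add: power_le_one)
    show "S n u \<ge> 0" unfolding S_def using that by (intro sum_nonneg) auto
  qed
  have S_lim: "((\<lambda>u. S n u) \<longlongrightarrow> real n) (at 1 within {0..1})" for n
  proof -
    have "((\<lambda>u. S n u) \<longlongrightarrow> S n 1) (at 1 within {0..1})" unfolding S_def by (intro tendsto_intros)
    then show ?thesis by (simp add: S_def)
  qed
  define Q where "Q u = ((\<Sum>n. d n * u ^ n) - (\<Sum>n. d n * 1 ^ n)) / (u - 1)" for u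
  have Q: "(\<lambda>n. d n * S n u) sums Q u" if u: "u \<in> {0..1}" "u \<noteq> 1" for u
  proof -
    have "(\<lambda>n. (d n * u ^ n - d n * 1 ^ n) / (u - 1)) sums Q u"
      unfolding Q_def by (intro sums_divide sums_diff summable_sums su) (use u in auto)
    moreover have "(d n * u ^ n - d n * 1 ^ n) / (u - 1) = d n * S n u" for n
    proof -
      have "u ^ n - 1 = S n u * (u - 1)" using one_diff_power_eq[of u n] by (simp add: S_def algebra_simps)
      then have "d n * (u ^ n - 1) = d n * (S n u * (u - 1))" by simp
      then have "d n * u ^ n - d n * 1 ^ n = d n * S n u * (u - 1)" by (simp only: right_diff_distrib power_one mult.assoc)
      then show ?thesis using u by simp
    qed
    ultimately show ?thesis by simp
  qed
  have Q_lim: "(Q \<longlongrightarrow> D) (at 1 within {0..1})"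
    using der unfolding has_field_derivative_iff Q_def[abs_def] by simp
  have ev: "\<forall>\<^sub>F u in at 1 within {0..1}. u \<in> {0..1} \<and> u \<noteq> (1::real)"
    by (simp add: eventually_at_topological) blast
  have nt: "at (1::real) within {0..1} \<noteq> bot" by (simp add: at_within_Icc_at_left)
  have part: "(\<Sum>n<N. d n * real n) \<le> D" if N: "N \<ge> 2" for N
  proof (rule tendsto_le[OF nt Q_lim])
    show "((\<lambda>u. \<Sum>n<N. d n * S n u) \<longlongrightarrow> (\<Sum>n<N. d n * real n)) (at 1 within {0..1})"
      by (intro tendsto_intros S_lim)
    show "\<forall>\<^sub>F u in at 1 within {0..1}. (\<Sum>n<N. d n * S n u) \<le> Q u"
      using ev
    proof eventually_elim
      case (elim u)
      note q = Q[of u]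
      have "sum (\<lambda>n. d n * S n u) {..<N} \<le> suminf (\<lambda>n. d n * S n u)"
        using elim q N nonneg S_le(2)[of u]
        by (intro sum_le_suminf) (auto simp: sums_iff not_less intro!: mult_nonneg_nonneg)
      then show ?case using elim q by (simp add: sums_iff)
    qed
  qed
  have "summable (\<lambda>n. d (n + 2) * real (n + 2))"
  proof (rule summableI_nonneg_bounded[where x = "D - d 1"])
    fix N :: nat
    have "{..<N + 2} = {0, 1} \<union> (\<lambda>n. n + 2) ` {..<N}"
    proof (rule set_eqI)
      fix k show "k \<in> {..<N + 2} \<longleftrightarrow> k \<in> {0, 1} \<union> (\<lambda>n. n + 2) ` {..<N}"
        by (cases "k < 2") (auto intro!: image_eqI[where x = "k - 2"])
    qed
    then have "(\<Sum>n<N + 2. d n * real n) = (\<Sum>n\<in>{0,1}. d n * real n) + (\<Sum>n\<in>(\<lambda>n. n + 2) ` {..<N}. d n * real n)"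
      by (simp only:) (rule sum.union_disjoint, auto)
    also have "(\<Sum>n\<in>(\<lambda>n. n + 2) ` {..<N}. d n * real n) = (\<Sum>n<N. d (n + 2) * real (n + 2))"
      by (subst sum.reindex) (auto simp: inj_on_def)
    finally show "(\<Sum>n<N. d (n + 2) * real (n + 2)) \<le> D - d 1"
      using part[of "N + 2"] by simp
  qed (use nonneg in auto)
  then have s: "summable (\<lambda>n. d n * real n)" using summable_iff_shift[of "\<lambda>n. d n * real n" 2] by simp
  then have "summable (\<lambda>n. d (Suc n) * real (Suc n))" by (subst summable_Suc_iff)
  then show "summable (diffs d)" by (simp add: diffs_def mult.commute)
  have "summable (\<lambda>n. \<bar>d (n + 2) * real (n + 2)\<bar>)"
    using \<open>summable (\<lambda>n. d (n + 2) * real (n + 2))\<close> nonneg by (simp add: abs_mult)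
  then have sabs: "summable (\<lambda>n. \<bar>d n * real n\<bar>)"
    using summable_iff_shift[of "\<lambda>n. \<bar>d n * real n\<bar>" 2] by simp
  then have sabs': "(\<lambda>n. \<bar>d n * real n\<bar>) summable_on UNIV"
    by (intro summable_infsum_eq_suminf(1)) simp
  have "((\<lambda>u. \<Sum>\<^sub>\<infinity>n. d n * S n u) \<longlongrightarrow> (\<Sum>\<^sub>\<infinity>n. d n * real n)) (at 1 within {0..1})"
  proof (rule tendsto_infsum_dominated[OF sabs'])
    show "\<forall>\<^sub>F u in at 1 within {0..1}. \<forall>n\<in>UNIV. \<bar>d n * S n u\<bar> \<le> \<bar>d n * real n\<bar>"
      using ev by eventually_elim (use S_le in \<open>auto simp: abs_mult intro!: mult_left_mono\<close>)
  qed (intro tendsto_intros S_lim)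
  moreover have "\<forall>\<^sub>F u in at 1 within {0..1}. (\<Sum>\<^sub>\<infinity>n. d n * S n u) = Q u"
    using ev
  proof eventually_elim
    case (elim u)
    have "summable (\<lambda>n. \<bar>d n * S n u\<bar>)"
    proof (rule summable_comparison_test'[OF sabs, of 0])
      show "norm \<bar>d n * S n u\<bar> \<le> \<bar>d n * real n\<bar>" for n
        using S_le[of u n] elim by (auto simp: abs_mult intro!: mult_left_mono)
    qed
    then show ?case using summable_infsum_eq_suminf(2) Q elim by (simp add: sums_iff)
  qed
  ultimately have "(Q \<longlongrightarrow> (\<Sum>\<^sub>\<infinity>n. d n * real n)) (at 1 within {0..1})"
    by (rule Lim_transform_eventually)
  then have "D = (\<Sum>\<^sub>\<infinity>n. d n * real n)" using Q_lim nt tendsto_unique by blast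
  also have "\<dots> = (\<Sum>n. d n * real n)" by (rule summable_infsum_eq_suminf(2)[OF sabs])
  also have "\<dots> = (\<Sum>n. diffs d n)" using suminf_split_head[OF s] by (simp add: diffs_def mult.commute)
  finally show "D = (\<Sum>n. diffs d n)" .
qed

lemma diffs_iterate: "(diffs ^^ r) b n = fact r * (real ((n + r) choose r) * b (n + r))"
proof (induction r arbitrary: n)
  case (Suc r)
  have "real (Suc n) * (fact r * real ((n + Suc r) choose r)) = fact (Suc r) * real ((n + Suc r) choose Suc r)"
  proof -
    have "Suc r * ((n + Suc r) choose Suc r) = Suc n * ((n + Suc r) choose r)"
      using binomial_absorb_comp[of "n + Suc r" r] binomial_absorption[of r "n + Suc r"]
      by (simp add: Suc_diff_le)
    then have "real (Suc r) * real ((n + Suc r) choose Suc r) = real (Suc n) * real ((n + Suc r) choose r)"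
      by (metis of_nat_mult)
    then show ?thesis by (simp del: of_nat_Suc add: mult.left_commute mult.assoc)
  qed
  note eq = this
  have "(diffs ^^ Suc r) b n = real (Suc n) * (diffs ^^ r) b (Suc n)"
    by (simp only: funpow.simps o_apply diffs_def[of "(diffs ^^ r) b"])
  also have "\<dots> = (real (Suc n) * (fact r * real ((n + Suc r) choose r))) * b (n + Suc r)"
    by (simp only: Suc.IH mult.assoc add_Suc_shift)
  finally show ?case by (simp only: eq mult.assoc)
qed simp

text \<open>The coefficient \<open>f\<^sup>(\<^sup>r\<^sup>) s / r!\<close> of the offspring generating function \<open>f\<close> at \<open>s\<close>, written as a sum
  over the offspring numbers.\<close>

definition gf_taylor :: "(nat \<Rightarrow> real) \<Rightarrow> nat \<Rightarrow> real \<Rightarrow> real" where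
  "gf_taylor b r s = (\<Sum>\<^sub>\<infinity>j. b j * real (j choose r) * s ^ (j - r))"

context branching_law
begin

text \<open>In the interior of the disc a power series is differentiated termwise. At \<open>1\<close>, differentiability is
  assumed, and Abel's argument identifies the one-sided derivative; it also yields convergence of the
  next series there.\<close>

lemma offspring_gf_deriv_eq:
  "summable ((diffs ^^ r) b) \<and> (\<forall>u\<in>{0..1}. offspring_gf_deriv b r u = (\<Sum>n. (diffs ^^ r) b n * u ^ n))"
proof (induction r)
  case 0
  show ?case using b_sums by (auto simp: offspring_gf_def sums_iff)
next
  case (Suc r)
  let ?d = "(diffs ^^ r) b" and ?F = "offspring_gf_deriv b r"
  have sd: "summable ?d" and eq: "\<And>u. u \<in> {0..1} \<Longrightarrow> ?F u = (\<Sum>n. ?d n * u ^ n)" using Suc by auto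
  have nonneg: "?d n \<ge> 0" if "n \<ge> 2" for n
    unfolding diffs_iterate using that by (intro mult_nonneg_nonneg b_nonneg) auto
  have tr: "(?F has_real_derivative D) (at u within {0..1})"
    if "((\<lambda>u. \<Sum>n. ?d n * u ^ n) has_real_derivative D) (at u within {0..1})" "u \<in> {0..1}" for D u
    by (rule has_field_derivative_transform_within[OF that(1) zero_less_one that(2)]) (rule eq[symmetric])
  have tr': "((\<lambda>u. \<Sum>n. ?d n * u ^ n) has_real_derivative D) (at u within {0..1})"
    if "(?F has_real_derivative D) (at u within {0..1})" "u \<in> {0..1}" for D u
    by (rule has_field_derivative_transform_within[OF that(1) zero_less_one that(2)]) (rule eq)
  have vd: "vector_derivative ?F (at u within {0..1}) = D"
    if "((\<lambda>u. \<Sum>n. ?d n * u ^ n) has_real_derivative D) (at u within {0..1})" "u \<in> {0..1}" for D u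
    by (rule vector_derivative_within_closed_interval[OF zero_less_one that(2)])
      (rule tr[OF that, unfolded has_real_derivative_iff_has_vector_derivative])
  from beta_finite[of r] have "(?F has_vector_derivative vector_derivative ?F (at 1 within {0..1})) (at 1 within {0..1})"
    by (rule vector_derivative_works[THEN iffD1])
  then have der1: "((\<lambda>u. \<Sum>n. ?d n * u ^ n) has_real_derivative vector_derivative ?F (at 1 within {0..1})) (at 1 within {0..1})"
    by (intro tr') (simp_all add: has_real_derivative_iff_has_vector_derivative)
  note p1 = power_series_derivative_at_1[OF nonneg sd der1]
  have "vector_derivative ?F (at u within {0..1}) = (\<Sum>n. diffs ?d n * u ^ n)" if u: "u \<in> {0..1}" for u
  proof (cases "u = 1")
    case True
    then show ?thesis using p1(2) by simp
  next
    case False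
    then have "DERIV (\<lambda>u. \<Sum>n. ?d n * u ^ n) u :> (\<Sum>n. diffs ?d n * u ^ n)"
      using u sd by (intro termdiffs_strong[where K = 1]) auto
    then show ?thesis by (rule vd[OF has_field_derivative_at_within u])
  qed
  then show ?case using p1(1) by (simp only: offspring_gf_deriv.simps funpow.simps o_apply) blast
qed

lemma taylor_abs_summable: "summable (\<lambda>j. \<bar>b j * real (j choose r)\<bar>)"
proof -
  have "summable (\<lambda>n. fact r * (real ((n + r) choose r) * b (n + r)))"
    using offspring_gf_deriv_eq[of r] by (simp add: diffs_iterate[abs_def])
  then have "summable (\<lambda>n. (1 / fact r) * (fact r * (real ((n + r) choose r) * b (n + r))))" by (rule summable_mult)
  then have "summable (\<lambda>n. real ((n + r) choose r) * b (n + r))" by simp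
  then have s: "summable (\<lambda>j. b j * real (j choose r))"
    using summable_iff_shift[of "\<lambda>j. b j * real (j choose r)" r] by (simp add: mult.commute)
  then have "summable (\<lambda>j. b (j + 2) * real ((j + 2) choose r))"
    using summable_iff_shift[of "\<lambda>j. b j * real (j choose r)" 2] by simp
  then have "summable (\<lambda>j. \<bar>b (j + 2) * real ((j + 2) choose r)\<bar>)" using b_nonneg by (simp add: abs_mult)
  then show ?thesis using summable_iff_shift[of "\<lambda>j. \<bar>b j * real (j choose r)\<bar>" 2] by simp
qed

lemma taylor_abs_summable_on: "(\<lambda>j. \<bar>b j * real (j choose r)\<bar>) summable_on UNIV"
  by (rule summable_infsum_eq_suminf(1)) (simp add: taylor_abs_summable)

lemma taylor_term_le:
  assumes "s \<in> {0..1}"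
  shows "\<bar>b j * real (j choose r) * s ^ (j - r)\<bar> \<le> \<bar>b j * real (j choose r)\<bar>"
  using assms mult_left_mono[of "s ^ (j - r)" 1 "\<bar>b j * real (j choose r)\<bar>"]
  by (simp add: abs_mult power_le_one)

lemma gf_taylor_abs_le:
  "s \<in> {0..1} \<Longrightarrow> \<bar>gf_taylor b r s\<bar> \<le> (\<Sum>\<^sub>\<infinity>j. \<bar>b j * real (j choose r)\<bar>)"
  unfolding gf_taylor_def by (rule abs_infsum_le[OF taylor_abs_summable_on taylor_term_le])

lemma taylor_summable:
  assumes "s \<in> {0..1}"
  shows "(\<lambda>j. b j * real (j choose r) * s ^ (j - r)) summable_on UNIV"
  by (rule abs_summable_real(2)[OF taylor_abs_summable_on]) (rule taylor_term_le[OF assms])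

lemma b_abs_summable: "(\<lambda>j. \<bar>b j\<bar>) summable_on UNIV"
  using taylor_abs_summable_on[of 0] by simp

lemma b_has_sum: "(b has_sum 0) UNIV"
proof -
  have "b summable_on UNIV" by (rule abs_summable_summable) (use b_abs_summable in simp)
  then have hs: "(b has_sum infsum b UNIV) UNIV" by (rule has_sum_infsum)
  then show ?thesis using sums_unique2[OF has_sum_imp_sums[OF hs] b_sums] by simp
qed

lemma beta_fac_eq: "beta_fac b r = fact r * gf_taylor b r 1"
proof -
  have s: "summable (\<lambda>j. b j * real (j choose r))"
    using taylor_abs_summable by (rule summable_rabs_cancel)
  have "beta_fac b r = (\<Sum>n. fact r * (real ((n + r) choose r) * b (n + r)))"
    using offspring_gf_deriv_eq[of r] by (simp add: beta_fac_def diffs_iterate)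
  also have "\<dots> = fact r * (\<Sum>n. b (n + r) * real ((n + r) choose r))"
    using suminf_mult[of "\<lambda>n. b (n + r) * real ((n + r) choose r)" "fact r"] s
      summable_iff_shift[of "\<lambda>j. b j * real (j choose r)" r] by (simp add: mult.commute)
  also have "(\<Sum>n. b (n + r) * real ((n + r) choose r)) = (\<Sum>j. b j * real (j choose r))"
    using suminf_split_initial_segment[OF s, of r] by (simp add: binomial_eq_0)
  also have "\<dots> = gf_taylor b r 1"
    unfolding gf_taylor_def using summable_infsum_eq_suminf(2)[OF taylor_abs_summable[of r]] by simp
  finally show ?thesis .
qed

lemma gf_taylor_tendsto:
  assumes "(f \<longlongrightarrow> s) F" "\<forall>\<^sub>F i in F. f i \<in> {0..1}"
  shows "((\<lambda>i. gf_taylor b r (f i)) \<longlongrightarrow> gf_taylor b r s) F"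
  unfolding gf_taylor_def
proof (rule tendsto_infsum_dominated[OF taylor_abs_summable_on])
  show "\<forall>\<^sub>F i in F. \<forall>j\<in>UNIV. \<bar>b j * real (j choose r) * f i ^ (j - r)\<bar> \<le> \<bar>b j * real (j choose r)\<bar>"
    using assms(2) by eventually_elim (use taylor_term_le in auto)
qed (intro tendsto_intros assms)

lemma gf_taylor_mono:
  assumes "s \<in> {0..1}" "r \<ge> 1"
  shows "gf_taylor b r s \<le> gf_taylor b r 1"
  unfolding gf_taylor_def
proof (rule infsum_mono[OF taylor_summable taylor_summable])
  fix j
  show "b j * real (j choose r) * s ^ (j - r) \<le> b j * real (j choose r) * 1 ^ (j - r)"
  proof (cases "j \<ge> 2")
    case True
    then show ?thesis using assms b_nonneg[of j] by (intro mult_left_mono) (auto simp: power_le_one)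
  next
    case False
    then have "j = 0 \<or> j = 1" by auto
    then show ?thesis using assms by (auto simp: binomial_eq_0 le_Suc_eq)
  qed
qed (use assms in auto)

lemma taylor_term_nonneg: "r \<ge> 2 \<Longrightarrow> b j * real (j choose r) \<ge> 0"
  using b_nonneg[of j] by (cases "j = 1") (auto simp: binomial_eq_0)

lemma gf_taylor_nonneg:
  assumes "s \<in> {0..1}" "r \<ge> 2"
  shows "gf_taylor b r s \<ge> 0"
  unfolding gf_taylor_def
  by (intro infsum_nonneg mult_nonneg_nonneg taylor_term_nonneg) (use assms in auto)

lemma gf_taylor_1: "gf_taylor b 1 1 = beta_star b - b 0"
proof -
  have s1: "(\<lambda>j. b j * real j) summable_on UNIV" using taylor_summable[of 1 1] by simp
  have s0: "b summable_on UNIV" using taylor_summable[of 1 0] by simp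
  have b0: "infsum b UNIV = 0"
    using summable_infsum_eq_suminf(2)[of b] taylor_abs_summable[of 0] b_sums by (simp add: sums_iff)
  have "(\<Sum>\<^sub>\<infinity>j. b j * real j + - b j) = (\<Sum>\<^sub>\<infinity>j. b j * real j) + (\<Sum>\<^sub>\<infinity>j. - b j)"
    by (rule infsum_add[OF s1]) (simp add: summable_on_uminus s0)
  then have 1: "gf_taylor b 1 1 = (\<Sum>\<^sub>\<infinity>j. b j * real j + - b j)" by (simp add: gf_taylor_def infsum_uminus b0)
  have sm: "(\<lambda>j. b j * real j + - b j) summable_on UNIV"
    by (intro summable_on_add s1) (simp add: summable_on_uminus s0)
  have "(\<Sum>\<^sub>\<infinity>j\<in>{n. n > 1}. b j * real j + - b j) = (\<Sum>\<^sub>\<infinity>j\<in>UNIV - {0, 1}. b j * real j + - b j)"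
    by (rule infsum_cong_neutral) auto
  also have "\<dots> = (\<Sum>\<^sub>\<infinity>j. b j * real j + - b j) - (\<Sum>\<^sub>\<infinity>j\<in>{0,1}. b j * real j + - b j)"
    by (rule infsum_Diff[OF sm]) auto
  finally show ?thesis using 1 by (simp add: beta_star_def algebra_simps)
qed

lemma gf_taylor_2_pos:
  assumes "beta_star b > 0"
  shows "gf_taylor b 2 1 > 0"
proof -
  have "\<exists>n>1. b n > 0"
  proof (rule ccontr)
    assume "\<not> ?thesis"
    then have "b n = 0" if "n > 1" for n using b_nonneg[of n] that by force
    then have "beta_star b = 0" unfolding beta_star_def by (intro infsum_0) auto
    with assms show False by simp
  qed
  then obtain n where n: "n > 1" "b n > 0" by blast
  have "0 < b n * real (n choose 2)" using n by (auto simp: Suc_le_eq)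
  also have "\<dots> = infsum (\<lambda>j. b j * real (j choose 2) * 1 ^ (j - 2)) {n}" by simp
  also have "\<dots> \<le> gf_taylor b 2 1"
    unfolding gf_taylor_def
    by (rule infsum_mono2) (use taylor_summable[of 1 2] taylor_term_nonneg[of 2] in auto)
  finally show ?thesis .
qed

end

section \<open>Moments of additive functionals of the branching walk\<close>

lemma expectation_pair_product:
  fixes f :: "'a \<Rightarrow> real" and g :: "'b \<Rightarrow> real"
  assumes f: "\<And>x. 0 \<le> f x" "\<And>x. f x \<le> C" and g: "\<And>x. 0 \<le> g x" "\<And>x. g x \<le> D"
  shows "measure_pmf.expectation (pair_pmf p q) (\<lambda>(x, y). f x * g y)
    = measure_pmf.expectation p f * measure_pmf.expectation q g"
proof -
  have C: "C \<ge> 0" using f order_trans by blast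
  have int: "integrable (measure_pmf p) f" "integrable (measure_pmf q) g"
    using f g by (auto intro: measure_pmf.integrable_const_bound[where B = C] measure_pmf.integrable_const_bound[where B = D])
  have b: "f x * g y \<le> C * D" for x y using f g C by (intro mult_mono) auto
  have "ennreal (measure_pmf.expectation (pair_pmf p q) (\<lambda>(x, y). f x * g y))
      = (\<integral>\<^sup>+z. ennreal ((\<lambda>(x, y). f x * g y) z) \<partial>pair_pmf p q)"
    by (rule nn_integral_eq_integral[symmetric], rule measure_pmf.integrable_const_bound[where B = "C * D"])
      (use f g b in \<open>auto simp: case_prod_unfold intro!: AE_pmfI\<close>)
  also have "\<dots> = (\<integral>\<^sup>+x. ennreal (f x) * (\<integral>\<^sup>+y. ennreal (g y) \<partial>q) \<partial>p)"
    by (simp add: nn_integral_pair_pmf' ennreal_mult f g nn_integral_cmult)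
  also have "\<dots> = (\<integral>\<^sup>+x. ennreal (f x) \<partial>p) * (\<integral>\<^sup>+y. ennreal (g y) \<partial>q)"
    by (rule nn_integral_multc) simp
  also have "\<dots> = ennreal (measure_pmf.expectation p f) * ennreal (measure_pmf.expectation q g)"
    using f g by (simp add: nn_integral_eq_integral[OF int(1)] nn_integral_eq_integral[OF int(2)])
  also have "\<dots> = ennreal (measure_pmf.expectation p f * measure_pmf.expectation q g)"
    using f g by (intro ennreal_mult[symmetric]) (auto intro!: integral_nonneg_AE)
  finally show ?thesis
    using f g by (subst (asm) ennreal_inj) (auto intro!: integral_nonneg_AE mult_nonneg_nonneg simp: case_prod_unfold)
qed

text \<open>The inner sum in the functions \<open>g\<^sub>n\<close>.\<close>

definition comp_sum :: "nat \<Rightarrow> nat \<Rightarrow> (nat \<Rightarrow> real) \<Rightarrow> real" where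
  "comp_sum r n m = (\<Sum>is\<in>compositions r n. fact n / prod_list (map fact is) * prod_list (map m is))"

lemma compositions_0: "compositions 0 n = (if n = 0 then {[]} else {})"
  by (auto simp: compositions_def)

lemma compositions_Suc: "compositions (Suc r) n = (\<Union>i\<in>{1..n}. (#) i ` compositions r (n - i))"
proof (intro set_eqI iffI)
  fix xs assume xs: "xs \<in> compositions (Suc r) n"
  then obtain i ys where "xs = i # ys" by (cases xs) (auto simp: compositions_def)
  with xs have "i \<in> {1..n}" "ys \<in> compositions r (n - i)" "xs = i # ys" by (auto simp: compositions_def)
  then show "xs \<in> (\<Union>i\<in>{1..n}. (#) i ` compositions r (n - i))" by blast
qed (auto simp: compositions_def)

text \<open>The \<open>r\<close>-th power of the exponential generating function of \<open>m\<^sub>1, m\<^sub>2, ...\<close>, which has no constant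
  term, enumerates the compositions into \<open>r\<close> parts.\<close>

lemma comp_sum_fps:
  "fact n * fps_nth (Abs_fps (\<lambda>i. if i = 0 then 0 else m i / fact i) ^ r) n = comp_sum r n m"
proof -
  let ?N = "Abs_fps (\<lambda>i. if i = 0 then 0 else m i / fact i)"
  have "fps_nth (?N ^ r) n = (\<Sum>is\<in>compositions r n. prod_list (map (\<lambda>i. m i / fact i) is))" for n
  proof (induction r arbitrary: n)
    case 0
    show ?case by (simp add: compositions_0)
  next
    case (Suc r)
    have "(\<Sum>is\<in>compositions (Suc r) n. prod_list (map (\<lambda>i. m i / fact i) is))
        = (\<Sum>i\<in>{1..n}. \<Sum>is\<in>(#) i ` compositions r (n - i). prod_list (map (\<lambda>i. m i / fact i) is))"
      unfolding compositions_Suc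
      by (rule sum.UNION_disjoint) (auto intro: finite_imageI finite_compositions)
    also have "\<dots> = (\<Sum>i\<in>{1..n}. m i / fact i * fps_nth (?N ^ r) (n - i))"
      by (simp add: sum.reindex Suc.IH sum_distrib_left)
    also have "\<dots> = (\<Sum>i\<in>{0..n}. fps_nth ?N i * fps_nth (?N ^ r) (n - i))"
      by (rule sum.mono_neutral_cong_left) auto
    also have "\<dots> = fps_nth (?N ^ Suc r) n" by (simp add: fps_mult_nth)
    finally show ?case by simp
  qed
  moreover have "prod_list (map (\<lambda>i. m i / fact i) is) = prod_list (map m is) / prod_list (map fact is)" for "is"
    by (induction "is") auto
  ultimately show ?thesis by (simp add: comp_sum_def sum_distrib_left)
qed

text \<open>This makes the moment equations recursive.\<close>

lemma composition_parts:
  assumes "is \<in> compositions r n" "r \<ge> 2" "i \<in> set is"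
  shows "1 \<le> i" "i < n"
proof -
  show "1 \<le> i" using assms by (auto simp: compositions_def Suc_le_eq)
  from assms(3) obtain xs ys where s: "is = xs @ i # ys" by (auto simp: in_set_conv_decomp)
  then have "xs @ ys \<noteq> []" using assms by (auto simp: compositions_def)
  then obtain j where j: "j \<in> set (xs @ ys)" by (cases "xs @ ys") auto
  then have "j > 0" using assms s by (auto simp: compositions_def)
  moreover have "j \<le> sum_list (xs @ ys)" by (rule member_le_sum_list[OF j]) simp
  moreover have "sum_list is = i + sum_list (xs @ ys)" by (simp add: s)
  ultimately show "i < n" using assms(1) by (simp add: compositions_def)
qed

lemma comp_sum_tendsto:
  assumes "r \<ge> 2" "\<And>i. 1 \<le> i \<Longrightarrow> i < n \<Longrightarrow> ((\<lambda>t. m t i) \<longlongrightarrow> l i) F"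
  shows "((\<lambda>t. comp_sum r n (m t)) \<longlongrightarrow> comp_sum r n l) F"
proof -
  have *: "((\<lambda>t. prod_list (map (m t) is)) \<longlongrightarrow> prod_list (map l is)) F"
    if "\<And>i. i \<in> set is \<Longrightarrow> ((\<lambda>t. m t i) \<longlongrightarrow> l i) F" for "is"
    using that by (induction "is") (auto intro!: tendsto_intros)
  show ?thesis
    unfolding comp_sum_def using assms composition_parts
    by (intro tendsto_sum tendsto_mult tendsto_const *) blast
qed

lemma comp_sum_mono:
  assumes "r \<ge> 2" "\<And>i. 1 \<le> i \<Longrightarrow> i < n \<Longrightarrow> 0 \<le> m i \<and> m i \<le> l i"
  shows "0 \<le> comp_sum r n m" "comp_sum r n m \<le> comp_sum r n l"
proof -
  have *: "0 \<le> prod_list (map m is) \<and> prod_list (map m is) \<le> prod_list (map l is)"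
    if "\<And>i. i \<in> set is \<Longrightarrow> 0 \<le> m i \<and> m i \<le> l i" for "is"
    using that
  proof (induction "is")
    case (Cons i "is")
    have "0 \<le> m i" "m i \<le> l i" using Cons.prems by auto
    moreover have "0 \<le> prod_list (map m is) \<and> prod_list (map m is) \<le> prod_list (map l is)"
      using Cons by auto
    ultimately show ?case by (auto intro!: mult_mono)
  qed simp
  have t: "0 \<le> prod_list (map m is) \<and> prod_list (map m is) \<le> prod_list (map l is)"
    if "is \<in> compositions r n" for "is"
    using *[of "is"] assms(2) composition_parts[OF that assms(1)] by blast
  have f: "(0::real) \<le> fact n / prod_list (map fact is)" for "is" :: "nat list"
    by (intro divide_nonneg_nonneg prod_list_nonneg) auto
  show "0 \<le> comp_sum r n m"
    unfolding comp_sum_def by (intro sum_nonneg mult_nonneg_nonneg f) (use t in blast)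
  show "comp_sum r n m \<le> comp_sum r n l"
    unfolding comp_sum_def by (intro sum_mono mult_left_mono f) (use t in blast)
qed

context branching_random_walk
begin

lemma g_moment_eq: "g_moment b n m = (\<Sum>r=2..n. gf_taylor b r 1 * comp_sum r n m)"
  by (simp add: g_moment_def beta_fac_eq comp_sum_def)

text \<open>For independent copies of a random variable with moments \<open>m\<close>, the \<open>n\<close>-th moment of the sum of \<open>j\<close>
  copies is \<open>n!\<close> times the coefficient of \<open>\<Phi> ^ j\<close>. Splitting off the constant term \<open>m 0\<close> by the binomial
  theorem and summing over \<open>j\<close> gives Faa di Bruno's formula. For the damped moments below, \<open>m 0\<close> is the mean damping
  factor, a number of \<open>[0,1]\<close>.\<close>

lemma offspring_expansion:
  fixes \<Phi> :: "real fps" and m :: "nat \<Rightarrow> real"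
  assumes \<Phi>: "\<And>i. fps_nth \<Phi> i = m i / fact i" and m0: "m 0 \<in> {0..1}" and n: "n \<ge> 1"
  shows "((\<lambda>j. b j * (fact n * fps_nth (\<Phi> ^ j) n)) has_sum
    (gf_taylor b 1 (m 0) * m n + (\<Sum>r=2..n. gf_taylor b r (m 0) * comp_sum r n m))) UNIV"
proof -
  let ?N = "Abs_fps (\<lambda>i. if i = 0 then 0 else m i / fact i)"
  have \<Phi>_eq: "\<Phi> = ?N + fps_const (m 0)" by (rule fps_ext) (simp add: \<Phi>)
  have N0: "fps_nth (?N ^ r) n = 0" if "r > n" for r
    using that by (simp add: startsby_zero_power_prefix)
  have pow: "fact n * fps_nth (\<Phi> ^ j) n = (\<Sum>r\<le>n. real (j choose r) * m 0 ^ (j - r) * comp_sum r n m)" for j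
  proof -
    have "fps_nth (\<Phi> ^ j) n = (\<Sum>r\<le>j. real (j choose r) * m 0 ^ (j - r) * fps_nth (?N ^ r) n)"
      unfolding \<Phi>_eq binomial_ring fps_sum_nth
      by (rule sum.cong) (simp_all add: fps_const_power fps_of_nat[symmetric] mult.assoc ac_simps)
    also have "\<dots> = (\<Sum>r\<le>max j n. real (j choose r) * m 0 ^ (j - r) * fps_nth (?N ^ r) n)"
      by (rule sum.mono_neutral_left) (auto simp: binomial_eq_0)
    also have "\<dots> = (\<Sum>r\<le>n. real (j choose r) * m 0 ^ (j - r) * fps_nth (?N ^ r) n)"
      by (rule sum.mono_neutral_right) (auto simp: N0)
    finally show ?thesis by (simp add: sum_distrib_left comp_sum_fps[symmetric] ac_simps)
  qed
  have "((\<lambda>j. \<Sum>r\<le>n. b j * real (j choose r) * m 0 ^ (j - r) * comp_sum r n m)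
      has_sum (\<Sum>r\<le>n. gf_taylor b r (m 0) * comp_sum r n m)) UNIV"
    unfolding gf_taylor_def
    by (intro has_sum_finite_sum has_sum_cmult_left has_sum_infsum taylor_summable[OF m0]) simp
  moreover have "(\<Sum>r\<le>n. gf_taylor b r (m 0) * comp_sum r n m)
      = gf_taylor b 1 (m 0) * m n + (\<Sum>r=2..n. gf_taylor b r (m 0) * comp_sum r n m)"
  proof -
    have "{..n} = insert 0 (insert 1 {2..n})" using n by auto
    moreover have "comp_sum 0 n m = 0" using n by (simp add: comp_sum_def compositions_0)
    moreover have "comp_sum 1 n m = m n" using n comp_sum_fps[of n m 1] by simp
    ultimately show ?thesis by simp
  qed
  moreover have "(\<lambda>j. \<Sum>r\<le>n. b j * real (j choose r) * m 0 ^ (j - r) * comp_sum r n m)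
      = (\<lambda>j. b j * (fact n * fps_nth (\<Phi> ^ j) n))"
    by (rule ext) (simp add: pow sum_distrib_left mult.assoc)
  ultimately show ?thesis by simp
qed

sublocale KS: markov_semigroup K
  by unfold_locales (auto simp: K_start K_Markov)

text \<open>Independent particles stay together at least when each of them stays.\<close>

lemma K_stay_tendsto: "((\<lambda>h. pmf (K h \<xi>) \<xi>) \<longlongrightarrow> 1) (at_right 0)"
proof (induction \<xi>)
  case empty
  have "\<forall>\<^sub>F h in at_right (0::real). 1 = pmf (K h {#}) {#}"
    using eventually_at_right_less[of "0::real"] by eventually_elim (simp add: K_empty)
  then show ?case by (rule Lim_transform_eventually[OF tendsto_const])
next
  case (add x \<xi>)
  have 1: "((\<lambda>h. pmf (K h {#x#}) {#x#}) \<longlongrightarrow> 1) (at_right 0)"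
    by (rule smallo_rate(2)[OF K_stay])
  show ?case
  proof (rule tendsto_sandwich)
    show "((\<lambda>h. pmf (K h {#x#}) {#x#} * pmf (K h \<xi>) \<xi>) \<longlongrightarrow> 1) (at_right 0)"
      using tendsto_mult[OF 1 add] by simp
    show "\<forall>\<^sub>F h in at_right 0. pmf (K h {#x#}) {#x#} * pmf (K h \<xi>) \<xi> \<le> pmf (K h (add_mset x \<xi>)) (add_mset x \<xi>)"
      using eventually_at_right_less[of "0::real"]
    proof eventually_elim
      case (elim h)
      let ?p = "pair_pmf (K h {#x#}) (K h \<xi>)"
      have "pmf (K h {#x#}) {#x#} * pmf (K h \<xi>) \<xi> = measure_pmf.prob ?p {({#x#}, \<xi>)}"
        by (simp add: measure_pmf_single pmf_pair)
      also have "\<dots> \<le> measure_pmf.prob ?p ((\<lambda>(\<eta>', \<xi>'). \<eta>' + \<xi>') -` {add_mset x \<xi>})"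
        by (rule measure_pmf.finite_measure_mono) auto
      also have "\<dots> = pmf (K h (add_mset x \<xi>)) (add_mset x \<xi>)"
        using K_independent[of h "{#x#}" \<xi>] elim by (simp add: pmf_map)
      finally show ?case .
    qed
  qed (auto simp: pmf_le_1)
qed

text \<open>The transitions out of a single particle are indexed by the size of the offspring
  (left summand) and the target of a jump (right summand). Staying at \<open>x\<close> belongs to the
  offspring number \<open>1\<close> if \<open>x = 0\<close> and to the jump target \<open>x\<close> otherwise.\<close>

definition targets :: "int ^ 'd \<Rightarrow> (nat + int ^ 'd) set" where
  "targets x = (if x = 0 then range Inl \<union> Inr ` (- {0}) else {Inl 0} \<union> range Inr)"

fun target :: "nat + int ^ 'd \<Rightarrow> (int ^ 'd) multiset" where
  "target (Inl j) = replicate_mset j 0"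
| "target (Inr y) = {#y#}"

fun rate :: "int ^ 'd \<Rightarrow> nat + int ^ 'd \<Rightarrow> real" where
  "rate x (Inl j) = b j + (if x = 0 \<and> j = 1 then a x x else 0)"
| "rate x (Inr y) = a x y - (if y = x then b 0 else 0)"

definition stay_index :: "int ^ 'd \<Rightarrow> nat + int ^ 'd" where
  "stay_index x = (if x = 0 then Inl 1 else Inr x)"

lemma stay_target: "target (stay_index x) = {#x#}" "stay_index x \<in> targets x"
  by (auto simp: stay_index_def targets_def)

lemma replicate_eq_single: "replicate_mset j x = {#y#} \<longleftrightarrow> j = 1 \<and> x = y"
proof
  assume "replicate_mset j x = {#y#}"
  then have "size (replicate_mset j x) = 1" "set_mset (replicate_mset j x) = {y}" by simp_all
  then show "j = 1 \<and> x = y" by simp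
qed simp

lemma target_inj: "inj_on target (targets x)"
proof (rule inj_onI)
  fix i k assume *: "i \<in> targets x" "k \<in> targets x" "target i = target k"
  have "replicate_mset j (0 :: int ^ 'd) = replicate_mset j' 0 \<longleftrightarrow> j = j'" for j j'
    by (metis size_replicate_mset)
  then show "i = k"
    using * replicate_eq_single[of _ "0 :: int ^ 'd"] replicate_eq_single[of _ "0 :: int ^ 'd", THEN eq_commute[THEN iffD1, THEN iffD1]]
    by (cases i; cases k) (auto simp: targets_def split: if_splits dest: sym)
qed

lemma rate_has_sum:
  assumes f: "\<And>\<xi>. \<bar>f \<xi>\<bar> \<le> C"
    and A: "((\<lambda>j. b j * f (replicate_mset j 0)) has_sum A) UNIV"
  shows "((\<lambda>i. rate x i * f (target i)) has_sum
    ((\<Sum>\<^sub>\<infinity>y. a x y * f {#y#}) + (if x = 0 then A else b 0 * f {#} - b 0 * f {#x#}))) (targets x)"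
proof -
  define S where "S = (\<Sum>\<^sub>\<infinity>y. a x y * f {#y#})"
  have single: "((\<lambda>y. if y = k then v else 0) has_sum v) UNIV" for k :: 'k and v :: real
    by (rule has_sum_finite_neutralI[of "{k}"]) auto
  have "(\<lambda>y. \<bar>a x y\<bar>) summable_on UNIV"
    using regular[of x] summable_on_iff_abs_summable_on_real[of "a x" UNIV] by (auto simp: summable_on_def)
  then have "(\<lambda>y. a x y * f {#y#}) summable_on UNIV"
    by (rule abs_summable_real(2)[OF summable_on_cmult_left[where c = C]])
      (use f in \<open>auto simp: abs_mult intro!: mult_left_mono\<close>)
  then have S: "((\<lambda>y. a x y * f {#y#}) has_sum S) UNIV" unfolding S_def by (rule has_sum_infsum)
  show ?thesis
  proof (cases "x = 0")
    case True
    have "((\<lambda>j. b j * f (replicate_mset j 0) + (if j = 1 then a 0 0 * f {#0#} else 0)) has_sum (A + a 0 0 * f {#0#})) UNIV"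
      by (intro has_sum_add A single)
    then have 1: "((\<lambda>i. rate x i * f (target i)) has_sum (A + a 0 0 * f {#0#})) (range Inl)"
      by (subst has_sum_reindex) (auto simp: o_def True algebra_simps if_distrib cong: if_cong elim!: has_sum_cong[THEN iffD1, rotated])
    have "((\<lambda>y. a x y * f {#y#}) has_sum (S - a 0 0 * f {#0#})) (UNIV - {0})"
      by (rule has_sum_Diff[OF S]) (auto simp: True intro!: has_sum_finiteI)
    then have 2: "((\<lambda>i. rate x i * f (target i)) has_sum (S - a 0 0 * f {#0#})) (Inr ` (- {0}))"
      by (subst has_sum_reindex) (auto simp: o_def True Compl_eq_Diff_UNIV elim!: has_sum_cong[THEN iffD1, rotated] split: if_splits)
    have "((\<lambda>i. rate x i * f (target i)) has_sum ((A + a 0 0 * f {#0#}) + (S - a 0 0 * f {#0#}))) (range Inl \<union> Inr ` (- {0}))"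
      by (rule has_sum_Un_disjoint[OF 1 2]) auto
    then show ?thesis by (simp add: targets_def True S_def add.commute)
  next
    case False
    have "((\<lambda>y. a x y * f {#y#} + (if y = x then - b 0 * f {#x#} else 0)) has_sum (S + - b 0 * f {#x#})) UNIV"
      by (intro has_sum_add S single)
    then have 1: "((\<lambda>i. rate x i * f (target i)) has_sum (S + - b 0 * f {#x#})) (range Inr)"
      by (subst has_sum_reindex) (auto simp: o_def algebra_simps if_distrib cong: if_cong elim!: has_sum_cong[THEN iffD1, rotated])
    have 2: "((\<lambda>i. rate x i * f (target i)) has_sum (b 0 * f {#})) {Inl 0}"
      by (rule has_sum_finiteI) (auto simp: False)
    have "((\<lambda>i. rate x i * f (target i)) has_sum ((b 0 * f {#}) + (S + - b 0 * f {#x#}))) ({Inl 0} \<union> range Inr)"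
      by (rule has_sum_Un_disjoint[OF 2 1]) auto
    then show ?thesis using False by (simp add: targets_def S_def[symmetric] algebra_simps)
  qed
qed

lemma rate_limit:
  assumes "i \<in> targets x"
  shows "((\<lambda>h. (pmf (K h (target (stay_index x))) (target i) - (if i = stay_index x then 1 else 0)) / h)
    \<longlongrightarrow> rate x i) (at_right 0)"
proof -
  have jump: "((\<lambda>h. pmf (K h {#x#}) {#y#} / h) \<longlongrightarrow> a x y) (at_right 0)" if "x \<noteq> y" for y
    using smallo_rate(1)[of "\<lambda>h. pmf (K h {#x#}) {#y#}" 0 "a x y"] K_jump[OF that] by simp
  have death: "((\<lambda>h. pmf (K h {#x#}) {#} / h) \<longlongrightarrow> b 0) (at_right 0)"
    using smallo_rate(1)[of "\<lambda>h. pmf (K h {#x#}) {#}" 0 "b 0"] K_death by simp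
  have stay: "((\<lambda>h. (pmf (K h {#x#}) {#x#} - 1) / h) \<longlongrightarrow> a x x + (if x = 0 then b 1 else - b 0)) (at_right 0)"
    by (rule smallo_rate(1)[OF K_stay])
  have branch: "((\<lambda>h. pmf (K h {#0#}) (replicate_mset n 0) / h) \<longlongrightarrow> b n) (at_right 0)" if "n > 1" for n
    using smallo_rate(1)[of "\<lambda>h. pmf (K h {#0#}) (replicate_mset n 0)" 0 "b n"] K_branch[OF that] by simp
  show ?thesis
  proof (cases "x = 0")
    case True
    show ?thesis
    proof (cases i)
      case (Inl j)
      consider "j = 0" | "j = 1" | "j > 1" by linarith
      then show ?thesis
        by cases (use True Inl death stay branch in \<open>auto simp: stay_index_def add.commute\<close>)
    next
      case (Inr y)
      then show ?thesis using True assms jump[of y] by (auto simp: stay_index_def targets_def)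
    qed
  next
    case False
    then show ?thesis using assms jump death stay
      by (cases i) (auto simp: stay_index_def targets_def)
  qed
qed

lemma ev_backward:
  assumes f: "\<And>\<xi>. 0 \<le> f \<xi>" "\<And>\<xi>. f \<xi> \<le> C" and t: "t \<ge> 0"
    and A: "((\<lambda>j. b j * KS.ev f t (replicate_mset j 0)) has_sum A) UNIV"
  shows "((\<lambda>t. KS.ev f t {#x#}) has_real_derivative
    (\<Sum>\<^sub>\<infinity>y. a x y * KS.ev f t {#y#}) + (if x = 0 then A else b 0 * f {#} - b 0 * KS.ev f t {#x#}))
    (at t within {0..})"
proof -
  have "((\<lambda>i. rate x i * 1) has_sum ((\<Sum>\<^sub>\<infinity>y. a x y * 1) + (if x = 0 then 0 else b 0 * 1 - b 0 * 1))) (targets x)"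
    by (intro rate_has_sum[where f = "\<lambda>_. 1" and C = 1]) (use b_has_sum in auto)
  then have q: "(rate x has_sum 0) (targets x)" using infsumI[OF regular[of x]] by (cases "x = 0") auto
  have "((\<lambda>t. KS.ev f t (target (stay_index x))) has_real_derivative
      (\<Sum>\<^sub>\<infinity>i\<in>targets x. rate x i * KS.ev f t (target i))) (at t within {0..})"
    by (rule KS.backward_equation[OF f target_inj stay_target(2) q rate_limit K_stay_tendsto t])
  moreover have "(\<Sum>\<^sub>\<infinity>i\<in>targets x. rate x i * KS.ev f t (target i))
    = (\<Sum>\<^sub>\<infinity>y. a x y * KS.ev f t {#y#}) + (if x = 0 then A else b 0 * KS.ev f t {#} - b 0 * KS.ev f t {#x#})"
    by (rule infsumI, rule rate_has_sum[where C = C, OF _ A]) (use KS.ev_range[OF f] in simp)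
  moreover have "KS.ev f t {#} = f {#}" by (simp add: KS.ev_def K_empty[OF t])
  ultimately show ?thesis by (cases "x = 0") (simp_all add: stay_target)
qed

end

lemma power_exp_le:
  assumes "x \<ge> 0" "z > 0"
  shows "x ^ n * exp (- z * x) \<le> fact n / (z::real) ^ n"
proof -
  have "(\<Sum>k\<in>{n}. (z * x) ^ k /\<^sub>R fact k) \<le> (\<Sum>k. (z * x) ^ k /\<^sub>R fact k)"
    by (rule sum_le_suminf[OF summable_exp_generic]) (use assms in auto)
  then have "(z * x) ^ n / fact n \<le> exp (z * x)" by (simp add: exp_def divide_inverse mult.commute)
  then show ?thesis using assms by (simp add: exp_minus power_mult_distrib field_simps)
qed

context branching_random_walk
begin

subsection \<open>The kernel of the evolution operator\<close>

text \<open>The operator \<open>A + \<beta> \<Delta>\<^sub>0\<close>, shifted by \<open>c\<close> to become a non-negative kernel.\<close>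

definition kern :: "int ^ 'd \<Rightarrow> int ^ 'd \<Rightarrow> real" where
  "kern x y = jump x y + beta_star b * (indicator {0} x * indicator {0} y)"

lemma beta_star_nonneg: "beta_star b \<ge> 0"
  unfolding beta_star_def using b_nonneg by (intro infsum_nonneg mult_nonneg_nonneg) auto

lemma kern_has_sum: "(kern x has_sum (c + beta_star b * indicator {0} x)) UNIV"
proof -
  have "((\<lambda>y. beta_star b * (indicator {0} x * indicator {0} y)) has_sum (beta_star b * indicator {0} x)) UNIV"
    by (rule has_sum_finite_neutralI[of "{0}"]) auto
  from has_sum_add[OF jump_has_sum this] show ?thesis by (simp add: kern_def[abs_def])
qed

sublocale W: bounded_kernel kern "c + beta_star b"
proof
  show "kern x y \<ge> 0" "kern x y = kern y x" for x y
    using J.B_nonneg[of x y] J.B_sym[of x y] beta_star_nonneg by (auto simp: kern_def indicator_def)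
  show "kern x summable_on UNIV" for x
    using kern_has_sum[of x] unfolding summable_on_def by blast
  show "infsum (kern x) UNIV \<le> c + beta_star b" for x
    using infsumI[OF kern_has_sum[of x]] beta_star_nonneg by (simp add: indicator_def)
qed

lemma kern_act:
  assumes "\<And>z. \<bar>f z\<bar> \<le> C"
  shows "W.act f x = J.act f x + beta_star b * f 0 * indicator {0} x"
proof -
  have h: "((\<lambda>y. beta_star b * (indicator {0} x * indicator {0} y) * f y) has_sum (beta_star b * f 0 * indicator {0} x)) UNIV"
    by (rule has_sum_finite_neutralI[of "{0}"]) auto
  have "((\<lambda>y. jump x y * f y) has_sum J.act f x) UNIV"
    unfolding J.act_def by (rule has_sum_infsum[OF J.act_summable[OF assms]])
  from has_sum_add[OF this h] show ?thesis
    unfolding W.act_def kern_def by (intro infsumI) (simp add: algebra_simps)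
qed

definition decay :: real where "decay = c + b 0"

text \<open>The evolution operator is \<open>kern - decay\<close>, so this is its fundamental solution with pole \<open>0\<close>:
  the mean number of particles at \<open>0\<close> when the process starts at \<open>x\<close>.\<close>

definition mean_kernel :: "real \<Rightarrow> int ^ 'd \<Rightarrow> real" where
  "mean_kernel t x = exp (- decay * t) * W.heat t (indicator {0}) x"

lemma decay_pos: "decay > 0"
  using c_pos b_nonneg[of 0] by (simp add: decay_def)

lemma mean_kernel_nonneg: "t \<ge> 0 \<Longrightarrow> mean_kernel t x \<ge> 0"
  unfolding mean_kernel_def by (intro mult_nonneg_nonneg W.heat_nonneg[OF _ indicator_le_1]) auto

lemma mean_kernel_le:
  assumes "t \<ge> 0"
  shows "mean_kernel t x \<le> exp ((beta_star b - b 0) * t)"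
proof -
  have "\<bar>W.heat t (indicator {0}) x\<bar> \<le> exp (\<bar>t\<bar> * (c + beta_star b)) * 1"
    by (rule W.heat_bound[OF indicator_le_1])
  then have "mean_kernel t x \<le> exp (- decay * t) * exp (t * (c + beta_star b))"
    unfolding mean_kernel_def using assms by (intro mult_left_mono) auto
  then show ?thesis by (simp add: mult_exp_exp decay_def algebra_simps)
qed

lemma mean_kernel_continuous: "continuous_on S (\<lambda>t. mean_kernel t x)"
  unfolding mean_kernel_def by (intro continuous_intros W.heat_continuous[OF indicator_le_1])

subsection \<open>Damped moments\<close>

context
  fixes w :: "int ^ 'd \<Rightarrow> real"
  assumes w01: "\<And>x. w x = 0 \<or> w x = 1"
begin

text \<open>The weight \<open>w\<close> is the indicator of a site for the local moments and the constant
  \<open>1\<close> for the total ones. Damping by \<open>exp (- z * weight \<xi>)\<close> keeps the moments bounded, without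
  destroying the product structure on which the moment equations rest.\<close>

definition weight :: "(int ^ 'd) multiset \<Rightarrow> real" where
  "weight \<xi> = (\<Sum>x\<in>#\<xi>. w x)"

definition damped :: "nat \<Rightarrow> real \<Rightarrow> (int ^ 'd) multiset \<Rightarrow> real" where
  "damped n z \<xi> = weight \<xi> ^ n * exp (- z * weight \<xi>)"

definition dmom :: "nat \<Rightarrow> real \<Rightarrow> real \<Rightarrow> (int ^ 'd) multiset \<Rightarrow> real" where
  "dmom n z t \<xi> = KS.ev (damped n z) t \<xi>"

definition mom :: "nat \<Rightarrow> real \<Rightarrow> int ^ 'd \<Rightarrow> real" where
  "mom n t x = measure_pmf.expectation (K t {#x#}) (\<lambda>\<xi>. weight \<xi> ^ n)"

lemma w_nonneg: "0 \<le> w x" and w_abs: "\<bar>w x\<bar> \<le> 1"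
  using w01[of x] by auto

lemma weight_simps: "weight {#} = 0" "weight {#x#} = w x" "weight (\<xi> + \<eta>) = weight \<xi> + weight \<eta>"
  by (auto simp: weight_def)

lemma weight_nonneg: "weight \<xi> \<ge> 0"
  by (induction \<xi>) (auto simp: weight_def w_nonneg)

lemma damped_nonneg: "0 \<le> damped n z \<xi>"
  by (simp add: damped_def weight_nonneg)

lemma damped_le: "z > 0 \<Longrightarrow> damped n z \<xi> \<le> fact n / z ^ n"
  unfolding damped_def by (rule power_exp_le[OF weight_nonneg])

lemma damped_single: "n \<ge> 1 \<Longrightarrow> damped n z {#x#} = w x * exp (- z * w x)"
  using w01[of x] by (auto simp: damped_def weight_simps)

lemma damped_add:
  "damped n z (\<xi> + \<eta>) = (\<Sum>i\<le>n. real (n choose i) * (damped i z \<xi> * damped (n - i) z \<eta>))"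
proof -
  have e: "exp (- z * (weight \<xi> + weight \<eta>)) = exp (- z * weight \<xi>) * exp (- z * weight \<eta>)"
    by (simp add: mult_exp_exp algebra_simps)
  show ?thesis
    unfolding damped_def weight_simps e binomial_ring sum_distrib_right
    by (rule sum.cong) (simp_all add: ac_simps)
qed

context
  fixes z :: real
  assumes z: "z > 0"
begin

lemma dmom_range: "0 \<le> dmom n z t \<xi>" "dmom n z t \<xi> \<le> fact n / z ^ n"
  unfolding dmom_def using KS.ev_range[OF damped_nonneg damped_le[OF z]] by auto

lemma dmom_0_range: "dmom 0 z t \<xi> \<in> {0..1}"
  using dmom_range[of 0 t \<xi>] by simp

lemma dmom_empty: "t \<ge> 0 \<Longrightarrow> dmom n z t {#} = (if n = 0 then 1 else 0)"
  by (simp add: dmom_def KS.ev_def K_empty damped_def weight_simps)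

lemma dmom_add:
  assumes t: "t \<ge> 0"
  shows "dmom n z t (\<xi> + \<eta>) = (\<Sum>i\<le>n. real (n choose i) * (dmom i z t \<xi> * dmom (n - i) z t \<eta>))"
proof -
  let ?p = "pair_pmf (K t \<xi>) (K t \<eta>)"
  let ?f = "\<lambda>i (\<xi>', \<eta>'). damped i z \<xi>' * damped (n - i) z \<eta>'"
  have int: "integrable (measure_pmf ?p) (\<lambda>q. real (n choose i) * ?f i q)" for i
  proof (rule measure_pmf.integrable_const_bound[where B = "real (n choose i) * (fact i / z ^ i * (fact (n - i) / z ^ (n - i)))"])
    have bnd: "damped i z \<xi>' * damped (n - i) z \<eta>' \<le> fact i / z ^ i * (fact (n - i) / z ^ (n - i))" for \<xi>' \<eta>'
      using z by (intro mult_mono damped_le damped_nonneg) auto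
    show "AE q in ?p. norm (real (n choose i) * ?f i q) \<le> real (n choose i) * (fact i / z ^ i * (fact (n - i) / z ^ (n - i)))"
    proof (intro AE_pmfI)
      fix q :: "(int ^ 'd) multiset \<times> (int ^ 'd) multiset"
      obtain \<xi>' \<eta>' where q: "q = (\<xi>', \<eta>')" by (cases q)
      have "norm (real (n choose i) * ?f i q) = real (n choose i) * (damped i z \<xi>' * damped (n - i) z \<eta>')"
        using damped_nonneg by (simp add: q abs_mult)
      also have "\<dots> \<le> real (n choose i) * (fact i / z ^ i * (fact (n - i) / z ^ (n - i)))"
        by (rule mult_left_mono[OF bnd]) simp
      finally show "norm (real (n choose i) * ?f i q) \<le> real (n choose i) * (fact i / z ^ i * (fact (n - i) / z ^ (n - i)))" .
    qed
  qed simp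
  have "dmom n z t (\<xi> + \<eta>) = measure_pmf.expectation ?p (\<lambda>(\<xi>', \<eta>'). damped n z (\<xi>' + \<eta>'))"
    unfolding dmom_def KS.ev_def K_independent[OF t] by (simp add: case_prod_unfold)
  also have "\<dots> = measure_pmf.expectation ?p (\<lambda>q. \<Sum>i\<le>n. real (n choose i) * ?f i q)"
    by (simp add: damped_add case_prod_unfold)
  also have "\<dots> = (\<Sum>i\<le>n. measure_pmf.expectation ?p (\<lambda>q. real (n choose i) * ?f i q))"
    by (rule Bochner_Integration.integral_sum) (rule int)
  also have "\<dots> = (\<Sum>i\<le>n. real (n choose i) * measure_pmf.expectation ?p (?f i))" by simp
  also have "\<dots> = (\<Sum>i\<le>n. real (n choose i) * (dmom i z t \<xi> * dmom (n - i) z t \<eta>))"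
    unfolding dmom_def KS.ev_def
    by (simp only: expectation_pair_product[OF damped_nonneg damped_le[OF z] damped_nonneg damped_le[OF z]])
  finally show ?thesis .
qed

lemma dmom_replicate:
  assumes t: "t \<ge> 0"
  shows "dmom n z t (replicate_mset j x) = fact n * fps_nth (Abs_fps (\<lambda>i. dmom i z t {#x#} / fact i) ^ j) n"
proof (induction j arbitrary: n)
  case 0
  then show ?case using t by (simp add: dmom_empty)
next
  case (Suc j)
  let ?\<Phi> = "Abs_fps (\<lambda>i. dmom i z t {#x#} / fact i)"
  have "dmom n z t (replicate_mset (Suc j) x) = dmom n z t ({#x#} + replicate_mset j x)" by simp
  also have "\<dots> = (\<Sum>i\<le>n. real (n choose i) * (dmom i z t {#x#} * (fact (n - i) * fps_nth (?\<Phi> ^ j) (n - i))))"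
    unfolding dmom_add[OF t] Suc.IH ..
  also have "\<dots> = (\<Sum>i\<le>n. fact n * (fps_nth ?\<Phi> i * fps_nth (?\<Phi> ^ j) (n - i)))"
    by (rule sum.cong) (auto simp: binomial_fact)
  also have "\<dots> = fact n * fps_nth (?\<Phi> ^ Suc j) n"
    by (simp add: fps_mult_nth sum_distrib_left atLeast0AtMost)
  finally show ?case .
qed

abbreviation source :: "nat \<Rightarrow> real \<Rightarrow> real" where
  "source n t \<equiv> (\<Sum>r=2..n. gf_taylor b r (dmom 0 z t {#0#}) * comp_sum r n (\<lambda>i. dmom i z t {#0#}))"

abbreviation deficit :: "real \<Rightarrow> real" where
  "deficit t \<equiv> gf_taylor b 1 1 - gf_taylor b 1 (dmom 0 z t {#0#})"

lemma dmom_derivative: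
  assumes n: "n \<ge> 1" and t: "t \<ge> 0"
  shows "((\<lambda>t. dmom n z t {#x#}) has_real_derivative
    W.act (\<lambda>x. dmom n z t {#x#}) x - decay * dmom n z t {#x#}
      + (source n t - deficit t * dmom n z t {#0#}) * indicator {0} x) (at t within {0..})"
proof -
  have b1: "\<bar>dmom n z t {#y#}\<bar> \<le> fact n / z ^ n" for y using dmom_range[of n t "{#y#}"] by simp
  have A: "((\<lambda>j. b j * KS.ev (damped n z) t (replicate_mset j 0)) has_sum
     (gf_taylor b 1 (dmom 0 z t {#0#}) * dmom n z t {#0#} + source n t)) UNIV"
    unfolding dmom_def[symmetric] dmom_replicate[OF t]
    by (rule offspring_expansion[where m = "\<lambda>i. dmom i z t {#0#}", OF _ dmom_0_range n]) simp
  have "((\<lambda>t. dmom n z t {#x#}) has_real_derivative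
     (\<Sum>\<^sub>\<infinity>y. a x y * dmom n z t {#y#}) + (if x = 0 then
        gf_taylor b 1 (dmom 0 z t {#0#}) * dmom n z t {#0#} + source n t
      else b 0 * damped n z {#} - b 0 * dmom n z t {#x#})) (at t within {0..})"
    unfolding dmom_def by (rule ev_backward[OF damped_nonneg damped_le[OF z] t A[unfolded dmom_def]])
  moreover have "damped n z {#} = 0" using n by (simp add: damped_def weight_simps)
  ultimately show ?thesis
    unfolding generator_eq[of "\<lambda>y. dmom n z t {#y#}" _ x, OF b1] kern_act[of "\<lambda>y. dmom n z t {#y#}" _ x, OF b1]
    by (elim DERIV_cong) (auto simp: gf_taylor_1[unfolded One_nat_def] decay_def algebra_simps)
qed

lemma dmom_continuous: "n \<ge> 1 \<Longrightarrow> continuous_on {0..} (\<lambda>t. dmom n z t {#x#})"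
  using dmom_derivative[of n _ x] by (meson DERIV_continuous atLeast_iff continuous_on_eq_continuous_within)

lemma deficit_nonneg: "deficit t \<ge> 0"
  using gf_taylor_mono[OF dmom_0_range, of 1] by simp

lemma source_bounds:
  assumes "\<And>i. 1 \<le> i \<Longrightarrow> i < n \<Longrightarrow> dmom i z t {#0#} \<le> C i"
  shows "0 \<le> source n t" "source n t \<le> g_moment b n C"
proof -
  have cs: "0 \<le> comp_sum r n (\<lambda>i. dmom i z t {#0#})" "comp_sum r n (\<lambda>i. dmom i z t {#0#}) \<le> comp_sum r n C"
    if "r \<ge> 2" for r using that assms dmom_range by (auto intro!: comp_sum_mono)
  show "0 \<le> source n t"
    by (intro sum_nonneg mult_nonneg_nonneg gf_taylor_nonneg dmom_0_range cs) auto
  show "source n t \<le> g_moment b n C"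
    unfolding g_moment_eq
    by (intro sum_mono mult_mono gf_taylor_mono dmom_0_range cs gf_taylor_nonneg) auto
qed

text \<open>Damping makes the derivative of the generating function fall short of its value at \<open>1\<close> by the
  deficit. As this only lowers the moments, the identity bounds them uniformly in \<open>z\<close>, and then \<open>z\<close> may tend
  to \<open>0\<close>.\<close>

lemma dmom_duhamel:
  assumes n: "n \<ge> 1" and T: "T \<ge> 0"
  shows "((\<lambda>s. mean_kernel (T - s) x * (source n s - deficit s * dmom n z s {#0#})) has_integral
    (dmom n z T {#x#} - exp (- decay * T) * W.heat T (\<lambda>x. damped n z {#x#}) x)) {0..T}"
proof -
  let ?M = "fact n / z ^ n"
  let ?\<rho> = "\<lambda>s. exp (decay * s) * (source n s - deficit s * dmom n z s {#0#})"
  define S1 where "S1 = (\<Sum>\<^sub>\<infinity>j. \<bar>b j * real (j choose 1)\<bar>)"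
  have S1: "\<bar>gf_taylor b 1 s\<bar> \<le> S1" if "s \<in> {0..1}" for s
    unfolding S1_def by (rule gf_taylor_abs_le[OF that])
  define Rb where "Rb = g_moment b n (\<lambda>i. fact i / z ^ i) + 2 * S1 * ?M"
  have Rb: "\<bar>source n s - deficit s * dmom n z s {#0#}\<bar> \<le> Rb" for s
  proof -
    have d: "\<bar>deficit s\<bar> \<le> 2 * S1" using S1[of 1] S1[OF dmom_0_range, of s "{#0#}"] by (simp add: abs_le_iff)
    have "\<bar>deficit s * dmom n z s {#0#}\<bar> \<le> 2 * S1 * ?M"
      unfolding abs_mult using d dmom_range[of n s "{#0#}"] by (intro mult_mono) auto
    moreover have "\<bar>source n s\<bar> \<le> g_moment b n (\<lambda>i. fact i / z ^ i)"
      using source_bounds[of n s "\<lambda>i. fact i / z ^ i"] dmom_range by simp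
    ultimately show ?thesis unfolding Rb_def by linarith
  qed
  have e: "exp (decay * s) \<le> exp (decay * T)" if "s \<in> {0..T}" for s
    using that decay_pos by simp
  have "((\<lambda>s. W.heat (T - s) (indicator {0}) x * ?\<rho> s) has_integral
    ((\<lambda>s x. exp (decay * s) * dmom n z s {#x#}) T x - W.heat T ((\<lambda>s x. exp (decay * s) * dmom n z s {#x#}) 0) x)) {0..T}"
  proof (rule W.duhamel[where C = "exp (decay * T) * ?M" and R = "exp (decay * T) * Rb" and H = 1, OF T])
    fix s x assume s: "s \<in> {0..T}"
    have "((\<lambda>s. exp (decay * s) * dmom n z s {#x#}) has_real_derivative
       exp (decay * s) * decay * dmom n z s {#x#} +
       (W.act (\<lambda>x. dmom n z s {#x#}) x - decay * dmom n z s {#x#}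
      + (source n s - deficit s * dmom n z s {#0#}) * indicator {0} x) * exp (decay * s)) (at s within {0..T})"
      by (intro DERIV_mult DERIV_subset[OF dmom_derivative[OF n]]) (use s in \<open>auto intro!: derivative_eq_intros\<close>)
    then show "((\<lambda>s. exp (decay * s) * dmom n z s {#x#}) has_real_derivative
        W.act (\<lambda>x. exp (decay * s) * dmom n z s {#x#}) x + ?\<rho> s * indicator {0} x) (at s within {0..T})"
      unfolding W.act_cmult by (rule DERIV_cong) (simp add: algebra_simps)
    show "\<bar>exp (decay * s) * dmom n z s {#x#}\<bar> \<le> exp (decay * T) * ?M"
      unfolding abs_mult using e[OF s] dmom_range[of n s "{#x#}"] by (intro mult_mono) auto
  next
    fix s assume s: "s \<in> {0..T}"
    show "\<bar>?\<rho> s\<bar> \<le> exp (decay * T) * Rb"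
      unfolding abs_mult using e[OF s] Rb by (intro mult_mono) auto
  qed (rule indicator_le_1)
  then have "((\<lambda>s. W.heat (T - s) (indicator {0}) x * ?\<rho> s) has_integral
      (exp (decay * T) * dmom n z T {#x#} - W.heat T (\<lambda>x. damped n z {#x#}) x)) {0..T}"
    by (simp add: dmom_def KS.ev_0)
  note hi = has_integral_mult_right[OF this, of "exp (- decay * T)"]
  have eT: "exp (- decay * T) * exp (decay * T) = 1" by (simp add: mult_exp_exp)
  have es: "exp (- decay * (T - s)) = exp (- decay * T) * exp (decay * s)" for s
    by (simp add: mult_exp_exp algebra_simps)
  have "(\<lambda>s. mean_kernel (T - s) x * (source n s - deficit s * dmom n z s {#0#}))
      = (\<lambda>s. exp (- decay * T) * (W.heat (T - s) (indicator {0}) x * ?\<rho> s))"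
    unfolding mean_kernel_def es by (rule ext) (simp only: mult.assoc mult.left_commute)
  moreover have "exp (- decay * T) * (exp (decay * T) * dmom n z T {#x#} - W.heat T (\<lambda>x. damped n z {#x#}) x)
      = dmom n z T {#x#} - exp (- decay * T) * W.heat T (\<lambda>x. damped n z {#x#}) x"
    by (simp only: right_diff_distrib mult.assoc[symmetric] eT mult_1)
  ultimately show ?thesis using hi by simp
qed

end

subsection \<open>The moment equations\<close>

text \<open>By induction the source term is bounded through the lower moments; dropping the deficit from the
  identity above leaves a bound that does not involve \<open>z\<close>.\<close>

lemma dmom_uniform_bound:
  assumes "n \<ge> 1" "T \<ge> 0"
  shows "\<exists>C. \<forall>z>0. \<forall>t\<in>{0..T}. \<forall>x. dmom n z t {#x#} \<le> C"
  using assms(1)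
proof (induction n rule: less_induct)
  case (less n)
  then have "\<forall>i\<in>{1..<n}. \<exists>C. \<forall>z>0. \<forall>t\<in>{0..T}. \<forall>x. dmom i z t {#x#} \<le> C" by auto
  then obtain C where C: "\<And>i z t x. i \<in> {1..<n} \<Longrightarrow> z > 0 \<Longrightarrow> t \<in> {0..T} \<Longrightarrow> dmom i z t {#x#} \<le> C i"
    by (metis (no_types) bchoice)
  let ?L = "c + beta_star b"
  have L: "?L \<ge> 0" using c_pos beta_star_nonneg by simp
  define E where "E = exp (T * ?L)"
  have "dmom n z t {#x#} \<le> E + E * max 0 (g_moment b n C) * T" if z: "z > 0" and t: "t \<in> {0..T}" for z t x
  proof -
    have hle: "exp (s * ?L) \<le> E" if "s \<in> {0..T}" for s
      unfolding E_def using that L by (simp add: mult_right_mono)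
    have kle: "mean_kernel s x \<le> E" if "s \<in> {0..T}" for s
    proof -
      have h: "\<bar>W.heat s (indicator {0}) x\<bar> \<le> exp (\<bar>s\<bar> * ?L) * 1" by (rule W.heat_bound[OF indicator_le_1])
      have h0: "0 \<le> W.heat s (indicator {0}) x"
        by (rule W.heat_nonneg[OF _ indicator_le_1]) (use that in auto)
      have "mean_kernel s x \<le> 1 * W.heat s (indicator {0}) x"
        unfolding mean_kernel_def using that decay_pos h0 by (intro mult_right_mono) auto
      then show ?thesis using h hle[OF that] that by simp
    qed
    have ci: "((\<lambda>s. E * max 0 (g_moment b n C)) has_integral (t * (E * max 0 (g_moment b n C)))) {0..t}"
      using has_integral_const_real[of "E * max 0 (g_moment b n C)" 0 t] t by simp
    have "dmom n z t {#x#} - exp (- decay * t) * W.heat t (\<lambda>x. damped n z {#x#}) x \<le> t * (E * max 0 (g_moment b n C))"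
    proof (rule has_integral_le[OF dmom_duhamel[OF z less.prems] ci])
      fix s assume s: "s \<in> {0..t}"
      have "source z n s \<le> g_moment b n C" "deficit z s * dmom n z s {#0#} \<ge> 0"
        using source_bounds[OF z, of n s C] C z s t deficit_nonneg[OF z] dmom_range[OF z] by auto
      then have "source z n s - deficit z s * dmom n z s {#0#} \<le> max 0 (g_moment b n C)" by linarith
      then have "mean_kernel (t - s) x * (source z n s - deficit z s * dmom n z s {#0#}) \<le> mean_kernel (t - s) x * max 0 (g_moment b n C)"
        using s by (intro mult_left_mono mean_kernel_nonneg) auto
      also have "\<dots> \<le> E * max 0 (g_moment b n C)"
        using s t by (intro mult_right_mono kle) auto
      finally show "mean_kernel (t - s) x * (source z n s - deficit z s * dmom n z s {#0#}) \<le> E * max 0 (g_moment b n C)" .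
    qed (use t in auto)
    moreover have "exp (- decay * t) * W.heat t (\<lambda>x. damped n z {#x#}) x \<le> E"
    proof -
      have d: "\<bar>damped n z {#x#}\<bar> \<le> 1" for x using damped_single[OF less.prems, of z x] w01[of x] z by auto
      have h: "\<bar>W.heat t (\<lambda>x. damped n z {#x#}) x\<bar> \<le> exp (\<bar>t\<bar> * ?L) * 1" by (rule W.heat_bound[OF d])
      have "exp (- decay * t) * W.heat t (\<lambda>x. damped n z {#x#}) x \<le> exp (- decay * t) * \<bar>W.heat t (\<lambda>x. damped n z {#x#}) x\<bar>"
        by (intro mult_left_mono) auto
      also have "\<dots> \<le> 1 * \<bar>W.heat t (\<lambda>x. damped n z {#x#}) x\<bar>"
        using t decay_pos by (intro mult_right_mono) auto
      finally show ?thesis using h hle[OF t] t by simp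
    qed
    moreover have "t * (E * max 0 (g_moment b n C)) \<le> T * (E * max 0 (g_moment b n C))"
      using t by (intro mult_right_mono) (auto simp: E_def)
    ultimately show ?thesis by (simp add: algebra_simps)
  qed
  then show ?case by blast
qed

text \<open>Monotone convergence: the uniform bound makes the limit finite, hence the moment itself.\<close>

lemma mom_limit:
  assumes t: "t \<ge> 0"
  shows "integrable (measure_pmf (K t {#x#})) (\<lambda>\<xi>. weight \<xi> ^ n)"
    and "(\<lambda>k. dmom n (1 / real (Suc k)) t {#x#}) \<longlonglongrightarrow> mom n t x"
    and "dmom n (1 / real (Suc k)) t {#x#} \<le> mom n t x"
proof -
  let ?z = "\<lambda>k. 1 / real (Suc k)"
  have zpos: "?z k > 0" for k by simp
  have bound: "\<exists>C. \<forall>k. dmom n (?z k) t {#x#} \<le> C"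
  proof (cases "n = 0")
    case True
    then show ?thesis using dmom_0_range[OF zpos] by (intro exI[of _ 1]) simp
  next
    case False
    then obtain C where "\<forall>z>0. \<forall>t'\<in>{0..t}. \<forall>x. dmom n z t' {#x#} \<le> C"
      using dmom_uniform_bound[of n t] t by auto
    then show ?thesis using t zpos by (intro exI[of _ C]) auto
  qed
  have intk: "integrable (measure_pmf (K t {#x#})) (damped n (?z k))" for k
    by (rule KS.ev_integrable[OF damped_nonneg damped_le[OF zpos]])
  have mono: "damped n (?z k) \<xi> \<le> damped n (?z l) \<xi>" if "k \<le> l" for k l \<xi>
  proof -
    have "weight \<xi> / real (Suc l) \<le> weight \<xi> / real (Suc k)"
      using that weight_nonneg[of \<xi>] by (intro divide_left_mono) auto
    then show ?thesis unfolding damped_def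
      by (intro mult_left_mono) (auto simp: weight_nonneg)
  qed
  have inc: "incseq (\<lambda>k. dmom n (?z k) t {#x#})"
    unfolding dmom_def KS.ev_def by (intro incseq_SucI integral_mono intk mono) simp
  obtain L where L: "(\<lambda>k. dmom n (?z k) t {#x#}) \<longlonglongrightarrow> L"
    using bound incseq_convergent[OF inc] by metis
  have lim: "(\<lambda>k. damped n (?z k) \<xi>) \<longlonglongrightarrow> weight \<xi> ^ n" for \<xi>
  proof -
    have "?z \<longlonglongrightarrow> 0" using LIMSEQ_inverse_real_of_nat by (simp add: inverse_eq_divide)
    then have "(\<lambda>k. weight \<xi> ^ n * exp (- ?z k * weight \<xi>)) \<longlonglongrightarrow> weight \<xi> ^ n * exp (- 0 * weight \<xi>)"
      by (intro tendsto_intros)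
    then show ?thesis by (simp add: damped_def)
  qed
  have "AE \<xi> in measure_pmf (K t {#x#}). mono (\<lambda>k. damped n (?z k) \<xi>)"
    by (intro AE_pmfI monoI mono)
  note mc = intk this AE_pmfI[of "K t {#x#}", OF lim] L[unfolded dmom_def KS.ev_def]
  show "integrable (measure_pmf (K t {#x#})) (\<lambda>\<xi>. weight \<xi> ^ n)"
    by (rule integrable_monotone_convergence[OF mc]) simp
  have "mom n t x = L" unfolding mom_def
    by (rule integral_monotone_convergence[OF mc]) simp
  then show lim': "(\<lambda>k. dmom n (?z k) t {#x#}) \<longlonglongrightarrow> mom n t x" using L by simp
  show "dmom n (?z k) t {#x#} \<le> mom n t x" by (rule incseq_le[OF inc lim'])
qed

lemma mom_nonneg: "mom n t x \<ge> 0"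
  unfolding mom_def by (intro integral_nonneg_AE AE_pmfI) (simp add: weight_nonneg)

lemma mom_bounded:
  assumes "n \<ge> 1" "T \<ge> 0"
  shows "\<exists>C. \<forall>t\<in>{0..T}. \<forall>x. mom n t x \<le> C"
proof -
  obtain C where C: "\<And>z t x. z > 0 \<Longrightarrow> t \<in> {0..T} \<Longrightarrow> dmom n z t {#x#} \<le> C"
    using dmom_uniform_bound[OF assms] by blast
  have "mom n t x \<le> C" if "t \<in> {0..T}" for t x
    by (rule LIMSEQ_le_const2[OF mom_limit(2)]) (use that C in auto)
  then show ?thesis by blast
qed

lemma mom_measurable:
  assumes "n \<ge> 1"
  shows "(\<lambda>t. indicator {0..} t * mom n t x) \<in> borel_measurable borel"
proof (rule borel_measurable_LIMSEQ_real)
  fix t :: real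
  show "(\<lambda>k. indicator {0..} t * dmom n (1 / real (Suc k)) t {#x#}) \<longlonglongrightarrow> indicator {0..} t * mom n t x"
    using mom_limit(2)[of t n x] by (cases "t \<ge> 0") simp_all
next
  fix k
  have "continuous_on {0..} (\<lambda>t. dmom n (1 / real (Suc k)) t {#x#})"
    by (rule dmom_continuous[OF _ assms]) simp
  then have "(\<lambda>t. indicator {0..} t *\<^sub>R dmom n (1 / real (Suc k)) t {#x#}) \<in> borel_measurable borel"
    by (rule borel_measurable_continuous_on_indicator[rotated]) simp
  then show "(\<lambda>t. indicator {0..} t * dmom n (1 / real (Suc k)) t {#x#}) \<in> borel_measurable borel" by simp
qed

text \<open>As \<open>z\<close> tends to \<open>0\<close>, the damped moment of order \<open>0\<close> tends to \<open>1\<close>, so the deficit disappears and the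
  coefficients of the source become those of \<open>g\<^sub>n\<close>.\<close>

theorem moment_equation:
  assumes n: "n \<ge> 1" and T: "T \<ge> 0"
  shows "((\<lambda>s. mean_kernel (T - s) x * g_moment b n (\<lambda>i. mom i s 0)) has_integral
    (mom n T x - exp (- decay * T) * W.heat T w x)) {0..T}"
proof -
  let ?z = "\<lambda>k. 1 / real (Suc k)"
  have zpos: "?z k > 0" for k by simp
  let ?L = "c + beta_star b"
  have "\<forall>i\<in>{1..n}. \<exists>C. \<forall>t\<in>{0..T}. \<forall>x. mom i t x \<le> C" using mom_bounded[OF _ T] by auto
  then obtain C where C: "\<And>i t x. i \<in> {1..n} \<Longrightarrow> t \<in> {0..T} \<Longrightarrow> mom i t x \<le> C i"
    by (metis (no_types) bchoice)
  define f where "f k s = mean_kernel (T - s) x * (source (?z k) n s - deficit (?z k) s * dmom n (?z k) s {#0#})" for k s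
  define S1 where "S1 = (\<Sum>\<^sub>\<infinity>j. \<bar>b j * real (j choose 1)\<bar>)"
  have S1: "\<bar>gf_taylor b 1 s\<bar> \<le> S1" if "s \<in> {0..1}" for s
    unfolding S1_def by (rule gf_taylor_abs_le[OF that])
  define Rb where "Rb = g_moment b n C + 2 * S1 * C n"
  define Kb where "Kb = exp (\<bar>beta_star b - b 0\<bar> * T)"
  have bound: "\<bar>f k s\<bar> \<le> Kb * Rb" if s: "s \<in> {0..T}" for k s
  proof -
    have dC: "dmom i (?z k) s {#0#} \<le> C i" if "i \<in> {1..n}" for i
      using order_trans[OF mom_limit(3) C[OF that s]] s by simp
    have d: "\<bar>deficit (?z k) s\<bar> \<le> 2 * S1" using S1[of 1] S1[OF dmom_0_range[OF zpos], of k s "{#0#}"] by (simp add: abs_le_iff)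
    have "\<bar>deficit (?z k) s * dmom n (?z k) s {#0#}\<bar> \<le> 2 * S1 * C n"
      unfolding abs_mult using d dmom_range(1)[OF zpos, of n k s "{#0#}"] dC[of n] n by (intro mult_mono) auto
    moreover have "\<bar>source (?z k) n s\<bar> \<le> g_moment b n C"
      using source_bounds[OF zpos, of n k s C] dC by simp
    ultimately have 1: "\<bar>source (?z k) n s - deficit (?z k) s * dmom n (?z k) s {#0#}\<bar> \<le> Rb" unfolding Rb_def by linarith
    have "mean_kernel (T - s) x \<le> exp ((beta_star b - b 0) * (T - s))"
      by (rule mean_kernel_le) (use s in simp)
    also have "\<dots> \<le> Kb" unfolding Kb_def
    proof (subst exp_le_cancel_iff)
      have "(beta_star b - b 0) * (T - s) \<le> \<bar>beta_star b - b 0\<bar> * (T - s)" using s by (intro mult_right_mono) auto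
      also have "\<dots> \<le> \<bar>beta_star b - b 0\<bar> * T" using s by (intro mult_left_mono) auto
      finally show "(beta_star b - b 0) * (T - s) \<le> \<bar>beta_star b - b 0\<bar> * T" .
    qed
    finally have 2: "\<bar>mean_kernel (T - s) x\<bar> \<le> Kb" using mean_kernel_nonneg[of "T - s" x] s by simp
    show ?thesis unfolding f_def abs_mult by (rule mult_mono[OF 2 1]) (auto simp: Kb_def)
  qed
  have lim: "(\<lambda>k. f k s) \<longlonglongrightarrow> mean_kernel (T - s) x * g_moment b n (\<lambda>i. mom i s 0)" if s: "s \<in> {0..T}" for s
  proof -
    have m: "(\<lambda>k. dmom i (?z k) s {#0#}) \<longlonglongrightarrow> mom i s 0" for i
      by (rule mom_limit(2)) (use s in simp)
    have m0: "mom 0 s 0 = 1" by (simp add: mom_def)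
    have F: "(\<lambda>k. gf_taylor b r (dmom 0 (?z k) s {#0#})) \<longlonglongrightarrow> gf_taylor b r 1" for r
      by (rule gf_taylor_tendsto) (use m[of 0] m0 dmom_0_range[OF zpos] in auto)
    have "(\<lambda>k. mean_kernel (T - s) x * (source (?z k) n s - deficit (?z k) s * dmom n (?z k) s {#0#}))
      \<longlonglongrightarrow> mean_kernel (T - s) x * ((\<Sum>r=2..n. gf_taylor b r 1 * comp_sum r n (\<lambda>i. mom i s 0))
         - (gf_taylor b 1 1 - gf_taylor b 1 1) * mom n s 0)"
      by (intro tendsto_mult tendsto_const tendsto_diff tendsto_sum F m comp_sum_tendsto) auto
    then show ?thesis by (simp add: f_def[abs_def] g_moment_eq)
  qed
  have hi: "(f k has_integral (dmom n (?z k) T {#x#} - exp (- decay * T) * W.heat T (\<lambda>x. damped n (?z k) {#x#}) x)) {0..T}" for k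
    unfolding f_def[abs_def] by (rule dmom_duhamel[OF zpos n T])
  have *: "(\<lambda>s. mean_kernel (T - s) x * g_moment b n (\<lambda>i. mom i s 0)) integrable_on {0..T}"
    "(\<lambda>k. integral {0..T} (f k)) \<longlonglongrightarrow> integral {0..T} (\<lambda>s. mean_kernel (T - s) x * g_moment b n (\<lambda>i. mom i s 0))"
    using dominated_convergence[of f "{0..T}" "\<lambda>_. Kb * Rb" "\<lambda>s. mean_kernel (T - s) x * g_moment b n (\<lambda>i. mom i s 0)"]
      hi bound lim by (auto intro: integrable_const_ivl)
  have heat_lim: "(\<lambda>k. W.heat T (\<lambda>x. damped n (?z k) {#x#}) x) \<longlonglongrightarrow> W.heat T w x"
  proof -
    have d: "\<bar>damped n (?z k) {#y#}\<bar> \<le> 1" for k y using damped_single[OF n, of "?z k" y] w01[of y] by auto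
    have h1: "(\<lambda>y. \<bar>W.heat T (indicator {x}) y\<bar>) summable_on UNIV"
      by (rule W.heat_l1(1)[OF indicator_l1 indicator_le_1])
    have "(\<lambda>k. \<Sum>\<^sub>\<infinity>y. W.heat T (indicator {x}) y * damped n (?z k) {#y#}) \<longlonglongrightarrow> (\<Sum>\<^sub>\<infinity>y. W.heat T (indicator {x}) y * w y)"
    proof (rule tendsto_infsum_dominated[OF h1])
      show "\<forall>\<^sub>F k in sequentially. \<forall>y\<in>UNIV. \<bar>W.heat T (indicator {x}) y * damped n (?z k) {#y#}\<bar> \<le> \<bar>W.heat T (indicator {x}) y\<bar>"
        using d mult_left_mono[OF d, of "\<bar>W.heat T (indicator {x}) _\<bar>"] by (auto simp: abs_mult)
      show "(\<lambda>k. W.heat T (indicator {x}) y * damped n (?z k) {#y#}) \<longlonglongrightarrow> W.heat T (indicator {x}) y * w y" for y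
      proof -
        have "?z \<longlonglongrightarrow> 0" using LIMSEQ_inverse_real_of_nat by (simp add: inverse_eq_divide)
        then have "(\<lambda>k. w y * exp (- ?z k * w y)) \<longlonglongrightarrow> w y * exp (- 0 * w y)" by (intro tendsto_intros)
        then show ?thesis by (intro tendsto_mult tendsto_const) (simp add: damped_single[OF n])
      qed
    qed
    moreover have "(\<Sum>\<^sub>\<infinity>y. W.heat T (indicator {x}) y * damped n (?z k) {#y#}) = W.heat T (\<lambda>y. damped n (?z k) {#y#}) x" for k
      by (rule W.heat_kernel_pairing(2)) (rule d)
    moreover have "(\<Sum>\<^sub>\<infinity>y. W.heat T (indicator {x}) y * w y) = W.heat T w x"
      by (rule W.heat_kernel_pairing(2)) (rule w_abs)
    ultimately show ?thesis by (simp only:)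
  qed
  have "(\<lambda>k. integral {0..T} (f k)) \<longlonglongrightarrow> mom n T x - exp (- decay * T) * W.heat T w x"
    unfolding integral_unique[OF hi] by (intro tendsto_intros heat_lim mom_limit(2) T)
  from LIMSEQ_unique[OF *(2) this] show ?thesis using *(1) by (simp add: has_integral_integrable_integral)
qed

end
end

section \<open>Exponential growth of convolutions\<close>

lemma exp_integral:
  assumes "k > (0::real)"
  shows "integrable lborel (\<lambda>r. indicator {0..} r * exp (- k * r))"
    and "(LINT r|lborel. indicator {0..} r * exp (- k * r)) = 1 / k"
proof -
  have "(\<integral>\<^sup>+r. ennreal (indicator {0..} r * exp (- k * r)) \<partial>lborel)
      = (\<integral>\<^sup>+t\<in>{0..}. ennreal (exp (- k * t) * (t ^ 0 / fact 0)) \<partial>lborel)"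
    by (rule nn_integral_cong) (simp add: indicator_def)
  also have "\<dots> = ennreal (1 / k)" by (simp only: nn_integral_power_exp[OF assms] power_Suc0_right)
  finally have n: "(\<integral>\<^sup>+r. ennreal (indicator {0..} r * exp (- k * r)) \<partial>lborel) = ennreal (1 / k)" .
  show "integrable lborel (\<lambda>r. indicator {0..} r * exp (- k * r))"
    by (rule integrableI_nonneg) (use n in auto)
  show "(LINT r|lborel. indicator {0..} r * exp (- k * r)) = 1 / k"
    by (rule integral_eq_nn_integral[THEN trans]) (use n assms in auto)
qed

lemma exp_decay_tendsto_0:
  assumes "k > (0::real)"
  shows "((\<lambda>t. exp (- k * t)) \<longlongrightarrow> 0) at_top"
  by (rule filterlim_compose[OF exp_at_bot])
    (rule filterlim_tendsto_neg_mult_at_bot[OF tendsto_const _ filterlim_ident], use assms in simp)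

text \<open>After multiplication by \<open>exp (- \<rho> T)\<close> the convolution becomes the integral of
  \<open>exp (- \<rho> r) * k r\<close> against the translate \<open>exp (- \<rho> (T - r)) * h (T - r)\<close>, which is bounded and tends to
  \<open>g\<close> for every \<open>r\<close>.\<close>

lemma convolution_asymptotics:
  fixes k h I :: "real \<Rightarrow> real"
  assumes km: "k \<in> borel_measurable borel" and k0: "\<And>r. r \<ge> 0 \<Longrightarrow> k r \<ge> 0"
    and kint: "integrable lborel (\<lambda>r. indicator {0..} r * (exp (- \<rho> * r) * k r))"
    and hm: "(\<lambda>s. indicator {0..} s * h s) \<in> borel_measurable borel"
    and hb: "\<And>T. T \<ge> 0 \<Longrightarrow> \<exists>C. \<forall>s\<in>{0..T}. \<bar>h s\<bar> \<le> C"
    and hl: "((\<lambda>s. exp (- \<rho> * s) * h s) \<longlongrightarrow> g) at_top"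
    and conv: "\<And>T. T \<ge> 0 \<Longrightarrow> ((\<lambda>s. k (T - s) * h s) has_integral I T) {0..T}"
  shows "((\<lambda>T. exp (- \<rho> * T) * I T) \<longlongrightarrow>
    g * (LINT r|lborel. indicator {0..} r * (exp (- \<rho> * r) * k r))) at_top"
proof -
  define H where "H s = exp (- \<rho> * s) * (indicator {0..} s * h s)" for s
  define \<kappa> where "\<kappa> r = indicator {0..} r * (exp (- \<rho> * r) * k r)" for r
  define F where "F T r = \<kappa> r * H (T - r)" for T r
  have \<kappa>0: "\<kappa> r \<ge> 0" for r using k0[of r] by (simp add: \<kappa>_def indicator_def)
  have Hm: "H \<in> borel_measurable borel" unfolding H_def[abs_def] using hm by measurable
  have \<kappa>i: "integrable lborel \<kappa>" using kint by (simp add: \<kappa>_def[abs_def])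
  have \<kappa>m: "\<kappa> \<in> borel_measurable borel" unfolding \<kappa>_def[abs_def] using km by measurable
  have Fm: "F T \<in> borel_measurable borel" for T
  proof -
    have "(\<lambda>r. H (T - r)) \<in> borel_measurable borel" using Hm by measurable
    then show ?thesis unfolding F_def[abs_def] using \<kappa>m by measurable
  qed
  have Hl: "(H \<longlongrightarrow> g) at_top"
    by (rule Lim_transform_eventually[OF hl])
      (rule eventually_mono[OF eventually_ge_at_top[of "0::real"]], simp add: H_def)
  obtain M where M: "\<And>s. \<bar>H s\<bar> \<le> M"
  proof -
    have "\<forall>\<^sub>F s in at_top. dist (H s) g < 1" using Hl by (rule tendstoD) simp
    then obtain S where S: "\<And>s. s \<ge> S \<Longrightarrow> dist (H s) g < 1" by (auto simp: eventually_at_top_linorder)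
    define S' where "S' = max S 0"
    have "S' \<ge> 0" by (simp add: S'_def)
    from hb[OF this] obtain C where C: "\<forall>s\<in>{0..S'}. \<bar>h s\<bar> \<le> C" by blast
    have "\<bar>H s\<bar> \<le> \<bar>g\<bar> + 1 + exp (\<bar>\<rho>\<bar> * S') * \<bar>C\<bar>" for s
    proof (cases "s \<in> {0..S'}")
      case True
      have "- \<rho> * s \<le> \<bar>\<rho>\<bar> * s" using True by (intro mult_right_mono) auto
      also have "\<dots> \<le> \<bar>\<rho>\<bar> * S'" using True by (intro mult_left_mono) auto
      finally have e: "exp (- \<rho> * s) \<le> exp (\<bar>\<rho>\<bar> * S')" by simp
      have "\<bar>H s\<bar> = exp (- \<rho> * s) * \<bar>h s\<bar>" using True by (simp add: H_def abs_mult)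
      also have "\<dots> \<le> exp (\<bar>\<rho>\<bar> * S') * \<bar>C\<bar>" using e bspec[OF C True] by (intro mult_mono) auto
      finally show ?thesis by simp
    next
      case False
      have nn: "exp (\<bar>\<rho>\<bar> * S') * \<bar>C\<bar> \<ge> 0" by simp
      show ?thesis
      proof (cases "s < 0")
        case True
        then have "H s = 0" by (simp add: H_def)
        then show ?thesis using nn by linarith
      next
        case s: False
        then have "dist (H s) g < 1" using False S[of s] by (auto simp: S'_def)
        then show ?thesis using nn unfolding dist_real_def by linarith
      qed
    qed
    then show ?thesis using that by blast
  qed
  have bound: "norm (F T r) \<le> \<kappa> r * M" for T r
    unfolding F_def using M \<kappa>0 by (simp add: abs_mult mult_left_mono)
  have Fi: "integrable lborel (F T)" for T
    by (rule Bochner_Integration.integrable_bound[OF integrable_mult_left[OF \<kappa>i, of M]])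
      (use Fm order_trans[OF bound abs_ge_self] in \<open>auto intro!: AE_I2\<close>)
  have "((\<lambda>T. LINT r|lborel. F T r) \<longlongrightarrow> (LINT r|lborel. \<kappa> r * g)) at_top"
  proof (rule integral_dominated_convergence_at_top[where w = "\<lambda>r. \<kappa> r * M"])
    show "AE r in lborel. ((\<lambda>T. F T r) \<longlongrightarrow> \<kappa> r * g) at_top"
    proof (rule AE_I2)
      fix r :: real
      have "filterlim (\<lambda>T. - r + T) at_top at_top"
        by (rule filterlim_tendsto_add_at_top[OF tendsto_const filterlim_ident])
      then have "filterlim (\<lambda>T. T - r) at_top at_top" by (simp add: add.commute)
      then show "((\<lambda>T. F T r) \<longlongrightarrow> \<kappa> r * g) at_top"
        unfolding F_def by (intro tendsto_mult tendsto_const filterlim_compose[OF Hl])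
    qed
    show "\<forall>\<^sub>F T in at_top. AE r in lborel. norm (F T r) \<le> \<kappa> r * M"
      by (intro always_eventually allI AE_I2 bound)
  qed (use \<kappa>i \<kappa>m Fm in auto)
  also have "(LINT r|lborel. \<kappa> r * g) = g * (LINT r|lborel. \<kappa> r)" by simp
  finally have lim: "((\<lambda>T. LINT r|lborel. F T r) \<longlongrightarrow> g * (LINT r|lborel. \<kappa> r)) at_top" .
  have eq: "(LINT r|lborel. F T r) = exp (- \<rho> * T) * I T" if T: "T \<ge> 0" for T
  proof -
    have aff: "(LINT r|lborel. F T r) = (LINT s|lborel. F T (T + (-1) * s))"
      using lborel_integral_real_affine[of "-1" "F T" T] by simp
    have "integrable lborel (\<lambda>s. F T (T + (-1) * s))"
      by (rule lborel_integrable_real_affine[OF Fi]) simp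
    then have "((\<lambda>s. F T (T + (-1) * s)) has_integral (LINT s|lborel. F T (T + (-1) * s))) UNIV"
      by (rule has_integral_integral_lborel)
    moreover have "F T (T + (-1) * s) = (if s \<in> {0..T} then exp (- \<rho> * T) * (k (T - s) * h s) else 0)" for s
    proof -
      have "exp (- \<rho> * (T - s)) * exp (- \<rho> * s) = exp (- \<rho> * T)" by (simp add: mult_exp_exp algebra_simps)
      then show ?thesis by (auto simp: F_def \<kappa>_def H_def indicator_def ac_simps)
    qed
    ultimately have "((\<lambda>s. exp (- \<rho> * T) * (k (T - s) * h s)) has_integral (LINT s|lborel. F T (T + (-1) * s))) {0..T}"
      by (simp only: has_integral_restrict_UNIV)
    moreover have "((\<lambda>s. exp (- \<rho> * T) * (k (T - s) * h s)) has_integral (exp (- \<rho> * T) * I T)) {0..T}"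
      by (rule has_integral_mult_right[OF conv[OF T]])
    ultimately show ?thesis using aff has_integral_unique by metis
  qed
  show ?thesis
    unfolding \<kappa>_def[symmetric]
    by (rule Lim_transform_eventually[OF lim])
      (rule eventually_mono[OF eventually_ge_at_top[of "0::real"]], rule eq)
qed

lemma asymp_equivI_exp:
  assumes "((\<lambda>t. exp (- \<rho> * t) * f t) \<longlongrightarrow> C) at_top" "C > (0::real)"
  shows "f \<sim>[at_top] (\<lambda>t. C * exp (\<rho> * t))"
proof (rule asymp_equivI')
  have "((\<lambda>t. (exp (- \<rho> * t) * f t) / C) \<longlongrightarrow> C / C) at_top"
    using assms by (intro tendsto_intros) auto
  then show "((\<lambda>t. f t / (C * exp (\<rho> * t))) \<longlongrightarrow> 1) at_top"
    using assms(2) by (simp add: exp_minus field_simps)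
qed

lemma comp_sum_scale: "comp_sum r n (\<lambda>i. q ^ i * m i) = q ^ n * comp_sum r n m"
proof -
  have "prod_list (map (\<lambda>i. q ^ i * m i) is) = q ^ sum_list is * prod_list (map m is)" for "is"
    by (induction "is") (auto simp: power_add)
  then show ?thesis
    unfolding comp_sum_def sum_distrib_left
    by (intro sum.cong) (auto simp: compositions_def)
qed

lemma comp_sum_measurable:
  assumes "\<And>i. i \<ge> 1 \<Longrightarrow> (\<lambda>s. m s i) \<in> borel_measurable M"
  shows "(\<lambda>s. comp_sum r n (m s)) \<in> borel_measurable M"
proof -
  have "(\<lambda>s. prod_list (map (m s) is)) \<in> borel_measurable M" if "\<forall>i\<in>set is. i \<ge> 1" for "is"
    using that by (induction "is") (auto intro!: borel_measurable_times assms)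
  then show ?thesis
    unfolding comp_sum_def
    by (intro borel_measurable_sum borel_measurable_times borel_measurable_const)
      (auto simp: compositions_def Suc_le_eq)
qed

lemma comp_sum_2_pos:
  assumes "n \<ge> 2" "\<And>i. 1 \<le> i \<Longrightarrow> i < n \<Longrightarrow> m i > 0"
  shows "comp_sum 2 n m > 0"
proof -
  have pos: "prod_list (map m is) > 0" if "is \<in> compositions 2 n" for "is"
  proof -
    have "\<And>i. i \<in> set is \<Longrightarrow> m i > 0" using composition_parts[OF that] assms(2) by auto
    then show ?thesis by (induction "is") auto
  qed
  have f: "prod_list (map fact is) > (0::real)" for "is" :: "nat list"
    by (induction "is") auto
  have "[1, n - 1] \<in> compositions 2 n" using assms by (auto simp: compositions_def)
  then show ?thesis
    unfolding comp_sum_def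
    by (intro sum_pos finite_compositions mult_pos_pos divide_pos_pos f pos) auto
qed

section \<open>Asymptotics of the moments\<close>

context branching_random_walk
begin

lemma kern_eigenfunction:
  assumes l: "l > 0" "beta_star b * g0 l = 1"
  shows "W.act (res l (indicator {0})) = (\<lambda>x. (l + c) * res l (indicator {0}) x)"
proof
  fix x
  have "W.act (res l (indicator {0})) x
      = J.act (res l (indicator {0})) x + beta_star b * g0 l * indicator {0} x"
    by (rule kern_act) (rule res_bound[OF l(1) indicator_le_1])
  then show "W.act (res l (indicator {0})) x = (l + c) * res l (indicator {0}) x"
    using l(2) act_res[of l "indicator {0}" 1 x, OF l(1) indicator_le_1] by simp
qed

text \<open>Uniqueness holds among all bounded functions, square-summable or not: this is what identifies the
  limit in the ergodic theorem.\<close>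

lemma kern_eigenfunction_unique:
  assumes l: "l > 0" and g: "\<And>x. \<bar>g x\<bar> \<le> C" and eq: "W.act g = (\<lambda>x. (l + c) * g x)"
  shows "g = (\<lambda>x. beta_star b * g 0 * res l (indicator {0}) x)"
proof
  fix x
  have "g x = res l (\<lambda>x. beta_star b * g 0 * indicator {0} x) x"
  proof (rule res_unique[OF l g])
    show "\<bar>beta_star b * g 0 * indicator {0} x\<bar> \<le> \<bar>beta_star b * g 0\<bar>" for x :: "int ^ 'd"
      by (simp add: indicator_def)
    show "J.act g x = (l + c) * g x - beta_star b * g 0 * indicator {0} x" for x
      using kern_act[of g C x, OF g] fun_cong[OF eq, of x] by simp
  qed
  then show "g x = beta_star b * g 0 * res l (indicator {0}) x"
    using res_cmult[OF l, of "indicator {0}" 1] by (simp add: indicator_le_1)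
qed

context
  assumes super: "beta_star b > 0" "beta_star b > beta_crit p"
    and growth: "lambdaE a b > 0"
begin

abbreviation l0 :: real where "l0 \<equiv> lambda0 a b"
abbreviation lE :: real where "lE \<equiv> lambdaE a b"
abbreviation \<psi> :: "int ^ 'd \<Rightarrow> real" where "\<psi> \<equiv> res l0 (indicator {0})"
abbreviation nrm :: real where "nrm \<equiv> (\<Sum>\<^sub>\<infinity>z. (\<psi> z)\<^sup>2)"

lemmas l0 = lambda0_characterization[OF super]

lemma psi_pos: "\<psi> x > 0"
  by (rule res_positive[OF l0(1)])

lemma nrm_pos: "nrm > 0"
proof -
  have "\<psi> \<in> l2" by (rule res_l2[OF l0(1) l2_indicator])
  then have "(\<psi> 0)\<^sup>2 \<le> nrm"
    using infsum_mono2[of "\<lambda>x. (\<psi> x)\<^sup>2" "{0}" UNIV] by (simp add: l2_def)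
  then show ?thesis using psi_pos[of 0] zero_less_power[of "\<psi> 0" 2] by linarith
qed

lemma heat_limit:
  "((\<lambda>t. exp (- (l0 + c) * t) * W.heat t (indicator {y}) x) \<longlongrightarrow> \<psi> x * \<psi> y / nrm) at_top"
proof (rule W.heat_ergodic)
  show "W.act \<psi> = (\<lambda>x. (l0 + c) * \<psi> x)" by (rule kern_eigenfunction[OF l0])
  show "\<psi> summable_on UNIV" by (rule res_l1[OF l0(1)])
  show "\<exists>\<kappa>. g = (\<lambda>x. \<kappa> * \<psi> x)" if "\<And>x. \<bar>g x\<bar> \<le> C" "W.act g = (\<lambda>x. (l0 + c) * g x)" for g C
    using kern_eigenfunction_unique[OF l0(1) that] by blast
qed (rule psi_pos)

lemma mean_limit:
  "((\<lambda>t. exp (- lE * t) * (exp (- decay * t) * W.heat t f x)) \<longlongrightarrow> L) at_top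
    \<longleftrightarrow> ((\<lambda>t. exp (- (l0 + c) * t) * W.heat t f x) \<longlongrightarrow> L) at_top"
proof -
  have "exp (- lE * t) * exp (- decay * t) = exp (- (l0 + c) * t)" for t
    by (simp add: mult_exp_exp lambdaE_def decay_def algebra_simps)
  then have "exp (- lE * t) * (exp (- decay * t) * W.heat t f x) = exp (- (l0 + c) * t) * W.heat t f x" for t
    by (simp only: mult.assoc[symmetric])
  then show ?thesis by (simp only:)
qed

text \<open>Summed over all targets, the mean solves \<open>v' = c v + \<beta> heat t \<delta>\<^sub>0\<close>, because the walk conserves
  mass; so it grows like the integral of the return kernel.\<close>

lemma heat_one_limit:
  "((\<lambda>t. exp (- (l0 + c) * t) * W.heat t (\<lambda>_. 1) x) \<longlongrightarrow> \<psi> x / (l0 * nrm)) at_top"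
proof -
  have act1: "W.act (\<lambda>_. 1) = (\<lambda>y. c * 1 + beta_star b * indicator {0} y)"
    by (rule ext) (simp add: W.act_def infsumI[OF kern_has_sum])
  have der: "((\<lambda>t. exp (- c * t) * W.heat t (\<lambda>_. 1) x) has_real_derivative
      exp (- c * t) * (beta_star b * W.heat t (indicator {0}) x)) (at t within S)" for t S
  proof -
    have "W.heat t (W.act (\<lambda>_. 1)) x = W.heat t (\<lambda>y. c * 1) x + W.heat t (\<lambda>y. beta_star b * indicator {0} y) x"
      unfolding act1
      by (rule W.heat_add_fun[where C = c and D = "beta_star b"])
        (use c_pos super in \<open>auto simp: indicator_def\<close>)
    also have "\<dots> = c * W.heat t (\<lambda>_. 1) x + beta_star b * W.heat t (indicator {0}) x"
    proof -
      have "W.heat t (\<lambda>y. c * 1) x = c * W.heat t (\<lambda>_. 1) x"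
        by (rule W.heat_cmult[where C = 1]) simp
      moreover have "W.heat t (\<lambda>y. beta_star b * indicator {0} y) x = beta_star b * W.heat t (indicator {0}) x"
        by (rule W.heat_cmult[where C = 1]) (rule indicator_le_1)
      ultimately show ?thesis by simp
    qed
    finally have h: "W.heat t (W.act (\<lambda>_. 1)) x = c * W.heat t (\<lambda>_. 1) x + beta_star b * W.heat t (indicator {0}) x" .
    have "((\<lambda>t. exp (- c * t) * W.heat t (\<lambda>_. 1) x) has_real_derivative
      exp (- c * t) * (- c) * W.heat t (\<lambda>_. 1) x + W.heat t (W.act (\<lambda>_. 1)) x * exp (- c * t)) (at t within S)"
      by (intro DERIV_mult W.heat_has_derivative[where C = 1]) (auto intro!: derivative_eq_intros)
    then show ?thesis unfolding h by (rule DERIV_cong) (simp add: algebra_simps)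
  qed
  define I where "I T = W.heat T (\<lambda>_. 1) x - exp (c * T)" for T
  have conv: "((\<lambda>s. exp (c * (T - s)) * (beta_star b * W.heat s (indicator {0}) x)) has_integral I T) {0..T}"
    if T: "T \<ge> 0" for T
  proof -
    have "((\<lambda>s. exp (- c * s) * (beta_star b * W.heat s (indicator {0}) x)) has_integral
        (exp (- c * T) * W.heat T (\<lambda>_. 1) x - exp (- c * 0) * W.heat 0 (\<lambda>_. 1) x)) {0..T}"
      by (rule fundamental_theorem_of_calculus[OF T])
        (use der in \<open>simp add: has_real_derivative_iff_has_vector_derivative\<close>)
    from has_integral_mult_right[OF this, of "exp (c * T)"]
    have hi: "((\<lambda>s. exp (c * T) * (exp (- c * s) * (beta_star b * W.heat s (indicator {0}) x))) has_integral
       (exp (c * T) * (exp (- c * T) * W.heat T (\<lambda>_. 1) x - exp (- c * 0) * W.heat 0 (\<lambda>_. 1) x))) {0..T}" .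
    have "exp (c * T) * exp (- c * s) = exp (c * (T - s))" for s by (simp add: mult_exp_exp algebra_simps)
    then have 1: "exp (c * T) * (exp (- c * s) * u) = exp (c * (T - s)) * u" for s u
      by (simp only: mult.assoc[symmetric])
    have 2: "exp (c * T) * (exp (- c * T) * W.heat T (\<lambda>_. 1) x - exp (- c * 0) * W.heat 0 (\<lambda>_. 1) x) = I T"
      unfolding right_diff_distrib 1 by (simp add: I_def W.heat_0)
    show ?thesis using hi unfolding 1 2[unfolded right_diff_distrib 1, folded right_diff_distrib] 2 by simp
  qed
  have k: "integrable lborel (\<lambda>r. indicator {0..} r * (exp (- (l0 + c) * r) * exp (c * r)))"
    "(LINT r|lborel. indicator {0..} r * (exp (- (l0 + c) * r) * exp (c * r))) = 1 / l0"
    using exp_integral[OF l0(1)] by (simp_all add: mult_exp_exp algebra_simps)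
  have "((\<lambda>T. exp (- (l0 + c) * T) * I T) \<longlongrightarrow> (beta_star b * (\<psi> x * \<psi> 0 / nrm)) *
      (LINT r|lborel. indicator {0..} r * (exp (- (l0 + c) * r) * exp (c * r)))) at_top"
  proof (rule convolution_asymptotics[OF _ _ k(1) _ _ _ conv])
    have cont: "continuous_on S (\<lambda>s. beta_star b * W.heat s (indicator {0}) x)" for S
      by (intro continuous_intros W.heat_continuous[OF indicator_le_1])
    then have "(\<lambda>s. beta_star b * W.heat s (indicator {0}) x) \<in> borel_measurable borel"
      by (rule borel_measurable_continuous_onI)
    then show "(\<lambda>s. indicator {0..} s * (beta_star b * W.heat s (indicator {0}) x)) \<in> borel_measurable borel"
      by measurable
    show "\<exists>C. \<forall>s\<in>{0..T}. \<bar>beta_star b * W.heat s (indicator {0}) x\<bar> \<le> C" for T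
    proof -
      have "bounded ((\<lambda>s. beta_star b * W.heat s (indicator {0}) x) ` {0..T})"
        by (rule compact_imp_bounded[OF compact_continuous_image[OF cont compact_Icc]])
      then show ?thesis by (auto simp: bounded_iff)
    qed
    have "((\<lambda>s. beta_star b * (exp (- (l0 + c) * s) * W.heat s (indicator {0}) x)) \<longlongrightarrow> beta_star b * (\<psi> x * \<psi> 0 / nrm)) at_top"
      by (intro tendsto_mult tendsto_const heat_limit)
    then show "((\<lambda>s. exp (- (l0 + c) * s) * (beta_star b * W.heat s (indicator {0}) x)) \<longlongrightarrow> beta_star b * (\<psi> x * \<psi> 0 / nrm)) at_top"
      by (simp only: mult.left_commute)
  qed auto
  also have "(beta_star b * (\<psi> x * \<psi> 0 / nrm)) * (LINT r|lborel. indicator {0..} r * (exp (- (l0 + c) * r) * exp (c * r)))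
      = (beta_star b * \<psi> 0) * \<psi> x / (l0 * nrm)"
    unfolding k(2) by (simp add: ac_simps)
  finally have lim: "((\<lambda>T. exp (- (l0 + c) * T) * I T) \<longlongrightarrow> \<psi> x / (l0 * nrm)) at_top"
    using l0(2) by simp
  have "((\<lambda>T. exp (- l0 * T)) \<longlongrightarrow> 0) at_top"
    by (rule exp_decay_tendsto_0[OF l0(1)])
  from tendsto_add[OF lim this] show ?thesis
  proof (rule filterlim_cong[OF refl refl, THEN iffD1, rotated, THEN back_subst[of "\<lambda>u. filterlim _ (nhds u) _"]])
    show "\<forall>\<^sub>F T in at_top. exp (- (l0 + c) * T) * I T + exp (- l0 * T) = exp (- (l0 + c) * T) * W.heat T (\<lambda>_. 1) x"
      by (rule always_eventually) (simp add: I_def right_diff_distrib mult_exp_exp algebra_simps)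
  qed simp
qed

subsection \<open>Higher moments\<close>

text \<open>The resolvent of the evolution operator at \<open>n lE\<close>, applied to \<open>\<delta>\<^sub>0\<close>. For \<open>n \<le> 1\<close> the integral
  diverges.\<close>

definition D :: "nat \<Rightarrow> int ^ 'd \<Rightarrow> real" where
  "D n x = (LINT r|lborel. indicator {0..} r * (exp (- (real n * lE) * r) * mean_kernel r x))"

lemma mean_kernel_limit: "((\<lambda>t. exp (- lE * t) * mean_kernel t x) \<longlongrightarrow> \<psi> x * \<psi> 0 / nrm) at_top"
  unfolding mean_kernel_def mean_limit by (rule heat_limit)

lemma mean_kernel_measurable: "(\<lambda>t. mean_kernel t x) \<in> borel_measurable borel"
  by (rule borel_measurable_continuous_onI[OF mean_kernel_continuous])

lemma D_integrable:
  assumes n: "n \<ge> 2"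
  shows "integrable lborel (\<lambda>r. indicator {0..} r * (exp (- (real n * lE) * r) * mean_kernel r x))"
proof -
  let ?q = "\<lambda>t. exp (- lE * t) * mean_kernel t x"
  have "\<forall>\<^sub>F s in at_top. dist (?q s) (\<psi> x * \<psi> 0 / nrm) < 1" by (rule tendstoD[OF mean_kernel_limit]) simp
  then obtain S where S: "\<And>s. s \<ge> S \<Longrightarrow> dist (?q s) (\<psi> x * \<psi> 0 / nrm) < 1" by (auto simp: eventually_at_top_linorder)
  have "bounded (?q ` {0..S})"
    by (intro compact_imp_bounded compact_continuous_image compact_Icc continuous_intros mean_kernel_continuous)
  then obtain C where C: "\<forall>s\<in>{0..S}. \<bar>?q s\<bar> \<le> C" by (auto simp: bounded_iff)
  define M where "M = \<bar>C\<bar> + \<bar>\<psi> x * \<psi> 0 / nrm\<bar> + 1"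
  have M: "\<bar>?q s\<bar> \<le> M" if "s \<ge> 0" for s
  proof (cases "s \<le> S")
    case True
    then have "\<bar>?q s\<bar> \<le> C" using C that by simp
    then show ?thesis unfolding M_def by linarith
  next
    case False
    then have "dist (?q s) (\<psi> x * \<psi> 0 / nrm) < 1" using S[of s] by simp
    then show ?thesis unfolding M_def dist_real_def by linarith
  qed
  have "integrable lborel (\<lambda>r. M * (indicator {0..} r * exp (- lE * r)))"
    by (rule integrable_mult_right[OF exp_integral(1)[OF growth]])
  then show ?thesis
  proof (rule Bochner_Integration.integrable_bound)
    show "(\<lambda>r. indicator {0..} r * (exp (- (real n * lE) * r) * mean_kernel r x)) \<in> borel_measurable lborel"
      using mean_kernel_measurable by measurable
    show "AE r in lborel. norm (indicator {0..} r * (exp (- (real n * lE) * r) * mean_kernel r x))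
        \<le> norm (M * (indicator {0..} r * exp (- lE * r)))"
    proof (rule AE_I2)
      fix r :: real
      show "norm (indicator {0..} r * (exp (- (real n * lE) * r) * mean_kernel r x))
        \<le> norm (M * (indicator {0..} r * exp (- lE * r)))"
      proof (cases "r \<ge> 0")
        case True
        \<comment> \<open>one factor compensates the growth of the kernel, the other one is integrable\<close>
        have "exp (- (real n * lE) * r) \<le> exp (- lE * r) * exp (- lE * r)"
        proof -
          have "2 * (lE * r) \<le> real n * (lE * r)" using n True growth by (intro mult_right_mono) auto
          then have "exp (- (real n * (lE * r))) \<le> exp (- (2 * (lE * r)))" by simp
          moreover have "exp (- lE * r) * exp (- lE * r) = exp (- (2 * (lE * r)))"
            unfolding mult_exp_exp by (simp add: algebra_simps)
          moreover have "exp (- (real n * lE) * r) = exp (- (real n * (lE * r)))"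
            by (simp add: mult.assoc)
          ultimately show ?thesis by (simp only:)
        qed
        then have "exp (- (real n * lE) * r) * \<bar>mean_kernel r x\<bar> \<le> exp (- lE * r) * exp (- lE * r) * \<bar>mean_kernel r x\<bar>"
          by (rule mult_right_mono) simp
        also have "\<dots> = exp (- lE * r) * \<bar>?q r\<bar>" by (simp add: abs_mult)
        also have "\<dots> \<le> exp (- lE * r) * M" by (intro mult_left_mono M True) simp
        finally show ?thesis using True by (simp add: abs_mult M_def mult.commute)
      qed simp
    qed
  qed
qed

text \<open>By the limit theorem the kernel is eventually positive.\<close>

lemma D_pos:
  assumes n: "n \<ge> 2"
  shows "D n x > 0"
proof -
  let ?f = "\<lambda>r. indicator {0..} r * (exp (- (real n * lE) * r) * mean_kernel r x)"
  have f0: "?f r \<ge> 0" for r using mean_kernel_nonneg[of r x] by (simp add: indicator_def)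
  have "D n x \<ge> 0" unfolding D_def by (intro integral_nonneg_AE AE_I2 f0)
  moreover have "D n x \<noteq> 0"
  proof
    assume "D n x = 0"
    then have "AE r in lborel. ?f r = 0"
      unfolding D_def using integral_nonneg_eq_0_iff_AE[OF D_integrable[OF n]] f0 by simp
    have "0 < \<psi> x * \<psi> 0 / nrm" using psi_pos nrm_pos by simp
    from order_tendstoD(1)[OF mean_kernel_limit this]
    obtain R where R: "\<And>r. r \<ge> R \<Longrightarrow> 0 < exp (- lE * r) * mean_kernel r x"
      by (auto simp: eventually_at_top_linorder)
    define R' where "R' = max R 0"
    have pos: "?f r \<noteq> 0" if "r \<in> {R'..R' + 1}" for r
      using R[of r] that by (auto simp: R'_def zero_less_mult_iff)
    from \<open>AE r in lborel. ?f r = 0\<close> have "AE r in lborel. r \<notin> {R'..R' + 1}"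
      by eventually_elim (use pos in blast)
    then have "emeasure lborel {R'..R' + 1} = 0"
      by (subst (asm) AE_iff_measurable[where N = "{R'..R' + 1}"]) (auto simp del: emeasure_lborel_Icc)
    then show False by simp
  qed
  ultimately show ?thesis by simp
qed

text \<open>The kernel grows at most like \<open>exp (\<beta> r)\<close>, which costs at most half of the exponent \<open>n lE\<close> once
  \<open>n lE \<ge> 2 \<beta>\<close>.\<close>

lemma D_bound:
  assumes n: "n \<ge> 2" "real n * lE \<ge> 2 * beta_star b"
  shows "\<bar>D n x\<bar> \<le> 2 / (real n * lE)"
proof -
  let ?k = "real n * lE / 2"
  have k: "?k > 0" using n growth by simp
  have "D n x \<le> (LINT r|lborel. indicator {0..} r * exp (- ?k * r))"
    unfolding D_def
  proof (rule integral_mono[OF D_integrable[OF n(1)] exp_integral(1)[OF k]])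
    fix r :: real
    show "indicator {0..} r * (exp (- (real n * lE) * r) * mean_kernel r x) \<le> indicator {0..} r * exp (- ?k * r)"
    proof (cases "r \<ge> 0")
      case True
      have "exp (- (real n * lE) * r) * mean_kernel r x \<le> exp (- (real n * lE) * r) * exp ((beta_star b - b 0) * r)"
        by (intro mult_left_mono mean_kernel_le True) simp
      also have "\<dots> = exp ((beta_star b - b 0 - real n * lE) * r)" by (simp add: mult_exp_exp algebra_simps)
      also have "\<dots> \<le> exp (- ?k * r)"
      proof -
        have "beta_star b - b 0 - real n * lE \<le> - ?k" using n(2) b_nonneg[of 0] by simp
        then show ?thesis using True by (simp only: exp_le_cancel_iff mult_right_mono)
      qed
      finally show ?thesis using True by simp
    qed simp
  qed
  also have "\<dots> = 2 / (real n * lE)" unfolding exp_integral(2)[OF k] by simp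
  finally show ?thesis using D_pos[OF n(1), of x] by simp
qed

context
  fixes w :: "int ^ 'd \<Rightarrow> real" and C1 :: "int ^ 'd \<Rightarrow> real"
  assumes w01: "\<And>x. w x = 0 \<or> w x = 1"
    and C1: "\<And>x. ((\<lambda>t. exp (- (l0 + c) * t) * W.heat t w x) \<longlongrightarrow> C1 x) at_top" "\<And>x. C1 x > 0"
begin

text \<open>Taking the limits themselves as the constants avoids a definition by recursion; the recursion is
  proved together with convergence.\<close>

definition growth_const :: "nat \<Rightarrow> int ^ 'd \<Rightarrow> real" where
  "growth_const n x = Lim at_top (\<lambda>t. exp (- (real n * lE) * t) * mom w n t x)"

lemma mom_1: "t \<ge> 0 \<Longrightarrow> mom w 1 t x = exp (- decay * t) * W.heat t w x"
proof -
  assume t: "t \<ge> 0"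
  have "((\<lambda>s. 0::real) has_integral (mom w 1 t x - exp (- decay * t) * W.heat t w x)) {0..t}"
    using moment_equation[OF w01, of 1 t x] t by (simp add: g_moment_def)
  then show ?thesis using has_integral_unique[OF has_integral_0] by force
qed

lemma mom_1_limit: "((\<lambda>t. exp (- lE * t) * mom w 1 t x) \<longlongrightarrow> C1 x) at_top"
proof -
  have "((\<lambda>t. exp (- lE * t) * (exp (- decay * t) * W.heat t w x)) \<longlongrightarrow> C1 x) at_top"
    unfolding mean_limit by (rule C1(1))
  then show ?thesis
    by (rule Lim_transform_eventually)
      (rule eventually_mono[OF eventually_ge_at_top[of "0::real"]], simp only: mom_1)
qed

text \<open>The source term of the moment equation is homogeneous of degree \<open>n\<close>, so it
  grows like \<open>exp (n * lE * t)\<close> as soon as the lower moments have their expected growth, while the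
  kernel grows like \<open>exp (lE * t)\<close> only: the convolution lemma applies.\<close>

lemma growth_step:
  assumes n: "n \<ge> 2"
    and low: "\<And>i. 1 \<le> i \<Longrightarrow> i < n \<Longrightarrow> ((\<lambda>t. exp (- (real i * lE) * t) * mom w i t 0) \<longlongrightarrow> A i) at_top"
  shows "((\<lambda>t. exp (- (real n * lE) * t) * mom w n t x) \<longlongrightarrow> g_moment b n A * D n x) at_top"
proof -
  define h where "h s = g_moment b n (\<lambda>i. mom w i s 0)" for s
  define I where "I T = mom w n T x - exp (- decay * T) * W.heat T w x" for T
  have "((\<lambda>T. exp (- (real n * lE) * T) * I T) \<longlongrightarrow> g_moment b n A * D n x) at_top"
    unfolding D_def
  proof (rule convolution_asymptotics[where h = h])
    show "(\<lambda>r. mean_kernel r x) \<in> borel_measurable borel" by (rule mean_kernel_measurable)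
    show "mean_kernel r x \<ge> 0" if "r \<ge> 0" for r by (rule mean_kernel_nonneg[OF that])
    show "integrable lborel (\<lambda>r. indicator {0..} r * (exp (- (real n * lE) * r) * mean_kernel r x))"
      by (rule D_integrable[OF n])
    show "((\<lambda>s. mean_kernel (T - s) x * h s) has_integral I T) {0..T}" if "T \<ge> 0" for T
      unfolding h_def I_def using moment_equation[OF w01, of n T x] n that by simp
    have ind: "indicator {0..} s ^ i = (indicator {0..} s :: real)" if "i \<ge> 1" for i and s :: real
      using that by (simp add: indicator_def)
    have "(\<lambda>s. indicator {0..} s * h s) = (\<lambda>s. \<Sum>r=2..n. gf_taylor b r 1 * comp_sum r n (\<lambda>i. indicator {0..} s ^ i * mom w i s 0))"
      unfolding comp_sum_scale h_def g_moment_eq sum_distrib_left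
      by (rule ext, rule sum.cong) (use ind[of n] n in \<open>auto simp: ac_simps\<close>)
    also have "\<dots> \<in> borel_measurable borel"
    proof (intro borel_measurable_sum borel_measurable_times[OF borel_measurable_const comp_sum_measurable])
      fix i :: nat assume i: "i \<ge> 1"
      show "(\<lambda>s. indicator {0..} s ^ i * mom w i s 0) \<in> borel_measurable borel"
        unfolding ind[OF i] by (rule mom_measurable[OF w01 i])
    qed
    finally show "(\<lambda>s. indicator {0..} s * h s) \<in> borel_measurable borel" .
    show "\<exists>C. \<forall>s\<in>{0..T}. \<bar>h s\<bar> \<le> C" if T: "T \<ge> 0" for T
    proof -
      have "\<forall>i\<in>{1..<n}. \<exists>C. \<forall>t\<in>{0..T}. \<forall>x. mom w i t x \<le> C" using mom_bounded[OF w01 _ T] by auto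
      then obtain C where C: "\<And>i t x. i \<in> {1..<n} \<Longrightarrow> t \<in> {0..T} \<Longrightarrow> mom w i t x \<le> C i"
        by (metis (no_types) bchoice)
      have "\<bar>h s\<bar> \<le> g_moment b n C" if s: "s \<in> {0..T}" for s
      proof -
        have cs: "0 \<le> comp_sum r n (\<lambda>i. mom w i s 0)" "comp_sum r n (\<lambda>i. mom w i s 0) \<le> comp_sum r n C"
          if "r \<ge> 2" for r using that C s mom_nonneg[OF w01] by (auto intro!: comp_sum_mono)
        have "0 \<le> h s" unfolding h_def g_moment_eq
          by (intro sum_nonneg mult_nonneg_nonneg gf_taylor_nonneg cs) auto
        moreover have "h s \<le> g_moment b n C" unfolding h_def g_moment_eq
          by (intro sum_mono mult_left_mono gf_taylor_nonneg cs) auto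
        ultimately show ?thesis by simp
      qed
      then show ?thesis by blast
    qed
    have "exp (- (real n * lE) * s) * h s = (\<Sum>r=2..n. gf_taylor b r 1 * comp_sum r n (\<lambda>i. exp (- lE * s) ^ i * mom w i s 0))" for s
      unfolding comp_sum_scale h_def g_moment_eq sum_distrib_left
      by (rule sum.cong) (simp_all add: exp_of_nat_mult[symmetric] ac_simps)
    moreover have "((\<lambda>s. \<Sum>r=2..n. gf_taylor b r 1 * comp_sum r n (\<lambda>i. exp (- lE * s) ^ i * mom w i s 0)) \<longlongrightarrow> g_moment b n A) at_top"
      unfolding g_moment_eq
    proof (intro tendsto_sum tendsto_mult tendsto_const comp_sum_tendsto)
      fix i assume "1 \<le> i" "i < n"
      from low[OF this] show "((\<lambda>s. exp (- lE * s) ^ i * mom w i s 0) \<longlongrightarrow> A i) at_top"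
        by (simp add: exp_of_nat_mult[symmetric] ac_simps)
    qed auto
    ultimately show "((\<lambda>s. exp (- (real n * lE) * s) * h s) \<longlongrightarrow> g_moment b n A) at_top" by simp
  qed
  moreover have "((\<lambda>T. exp (- (real n * lE) * T) * (exp (- decay * T) * W.heat T w x)) \<longlongrightarrow> 0) at_top"
  proof -
    have "((\<lambda>T. exp (- ((real n - 1) * lE) * T)) \<longlongrightarrow> 0) at_top"
    proof -
      have "(real n - 1) * lE > 0" using n growth by simp
      then show ?thesis by (rule exp_decay_tendsto_0)
    qed
    moreover have "((\<lambda>t. exp (- lE * t) * (exp (- decay * t) * W.heat t w x)) \<longlongrightarrow> C1 x) at_top"
      unfolding mean_limit by (rule C1(1))
    ultimately have "((\<lambda>T. exp (- ((real n - 1) * lE) * T) * (exp (- lE * T) * (exp (- decay * T) * W.heat T w x))) \<longlongrightarrow> 0 * C1 x) at_top"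
      by (rule tendsto_mult)
    moreover have "exp (- ((real n - 1) * lE) * T) * exp (- lE * T) = exp (- (real n * lE) * T)" for T
      by (simp add: mult_exp_exp algebra_simps)
    ultimately show ?thesis by (simp add: mult.assoc[symmetric])
  qed
  ultimately have "((\<lambda>T. exp (- (real n * lE) * T) * I T + exp (- (real n * lE) * T) * (exp (- decay * T) * W.heat T w x))
      \<longlongrightarrow> g_moment b n A * D n x + 0) at_top"
    by (rule tendsto_add)
  then show ?thesis by (simp add: I_def right_diff_distrib)
qed

theorem moment_growth:
  shows "n \<ge> 1 \<Longrightarrow> ((\<lambda>t. exp (- (real n * lE) * t) * mom w n t x) \<longlongrightarrow> growth_const n x) at_top"
    and "growth_const 1 x = C1 x"
    and "n \<ge> 2 \<Longrightarrow> growth_const n x = g_moment b n (\<lambda>k. growth_const k 0) * D n x"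
    and "n \<ge> 1 \<Longrightarrow> growth_const n x > 0"
proof -
  have L: "growth_const n x = l" if "((\<lambda>t. exp (- (real n * lE) * t) * mom w n t x) \<longlongrightarrow> l) at_top" for n x l
    unfolding growth_const_def using that by (intro tendsto_Lim) auto
  have one: "((\<lambda>t. exp (- (real 1 * lE) * t) * mom w 1 t x) \<longlongrightarrow> C1 x) at_top" for x
    using mom_1_limit by simp
  show g1: "growth_const 1 x = C1 x" for x by (rule L[OF one])
  have main: "((\<lambda>t. exp (- (real n * lE) * t) * mom w n t x) \<longlongrightarrow> growth_const n x) at_top \<and> growth_const n x > 0
      \<and> (n \<ge> 2 \<longrightarrow> growth_const n x = g_moment b n (\<lambda>k. growth_const k 0) * D n x)"
    if "n \<ge> 1" for n x
    using that
  proof (induction n arbitrary: x rule: less_induct)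
    case (less n)
    show ?case
    proof (cases "n = 1")
      case True
      then show ?thesis using one[of x] g1[of x] C1(2)[of x] by simp
    next
      case False
      with less.prems have n: "n \<ge> 2" by simp
      have "((\<lambda>t. exp (- (real n * lE) * t) * mom w n t x) \<longlongrightarrow> g_moment b n (\<lambda>k. growth_const k 0) * D n x) at_top"
        by (rule growth_step[OF n]) (use less.IH in blast)
      moreover from L[OF this] have eq: "growth_const n x = g_moment b n (\<lambda>k. growth_const k 0) * D n x" .
      moreover have "g_moment b n (\<lambda>k. growth_const k 0) > 0"
      proof -
        have pos: "growth_const i 0 > 0" if "1 \<le> i" "i < n" for i using less.IH[OF that(2,1)] by blast
        have "0 < gf_taylor b 2 1 * comp_sum 2 n (\<lambda>k. growth_const k 0)"
          by (intro mult_pos_pos gf_taylor_2_pos super(1) comp_sum_2_pos n pos)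
        also have "\<dots> = (\<Sum>r\<in>{2}. gf_taylor b r 1 * comp_sum r n (\<lambda>k. growth_const k 0))" by simp
        also have "\<dots> \<le> g_moment b n (\<lambda>k. growth_const k 0)"
          unfolding g_moment_eq
        proof (rule sum_mono2)
          fix r assume "r \<in> {2..n} - {2}"
          then have "r \<ge> 2" by simp
          then show "0 \<le> gf_taylor b r 1 * comp_sum r n (\<lambda>k. growth_const k 0)"
            using pos by (intro mult_nonneg_nonneg gf_taylor_nonneg comp_sum_mono(1)[where l = "\<lambda>k. growth_const k 0"])
              (auto intro: less_imp_le)
        qed (use n in auto)
        finally show ?thesis .
      qed
      ultimately show ?thesis using D_pos[OF n, of x] by simp
    qed
  qed
  show "n \<ge> 1 \<Longrightarrow> ((\<lambda>t. exp (- (real n * lE) * t) * mom w n t x) \<longlongrightarrow> growth_const n x) at_top"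
    "n \<ge> 2 \<Longrightarrow> growth_const n x = g_moment b n (\<lambda>k. growth_const k 0) * D n x"
    "n \<ge> 1 \<Longrightarrow> growth_const n x > 0"
    using main[of n x] by auto
qed

end
end
end

section \<open>Moments of the process\<close>

lemma countable_multisets: "countable (UNIV :: 'a::countable multiset set)"
proof -
  have "surj (mset :: 'a list \<Rightarrow> _)" unfolding surj_def by (metis ex_mset)
  moreover have "countable (range (mset :: 'a list \<Rightarrow> _))" by (rule countable_image[OF countableI_type])
  ultimately show ?thesis by simp
qed

context branching_random_walk
begin

text \<open>The law of the state at one time is fixed by its values on single states, since there are
  countably many of them.\<close>

lemma expectation_eq:
  assumes t: "t \<ge> 0"
  shows "integral\<^sup>L (M x) (\<lambda>\<omega>. f (X t \<omega>)) = measure_pmf.expectation (K t {#x#}) (f :: _ \<Rightarrow> real)"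
proof -
  interpret prob_space "M x" by (rule M_prob)
  note X [measurable] = X_measurable[OF t, of x]
  have "distr (M x) (count_space UNIV) (X t) = measure_pmf (K t {#x#})"
  proof (rule measure_eqI_countable[where A = UNIV])
    fix \<xi> :: "(int ^ 'd) multiset"
    have "emeasure (distr (M x) (count_space UNIV) (X t)) {\<xi>} = emeasure (M x) (X t -` {\<xi>} \<inter> space (M x))"
      by (rule emeasure_distr[OF X]) simp
    also have "X t -` {\<xi>} \<inter> space (M x) = {w \<in> space (M x). \<forall>(t, \<eta>)\<in>set [(t, \<xi>)]. X t w = \<eta>}" by auto
    also have "emeasure (M x) \<dots> = ennreal (path_prob K 0 {#x#} [(t, \<xi>)])"
      unfolding emeasure_eq_measure by (subst X_law) (use t in auto)
    also have "\<dots> = emeasure (measure_pmf (K t {#x#})) {\<xi>}" by (simp add: emeasure_pmf_single)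
    finally show "emeasure (distr (M x) (count_space UNIV) (X t)) {\<xi>} = emeasure (measure_pmf (K t {#x#})) {\<xi>}" .
  qed (simp_all add: countable_multisets)
  then have "measure_pmf.expectation (K t {#x#}) f = integral\<^sup>L (distr (M x) (count_space UNIV) (X t)) f" by simp
  also have "\<dots> = integral\<^sup>L (M x) (\<lambda>\<omega>. f (X t \<omega>))" by (rule integral_distr[OF X]) simp
  finally show ?thesis by simp
qed

lemma local_moment_eq:
  assumes "t \<ge> 0"
  shows "local_moment M X n t x y = mom (indicator {y}) n t x"
proof -
  have "weight (indicator {y}) \<xi> = real (count \<xi> y)" for \<xi>
    by (induction \<xi>) (auto simp: weight_def indicator_def)
  moreover have "indicat_real {y} x = 0 \<or> indicat_real {y} x = 1" for x by (simp add: indicator_def)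
  note m = mom_def[of _ n t x, OF this]
  ultimately show ?thesis
    unfolding local_moment_def using expectation_eq[OF assms, of x "\<lambda>\<xi>. real (count \<xi> y) ^ n"] by (simp add: m)
qed

lemma total_moment_eq:
  assumes "t \<ge> 0"
  shows "total_moment M X n t x = mom (\<lambda>_. 1) n t x"
proof -
  have "weight (\<lambda>_. 1) \<xi> = real (size \<xi>)" for \<xi>
    by (induction \<xi>) (auto simp: weight_def)
  moreover have "(\<lambda>_. 1 :: real) x = 0 \<or> (\<lambda>_. 1 :: real) x = 1" for x :: "int ^ 'd" by simp
  note m = mom_def[of _ n t x, OF this]
  ultimately show ?thesis
    unfolding total_moment_def using expectation_eq[OF assms, of x "\<lambda>\<xi>. real (size \<xi>) ^ n"] by (simp add: m)
qed

lemma moments_asymptotic: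
  assumes super: "beta_star b > 0" "beta_star b > beta_crit p" and growth: "lambdaE a b > 0"
    and w01: "\<And>x. w x = 0 \<or> w x = 1"
    and C1: "\<And>x. ((\<lambda>t. exp (- (lambda0 a b + c) * t) * W.heat t w x) \<longlongrightarrow> C1 x) at_top" "\<And>x. C1 x > 0"
    and n: "n \<ge> 1" and f: "\<And>t. t \<ge> 0 \<Longrightarrow> f t = mom w n t x"
  shows "f \<sim>[at_top] (\<lambda>t. growth_const w n x * exp (real n * lambdaE a b * t))"
proof (rule asymp_equivI_exp)
  note g = moment_growth[OF super growth w01 C1]
  show "((\<lambda>t. exp (- (real n * lambdaE a b) * t) * f t) \<longlongrightarrow> growth_const w n x) at_top"
    by (rule Lim_transform_eventually[OF g(1)[OF n]])
      (rule eventually_mono[OF eventually_ge_at_top[of "0::real"]], simp only: f)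
  show "growth_const w n x > 0" by (rule g(4)[OF n])
qed

end

theorem theorem5p1:
  fixes a :: "int ^ 'd::finite \<Rightarrow> int ^ 'd \<Rightarrow> real"
    and p :: "real \<Rightarrow> int ^ 'd \<Rightarrow> (int ^ 'd) pmf"
    and b :: "nat \<Rightarrow> real"
    and K :: "real \<Rightarrow> (int ^ 'd) multiset \<Rightarrow> (int ^ 'd) multiset pmf"
    and M :: "int ^ 'd \<Rightarrow> 'w measure"
    and X :: "real \<Rightarrow> 'w \<Rightarrow> (int ^ 'd) multiset"
  assumes "branching_random_walk a p b K M X"
    and "beta_star b > 0"
    and "beta_star b > beta_crit p"
    and "lambdaE a b > 0"
  shows "\<exists>(D :: nat \<Rightarrow> int ^ 'd \<Rightarrow> real)
            (C :: nat \<Rightarrow> int ^ 'd \<Rightarrow> int ^ 'd \<Rightarrow> real)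
            (Ctot :: nat \<Rightarrow> int ^ 'd \<Rightarrow> real).
      (\<forall>x y. C 1 x y = green_real p (lambda0 a b) x 0 * green_real p (lambda0 a b) 0 y
                        / (l2_norm (green_real p (lambda0 a b) 0))\<^sup>2) \<and>
      (\<forall>x. Ctot 1 x = green_real p (lambda0 a b) x 0
                        / (lambda0 a b * (l2_norm (green_real p (lambda0 a b) 0))\<^sup>2)) \<and>
      (\<forall>n\<ge>2. \<forall>x y. C n x y = g_moment b n (\<lambda>k. C k 0 y) * D n x \<and> C n x y > 0) \<and>
      (\<forall>n\<ge>2. \<forall>x. Ctot n x = g_moment b n (\<lambda>k. Ctot k 0) * D n x \<and> Ctot n x > 0) \<and>
      (\<exists>nstar::nat. \<forall>n\<ge>nstar. \<forall>x. \<bar>D n x\<bar> \<le> 2 / (real n * lambdaE a b)) \<and>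
      (\<forall>n\<ge>1. \<forall>x y. (\<lambda>t. local_moment M X n t x y)
                        \<sim>[at_top] (\<lambda>t. C n x y * exp (real n * lambdaE a b * t))) \<and>
      (\<forall>n\<ge>1. \<forall>x. (\<lambda>t. total_moment M X n t x)
                        \<sim>[at_top] (\<lambda>t. Ctot n x * exp (real n * lambdaE a b * t)))"
proof -
  interpret branching_random_walk a p b K M X by (rule assms(1))
  note super = assms(2,3) and growth = assms(4)
  let ?l = "lambda0 a b" and ?G = "green_real p (lambda0 a b)"
  note l = lambda0_characterization[OF super]
  have G: "?G x 0 = res ?l (indicator {0}) x" "?G 0 x = res ?l (indicator {0}) x" for x
    using green_real_eq_res[OF l(1)] res_symmetric[OF l(1), of x 0] by simp_all
  have nrm: "(l2_norm (?G 0))\<^sup>2 = (\<Sum>\<^sub>\<infinity>z. (res ?l (indicator {0}) z)\<^sup>2)"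
    by (simp add: l2_norm_def G infsum_nonneg)
  define N where "N = (\<Sum>\<^sub>\<infinity>z. (res ?l (indicator {0}) z)\<^sup>2)"
  have N: "N > 0" unfolding N_def by (rule nrm_pos[OF super growth])
  have pos: "res ?l (indicator {0}) x > 0" for x by (rule res_positive[OF l(1)])
  let ?C1 = "\<lambda>x y. res ?l (indicator {0}) x * res ?l (indicator {0}) y / N"
  let ?T1 = "\<lambda>x. res ?l (indicator {0}) x / (?l * N)"
  have ind: "indicat_real {y} x = 0 \<or> indicat_real {y} x = 1" for x y :: "int ^ 'd"
    by (simp add: indicator_def)
  have one: "(\<lambda>_. 1 :: real) x = 0 \<or> (\<lambda>_. 1 :: real) x = 1" for x :: "int ^ 'd" by simp
  have lim_local: "((\<lambda>t. exp (- (?l + c) * t) * W.heat t (indicator {y}) x) \<longlongrightarrow> ?C1 x y) at_top" for x y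
    unfolding N_def by (rule heat_limit[OF super growth])
  have lim_total: "((\<lambda>t. exp (- (?l + c) * t) * W.heat t (\<lambda>_. 1) x) \<longlongrightarrow> ?T1 x) at_top" for x
    unfolding N_def by (rule heat_one_limit[OF super growth])
  have C1_pos: "?C1 x y > 0" and T1_pos: "?T1 x > 0" for x y
    using pos N l(1) by simp_all
  note gl = moment_growth[OF super growth ind lim_local C1_pos]
  note gt = moment_growth[OF super growth one lim_total T1_pos]
  define C where "C n x y = growth_const (indicator {y}) n x" for n x y
  define T where "T n x = growth_const (\<lambda>_. 1) n x" for n x
  \<comment> \<open>the index from which the bound on \<open>D\<close> applies\<close>
  obtain m :: nat where m: "2 * beta_star b < real m * lambdaE a b"
    using reals_Archimedean3[OF growth] by blast
  have bound: "\<bar>D n x\<bar> \<le> 2 / (real n * lambdaE a b)" if "n \<ge> max 2 m" for n x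
  proof (rule D_bound[OF super growth])
    have "real m * lambdaE a b \<le> real n * lambdaE a b" using that growth by (intro mult_right_mono) auto
    then show "real n * lambdaE a b \<ge> 2 * beta_star b" using m by simp
  qed (use that in simp)
  show ?thesis
  proof (rule exI[of _ D], rule exI[of _ C], rule exI[of _ T], intro conjI)
    show "\<forall>x y. C 1 x y = ?G x 0 * ?G 0 y / (l2_norm (?G 0))\<^sup>2"
      unfolding C_def G nrm N_def[symmetric] using gl(2) by blast
    show "\<forall>x. T 1 x = ?G x 0 / (?l * (l2_norm (?G 0))\<^sup>2)"
      unfolding T_def G nrm N_def[symmetric] using gt(2) by blast
    show "\<forall>n\<ge>2. \<forall>x y. C n x y = g_moment b n (\<lambda>k. C k 0 y) * D n x \<and> C n x y > 0"
      unfolding C_def using gl(3) gl(4)[OF order_trans[OF one_le_numeral]] by blast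
    show "\<forall>n\<ge>2. \<forall>x. T n x = g_moment b n (\<lambda>k. T k 0) * D n x \<and> T n x > 0"
      unfolding T_def using gt(3) gt(4)[OF order_trans[OF one_le_numeral]] by blast
    show "\<exists>nstar. \<forall>n\<ge>nstar. \<forall>x. \<bar>D n x\<bar> \<le> 2 / (real n * lambdaE a b)"
      using bound by blast
    show "\<forall>n\<ge>1. \<forall>x y. (\<lambda>t. local_moment M X n t x y) \<sim>[at_top] (\<lambda>t. C n x y * exp (real n * lambdaE a b * t))"
    proof (intro allI impI)
      fix n x y assume n: "(n::nat) \<ge> 1"
      show "(\<lambda>t. local_moment M X n t x y) \<sim>[at_top] (\<lambda>t. C n x y * exp (real n * lambdaE a b * t))"
        unfolding C_def by (rule moments_asymptotic[OF super growth ind lim_local C1_pos n local_moment_eq])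
    qed
    show "\<forall>n\<ge>1. \<forall>x. (\<lambda>t. total_moment M X n t x) \<sim>[at_top] (\<lambda>t. T n x * exp (real n * lambdaE a b * t))"
    proof (intro allI impI)
      fix n x assume n: "(n::nat) \<ge> 1"
      show "(\<lambda>t. total_moment M X n t x) \<sim>[at_top] (\<lambda>t. T n x * exp (real n * lambdaE a b * t))"
        unfolding T_def by (rule moments_asymptotic[OF super growth one lim_total T1_pos n total_moment_eq])
    qed
  qed
qed

end
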